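(* Suppose that the solution set $\Theta$ of the dual problem $\min\{\Phi(\lambda,p,\mu):(\lambda,p,\mu)\in L^2(\Omega)\times H_0^1(\Omega)\times L^2(\Omega)\}$ is non-empty and let $(\lambda^*,p^*,\mu^* )\in\Theta$. Let $\{(\lambda^k,p^k,\mu^k)\}_{k\ge1}$ be the sequence generated by the continuous sGS-mABCD algorithm started from $(\lambda^0,p^0,\mu^0)$. Then for all $k\ge 1$, $$\Phi(\lambda^k,p^k,\mu^k)-\Phi(\lambda^*,p^*,\mu^* )\le \frac{4\tau}{(k+1)^2},$$ where $$\tau=\frac{1}{2\alpha}\big\langle \lambda^*-\lambda^0,\ \mathcal{R}(\lambda^*-\lambda^0)\big\rangle_{L^2(\Omega)}+\frac{1}{2\alpha}\|\mu^*-\mu^0\|_{L^2(\Omega)}^2 .$$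
   Context: $\Omega\subset\mathbb{R}^n$, $n\in\{2,3\}$, is a convex, open, bounded domain with $C^{1,1}$ or polygonal boundary. Let $a_{ij}=a_{ji}\in L^\infty(\Omega)$, $c_0\in L^\infty(\Omega)$ with $c_0\ge0$, and assume uniform ellipticity: there is $\theta>0$ with $\sum_{i,j}a_{ij}(x)\xi_i\xi_j\ge\theta\|\xi\|^2$ for a.a. $x$ and all $\xi\in\mathbb{R}^n$. Define the bilinear form $a(y,v)=\int_\Omega\big(\sum_{i,j=1}^n a_{ji}y_{x_i}v_{x_j}+c_0yv\big)\,dx$ on $H_0^1(\Omega)$ and the operator $A:H_0^1(\Omega)\to H^{-1}(\Omega)$, $Ay=a(y,\cdot)$; since $a$ is symmetric, $A^*=A$. Data: $y_d,y_r\in L^2(\Omega)$, constants $a\le 0\le b$, $\alpha>0$, $\beta>0$; $U_{ad}=\{u\in L^2(\Omega): a\le u\le b \text{ a.e.}\}$. The dual objective is $$\Phi(\lambda,p,\mu)=\tfrac12\|A^*p-y_d\|_{L^2}^2+\tfrac1{2\alpha}\|p-\lambda-\mu\|_{L^2}^2+\langle p,y_r\rangle_{L^2}+\delta_{\beta B_\infty(0)}(\lambda)+\delta^*_{U_{ad}}(\mu)-\tfrac12\|y_d\|_{L^2}^2,$$ for $\lambda,\mu\in L^2(\Omega)$, $p\in H_0^1(\Omega)$ (the first term is $+\infty$ if $A^*p\notin L^2(\Omega)$), where $\delta_{\beta B_\infty(0)}$ is the indicator function of $\{\lambda\in L^2(\Omega):\|\lambda\|_{L^\infty}\le\beta\}$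 and $\delta^*_{U_{ad}}(\mu)=\sup_{u\in U_{ad}}\langle\mu,u\rangle_{L^2}=\int_\Omega\max(a\mu(x),b\mu(x))\,dx$. The operator $\mathcal{R}=(\alpha AA^*+\mathcal I)^{-1}$ on $L^2(\Omega)$ is defined as follows: for $f\in L^2(\Omega)$, $\mathcal{R}f:=q^1$, where $(q^1,q^2)\in H_0^1(\Omega)^2$ is the solution of $a(q^1,v)=\langle q^2,v\rangle_{L^2}$ and $\alpha a(q^2,v)+\langle q^1,v\rangle_{L^2}=\langle f,v\rangle_{L^2}$ for all $v\in H_0^1(\Omega)$. Continuous sGS-mABCD algorithm: given $(\lambda^0,p^0,\mu^0)\in L^2(\Omega)\times H_0^1(\Omega)\times L^2(\Omega)$ with $|\lambda^0|\le\beta$ a.e., set $(\tilde\lambda^1,\tilde p^1,\tilde\mu^1)=(\lambda^0,p^0,\mu^0)$, $t_1=1$. For $k=1,2,\dots$: (i) $\hat p^k=\arg\min_{p\in H_0^1}\{\tfrac12\|A^*p-y_d\|_{L^2}^2+\tfrac1{2\alpha}\|p-\tilde\lambda^k-\tilde\mu^k\|_{L^2}^2+\langle p,y_r\rangle_{L^2}\}$; (ii) $\lambda^k=\Pi_{[-\beta,\beta]}(\hat p^k-\tilde\mu^k)$ (pointwise projection); (iii) $p^k=\arg\min_{p\in H_0^1}\{\tfrac12\|A^*p-y_d\|_{L^2}^2+\tfrac1{2\alpha}\|p-\lambda^k-\tilde\mu^k\|_{L^2}^2+\langle p,y_r\rangle_{L^2}\}$; (iv) $\mu^k=\arg\min_\mu\{\tfrac1{2\alpha}\|\mu-(p^k-\lambda^k)\|_{L^2}^2+\delta^*_{U_{ad}}(\mu)\}=p^k-\lambda^k-\alpha\Pi_{[a,b]}(\tfrac1\alpha(p^k-\lambda^k))$;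 (v) $t_{k+1}=\frac{1+\sqrt{1+4t_k^2}}2$, $\beta_k=\frac{t_k-1}{t_{k+1}}$, and $\tilde\lambda^{k+1}=\lambda^k+\beta_k(\lambda^k-\lambda^{k-1})$, $\tilde p^{k+1}=p^k+\beta_k(p^k-p^{k-1})$, $\tilde\mu^{k+1}=\mu^k+\beta_k(\mu^k-\mu^{k-1})$. *)

theory Defs
  imports "HOL-Analysis.Analysis"
begin

type_synonym 'n fn = "real^'n \<Rightarrow> real"

definition C11_boundary :: "(real^'n::finite) set \<Rightarrow> bool" where
  "C11_boundary \<Omega> \<longleftrightarrow>
     (\<forall>x\<in>frontier \<Omega>. \<exists>r>0. \<exists>Q i0 (\<gamma>::real^'n \<Rightarrow> real) G L.
        orthogonal_transformation Q \<and>
        (\<forall>z s. \<gamma> (\<chi> j. if j = i0 then s else z $ j) = \<gamma> z) \<and>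
        (\<forall>u. (\<gamma> has_derivative (\<lambda>h. G u \<bullet> h)) (at u)) \<and>
        (\<forall>u v. norm (G u - G v) \<le> L * norm (u - v)) \<and>
        \<Omega> \<inter> ball x r = {y \<in> ball x r. Q (y - x) $ i0 < \<gamma> (Q (y - x))})"

definition polygonal_boundary :: "(real^'n::finite) set \<Rightarrow> bool" where
  "polygonal_boundary \<Omega> \<longleftrightarrow>
     (\<exists>F. finite F \<and> (\<forall>P\<in>F. polytope P \<and> aff_dim P = int CARD('n) - 1) \<and> frontier \<Omega> = \<Union>F)"

definition L2 :: "(real^'n::finite) set \<Rightarrow> 'n fn \<Rightarrow> bool" where
  "L2 \<Omega> f \<longleftrightarrow> f \<in> borel_measurable (lebesgue_on \<Omega>) \<and>
                integrable (lebesgue_on \<Omega>) (\<lambda>x. (f x)\<^sup>2)"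

definition ipL2 :: "(real^'n::finite) set \<Rightarrow> 'n fn \<Rightarrow> 'n fn \<Rightarrow> real" where
  "ipL2 \<Omega> f g = (\<integral>x. f x * g x \<partial>lebesgue_on \<Omega>)"

definition nrmL2 :: "(real^'n::finite) set \<Rightarrow> 'n fn \<Rightarrow> real" where
  "nrmL2 \<Omega> f = sqrt (ipL2 \<Omega> f f)"

definition partial :: "('n::finite) fn \<Rightarrow> 'n \<Rightarrow> 'n fn" where
  "partial \<phi> i = (\<lambda>x. frechet_derivative \<phi> (at x) (axis i 1))"

coinductive smooth_fn :: "('n::finite) fn \<Rightarrow> bool" where
  "(\<forall>x. \<phi> differentiable (at x)) \<Longrightarrow> (\<forall>i. smooth_fn (partial \<phi> i)) \<Longrightarrow> smooth_fn \<phi>"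

definition test_fn :: "(real^'n::finite) set \<Rightarrow> 'n fn \<Rightarrow> bool" where
  "test_fn \<Omega> \<phi> \<longleftrightarrow> smooth_fn \<phi> \<and> compact (closure {x. \<phi> x \<noteq> 0}) \<and>
                      closure {x. \<phi> x \<noteq> 0} \<subseteq> \<Omega>"

definition weak_grad :: "(real^'n::finite) set \<Rightarrow> 'n fn \<Rightarrow> (real^'n \<Rightarrow> real^'n) \<Rightarrow> bool" where
  "weak_grad \<Omega> p g \<longleftrightarrow>
     (\<forall>\<phi>. test_fn \<Omega> \<phi> \<longrightarrow> (\<forall>i. ipL2 \<Omega> p (partial \<phi> i) = - ipL2 \<Omega> (\<lambda>x. g x $ i) \<phi>))"

definition H01 :: "(real^'n::finite) set \<Rightarrow> 'n fn \<Rightarrow> bool" where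
  "H01 \<Omega> p \<longleftrightarrow> L2 \<Omega> p \<and>
     (\<exists>g. weak_grad \<Omega> p g \<and> (\<forall>i. L2 \<Omega> (\<lambda>x. g x $ i)) \<and>
        (\<exists>\<phi>. (\<forall>k. test_fn \<Omega> (\<phi> k)) \<and>
             (\<lambda>k. nrmL2 \<Omega> (\<lambda>x. \<phi> k x - p x)) \<longlonglongrightarrow> 0 \<and>
             (\<forall>i. (\<lambda>k. nrmL2 \<Omega> (\<lambda>x. partial (\<phi> k) i x - g x $ i)) \<longlonglongrightarrow> 0)))"

definition grad :: "(real^'n::finite) set \<Rightarrow> 'n fn \<Rightarrow> real^'n \<Rightarrow> real^'n" where
  "grad \<Omega> p = (SOME g. weak_grad \<Omega> p g \<and> (\<forall>i. L2 \<Omega> (\<lambda>x. g x $ i)))"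

text \<open>Coefficients: aa x \$ i \$ j = a_ij(x).\<close>
definition aform :: "(real^'n::finite) set \<Rightarrow> (real^'n \<Rightarrow> real^'n^'n) \<Rightarrow> 'n fn \<Rightarrow> 'n fn \<Rightarrow> 'n fn \<Rightarrow> real" where
  "aform \<Omega> aa c0 y v =
     (\<integral>x. (\<Sum>i\<in>UNIV. \<Sum>j\<in>UNIV. aa x $ j $ i * grad \<Omega> y x $ i * grad \<Omega> v x $ j)
          + c0 x * y x * v x \<partial>lebesgue_on \<Omega>)"

text \<open>f represents A^* p in L2: <A^* p, v> = a(v,p) for all v in H_0^1.\<close>
definition AstarL2 :: "(real^'n::finite) set \<Rightarrow> (real^'n \<Rightarrow> real^'n^'n) \<Rightarrow> 'n fn \<Rightarrow> 'n fn \<Rightarrow> 'n fn \<Rightarrow> bool" where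
  "AstarL2 \<Omega> aa c0 p f \<longleftrightarrow> L2 \<Omega> f \<and> (\<forall>v. H01 \<Omega> v \<longrightarrow> aform \<Omega> aa c0 v p = ipL2 \<Omega> f v)"

definition Astar :: "(real^'n::finite) set \<Rightarrow> (real^'n \<Rightarrow> real^'n^'n) \<Rightarrow> 'n fn \<Rightarrow> 'n fn \<Rightarrow> 'n fn" where
  "Astar \<Omega> aa c0 p = (SOME f. AstarL2 \<Omega> aa c0 p f)"

text \<open>R = (alpha A A^* + I)^{-1}, via the coupled system.\<close>
definition Rop :: "(real^'n::finite) set \<Rightarrow> (real^'n \<Rightarrow> real^'n^'n) \<Rightarrow> 'n fn \<Rightarrow> real \<Rightarrow> 'n fn \<Rightarrow> 'n fn" where
  "Rop \<Omega> aa c0 \<alpha> f = (SOME q1. \<exists>q2. H01 \<Omega> q1 \<and> H01 \<Omega> q2 \<and>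
      (\<forall>v. H01 \<Omega> v \<longrightarrow> aform \<Omega> aa c0 q1 v = ipL2 \<Omega> q2 v) \<and>
      (\<forall>v. H01 \<Omega> v \<longrightarrow> \<alpha> * aform \<Omega> aa c0 q2 v + ipL2 \<Omega> q1 v = ipL2 \<Omega> f v))"

definition dstar_Uad :: "(real^'n::finite) set \<Rightarrow> real \<Rightarrow> real \<Rightarrow> 'n fn \<Rightarrow> real" where
  "dstar_Uad \<Omega> ua ub \<mu> = (\<integral>x. max (ua * \<mu> x) (ub * \<mu> x) \<partial>lebesgue_on \<Omega>)"

definition Phi :: "(real^'n::finite) set \<Rightarrow> (real^'n \<Rightarrow> real^'n^'n) \<Rightarrow> 'n fn \<Rightarrow> 'n fn \<Rightarrow> 'n fn
     \<Rightarrow> real \<Rightarrow> real \<Rightarrow> real \<Rightarrow> real \<Rightarrow> 'n fn \<Rightarrow> 'n fn \<Rightarrow> 'n fn \<Rightarrow> ereal" where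
  "Phi \<Omega> aa c0 yd yr \<alpha> \<beta> ua ub l p \<mu> =
     (if (\<exists>f. AstarL2 \<Omega> aa c0 p f) \<and> (AE x in lebesgue_on \<Omega>. \<bar>l x\<bar> \<le> \<beta>)
      then ereal (1/2 * (nrmL2 \<Omega> (\<lambda>x. Astar \<Omega> aa c0 p x - yd x))\<^sup>2
                 + 1/(2*\<alpha>) * (nrmL2 \<Omega> (\<lambda>x. p x - l x - \<mu> x))\<^sup>2
                 + ipL2 \<Omega> p yr + dstar_Uad \<Omega> ua ub \<mu> - 1/2 * (nrmL2 \<Omega> yd)\<^sup>2)
      else \<infinity>)"

text \<open>Objective of the p-subproblems (i) and (iii), with w = lambda + mu.\<close>
definition Jp :: "(real^'n::finite) set \<Rightarrow> (real^'n \<Rightarrow> real^'n^'n) \<Rightarrow> 'n fn \<Rightarrow> 'n fn \<Rightarrow> 'n fn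
     \<Rightarrow> real \<Rightarrow> 'n fn \<Rightarrow> 'n fn \<Rightarrow> ereal" where
  "Jp \<Omega> aa c0 yd yr \<alpha> w p =
     (if (\<exists>f. AstarL2 \<Omega> aa c0 p f)
      then ereal (1/2 * (nrmL2 \<Omega> (\<lambda>x. Astar \<Omega> aa c0 p x - yd x))\<^sup>2
                 + 1/(2*\<alpha>) * (nrmL2 \<Omega> (\<lambda>x. p x - w x))\<^sup>2 + ipL2 \<Omega> p yr)
      else \<infinity>)"

definition is_argmin_p :: "(real^'n::finite) set \<Rightarrow> (real^'n \<Rightarrow> real^'n^'n) \<Rightarrow> 'n fn \<Rightarrow> 'n fn \<Rightarrow> 'n fn
     \<Rightarrow> real \<Rightarrow> 'n fn \<Rightarrow> 'n fn \<Rightarrow> bool" where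
  "is_argmin_p \<Omega> aa c0 yd yr \<alpha> w q \<longleftrightarrow> H01 \<Omega> q \<and>
     (\<forall>p. H01 \<Omega> p \<longrightarrow> Jp \<Omega> aa c0 yd yr \<alpha> w q \<le> Jp \<Omega> aa c0 yd yr \<alpha> w p)"

definition proj :: "real \<Rightarrow> real \<Rightarrow> real \<Rightarrow> real" where
  "proj lo hi s = max lo (min hi s)"

text \<open>tk k = t_k for k >= 1 (the value at 0 is a dummy and never used).\<close>
fun tk :: "nat \<Rightarrow> real" where
  "tk 0 = 1"
| "tk (Suc 0) = 1"
| "tk (Suc (Suc k)) = (1 + sqrt (1 + 4 * (tk (Suc k))\<^sup>2)) / 2"

definition bk :: "nat \<Rightarrow> real" where
  "bk k = (tk k - 1) / tk (Suc k)"

end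

theory Submission
  imports Defs
begin

text \<open>Eliminating \<open>p\<close>, one sweep (i)--(iii) of the symmetric Gauss--Seidel iteration is an exact
  minimisation in \<open>(\<lambda>, p)\<close> of the objective plus the proximal term
  \<open>\<langle>\<lambda> - \<lambda>t, R (\<lambda> - \<lambda>t)\<rangle> / (2 * \<alpha>)\<close>, because subtracting the Euler equations of the two
  \<open>p\<close>-steps gives \<open>p\<^sup>k - ph\<^sup>k = R (\<lambda>\<^sup>k - \<lambda>t\<^sup>k)\<close>. Alternating this with the exact \<open>\<mu>\<close>-step, the
  variational inequalities of both blocks and a completion of the square yield, for
  \<open>H (\<lambda>, \<mu>) = (\<langle>\<lambda>, R \<lambda>\<rangle> + \<parallel>\<mu>\<parallel>\<^sup>2) / (2 * \<alpha>)\<close>,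
  \<open>\<Phi>(v) - \<Phi>(v\<^sup>k) \<ge> H (v - v\<^sup>k) - H (v - vt\<^sup>k)\<close>
  at \<open>v = v\<^sup>k\<^sup>-\<^sup>1\<close> and at the solution, which is all that Nesterov's argument needs.
  Only weak formulations enter. The resolvent \<open>R\<close> exists by Lax--Milgram on \<open>H_0^1 \<times> H_0^1\<close>, with
  the Poincare inequality for coercivity; the fundamental lemma of the calculus of variations makes
  weak gradients and \<open>A p\<close> unique almost everywhere, so that the choices in \<^const>\<open>grad\<close>,
  \<^const>\<open>Astar\<close> and \<^const>\<open>Rop\<close> do not matter.\<close>

section \<open>Accelerated descent in an inner product space\<close>

text \<open>\<open>A\<close> is unbounded on L^2 and the objective is finite only on its domain. The
  abstract estimate therefore works with a linear subspace of pairs (p, A p) and tests every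
  optimality condition with such pairs. As (\<open>R f\<close>, \<open>AR f\<close>) is one of them,
  testing the resolvent equation gives \<open>f \<bullet> R g = \<alpha> * (AR f \<bullet> AR g) + R
  f \<bullet> R g\<close>, the source of symmetry and nonnegativity of \<open>R\<close>. The weight
  \<open>R\<close> on \<open>\<lambda>\<close> arises because \<open>\<lambda>\<close> is projected
  at the provisional \<open>ph\<close> while values are compared at the final \<open>p\<close>. The
  identity weight on \<open>\<mu>\<close> is the price of completing the square in the gap between
  \<open>\<mu>\<close> and its extrapolation. Since \<open>p\<close> is recomputed from
  \<open>\<lambda>\<close> and \<open>\<mu>\<close> in every sweep, only these two blocks carry a
  distance to the start. The factor 4 is the inverse square of the slope in
  \<open>tk k \<ge> (real k + 1) / 2\<close>. On the analytic side one Hilbert type serves all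
  domains; H_0^1 becomes a closed subspace of a product of copies, and existence theorems are proved
  relative to a closed subspace.\<close>

text \<open>\<open>G\<close> plays the role of the graph of the unbounded operator \<open>A\<close> and \<open>AR f\<close> that of \<open>A (R f)\<close>.\<close>
lemma mabcd_step:
  fixes G :: "('h::real_inner \<times> 'h) set" and R AR :: "'h \<Rightarrow> 'h" and \<alpha> sk sv :: real
  assumes \<alpha>: "\<alpha> > 0" and G: "subspace G"
    and R: "linear R" "\<And>f. (R f, AR f) \<in> G"
      "\<And>f v av. (v, av) \<in> G \<Longrightarrow> \<alpha> * (AR f \<bullet> av) + (R f - f) \<bullet> v = 0"
    and mem: "(ph, aph) \<in> G" "(pk, apk) \<in> G" "(pv, apv) \<in> G"
    and opt_i: "\<And>v av. (v, av) \<in> G \<Longrightarrow> (aph - yd) \<bullet> av + (ph - lt - mt) \<bullet> v / \<alpha> + v \<bullet> yr = 0"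
    and opt_ii: "(lk + mt - ph) \<bullet> (lv - lk) \<ge> 0"
    and opt_iii: "\<And>v av. (v, av) \<in> G \<Longrightarrow> (apk - yd) \<bullet> av + (pk - lk - mt) \<bullet> v / \<alpha> + v \<bullet> yr = 0"
    and opt_iv: "sv \<ge> sk + (pk - lk - mk) \<bullet> (mv - mk) / \<alpha>"
  shows "(1/2 * (norm (apv - yd))\<^sup>2 + 1/(2*\<alpha>) * (norm (pv - lv - mv))\<^sup>2 + pv \<bullet> yr + sv)
       - (1/2 * (norm (apk - yd))\<^sup>2 + 1/(2*\<alpha>) * (norm (pk - lk - mk))\<^sup>2 + pk \<bullet> yr + sk)
     \<ge> 1/(2*\<alpha>) * ((lv - lk) \<bullet> R (lv - lk) + (norm (mv - mk))\<^sup>2)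
       - 1/(2*\<alpha>) * ((lv - lt) \<bullet> R (lv - lt) + (norm (mv - mt))\<^sup>2)"
proof -
  have Rform: "f \<bullet> R g = \<alpha> * (AR f \<bullet> AR g) + R f \<bullet> R g" for f g
    using R(3)[OF R(2)[of g], of f] by (simp add: inner_diff_left)
  have Rsym: "f \<bullet> R g = g \<bullet> R f" for f g
    using Rform[of f g] Rform[of g f] by (simp add: inner_commute)
  have Rpos: "f \<bullet> R f \<ge> 0" for f
    using Rform[of f f] \<alpha> by simp
  define g where "g = lk - lt"
  have ph: "ph = pk - R g"
  proof -
    define d ad where "d = pk - ph - R g" and "ad = apk - aph - AR g"
    have "(pk, apk) - (ph, aph) - (R g, AR g) \<in> G"
      using mem R(2) G by (intro subspace_diff) auto
    then have dG: "(d, ad) \<in> G" by (simp add: d_def ad_def)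
    \<comment> \<open>The difference (\<open>d\<close>, \<open>ad\<close>) is itself an admissible
      test pair, and the three equations combine to a positive definite expression in it.\<close>
    have "\<alpha> * (ad \<bullet> ad) + d \<bullet> d = \<alpha> * ((apk - yd) \<bullet> ad + (pk - lk - mt) \<bullet> d / \<alpha> + d \<bullet> yr)
        - \<alpha> * ((aph - yd) \<bullet> ad + (ph - lt - mt) \<bullet> d / \<alpha> + d \<bullet> yr)
        - (\<alpha> * (AR g \<bullet> ad) + (R g - g) \<bullet> d)"
      using \<alpha> by (simp add: d_def ad_def g_def field_simps inner_diff_left inner_diff_right inner_add_left inner_add_right inner_commute)
    also have "\<dots> = 0"
      using opt_i[OF dG] opt_iii[OF dG] R(3)[OF dG, of g] by simp
    finally have "\<alpha> * (ad \<bullet> ad) + d \<bullet> d = 0" .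
    moreover have "\<alpha> * (ad \<bullet> ad) \<ge> 0" using \<alpha> by simp
    ultimately have "d \<bullet> d = 0" using inner_ge_zero[of d] by linarith
    then have "d = 0" by simp
    then show ?thesis by (simp add: d_def algebra_simps)
  qed
  \<comment> \<open>\<open>r\<close> is the residual at the new iterate; \<open>e\<close> and
    \<open>g\<close> measure how far \<open>mk\<close> and \<open>lk\<close> moved from the
    extrapolated \<open>mt\<close> and \<open>lt\<close>. In these variables the optimality
    conditions are linear in the increments towards the comparison point.\<close>
  define r e dl dm dp dap where "r = pk - lk - mk" and "e = mk - mt" and "dl = lv - lk"
    and "dm = mv - mk" and "dp = pv - pk" and "dap = apv - apk"
  have dG: "(dp, dap) \<in> G"
    using subspace_diff[OF G mem(3) mem(2)] by (simp add: dp_def dap_def)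
  have v: "apv = apk + dap" "pv = pk + dp" "lv = lk + dl" "mv = mk + dm" "mt = mk - e" "lt = lk - g"
    by (simp_all add: r_def e_def dl_def dm_def dp_def dap_def g_def)
  have pk: "pk = r + lk + mk" by (simp add: r_def)
  have iii: "\<alpha> * ((apk - yd) \<bullet> dap) + (r + e) \<bullet> dp + \<alpha> * (dp \<bullet> yr) = 0"
  proof -
    have "(apk - yd) \<bullet> dap + (r + e) \<bullet> dp / \<alpha> + dp \<bullet> yr = 0"
      using opt_iii[OF dG] by (simp add: r_def e_def algebra_simps)
    then have "\<alpha> * ((apk - yd) \<bullet> dap + (r + e) \<bullet> dp / \<alpha> + dp \<bullet> yr) = 0" by simp
    then show ?thesis using \<alpha> by (simp add: distrib_left)
  qed
  have ii: "(R g - r - e) \<bullet> dl \<ge> 0"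
    using opt_ii unfolding ph by (simp add: r_def e_def dl_def algebra_simps)
  have iv: "\<alpha> * (sv - sk) \<ge> r \<bullet> dm"
  proof -
    have "r \<bullet> dm / \<alpha> \<le> sv - sk" using opt_iv by (simp add: r_def dm_def)
    then show ?thesis using \<alpha> by (simp add: field_simps)
  qed
  \<comment> \<open>Completing the square in \<open>dp - dl - dm\<close> against \<open>e\<close>
    costs the square of \<open>norm e\<close>; together with \<open>- 2 * (e \<bullet> dm)\<close>
    this is the difference of the squares of \<open>norm dm\<close> and
    \<open>norm (dm + e)\<close>. The term \<open>g \<bullet> R g\<close> does the same for
    \<open>\<lambda>\<close>.\<close>
  have pos: "0 \<le> \<alpha> * (dap \<bullet> dap) + (dp - dl - dm - e) \<bullet> (dp - dl - dm - e) + g \<bullet> R g"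
    using \<alpha> Rpos by (intro add_nonneg_nonneg mult_nonneg_nonneg inner_ge_zero) auto
  have gen: "y - w \<le> 2 * a + 2 * (z - x) + 2 * b + d + y - w"
    if "a = 0" "x \<le> z" "0 \<le> b" "0 \<le> d" for a b d x y z w :: real
    using that by simp
  have "2 * \<alpha> * ((1/2 * (norm (apv - yd))\<^sup>2 + 1/(2*\<alpha>) * (norm (pv - lv - mv))\<^sup>2 + pv \<bullet> yr + sv)
       - (1/2 * (norm (apk - yd))\<^sup>2 + 1/(2*\<alpha>) * (norm (pk - lk - mk))\<^sup>2 + pk \<bullet> yr + sk))
     = \<alpha> * (norm (apv - yd))\<^sup>2 + (norm (pv - lv - mv))\<^sup>2 + 2 * \<alpha> * (pv \<bullet> yr + sv)
       - (\<alpha> * (norm (apk - yd))\<^sup>2 + (norm (pk - lk - mk))\<^sup>2 + 2 * \<alpha> * (pk \<bullet> yr + sk))"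
    using \<alpha> by (simp add: field_simps)
  also have "\<dots> = 2 * (\<alpha> * ((apk - yd) \<bullet> dap) + (r + e) \<bullet> dp + \<alpha> * (dp \<bullet> yr))
      + 2 * (\<alpha> * (sv - sk) - r \<bullet> dm) + 2 * ((R g - r - e) \<bullet> dl)
      + (\<alpha> * (dap \<bullet> dap) + (dp - dl - dm - e) \<bullet> (dp - dl - dm - e) + g \<bullet> R g)
      + (dl \<bullet> R dl + (norm dm)\<^sup>2) - ((dl + g) \<bullet> R (dl + g) + (norm (dm + e))\<^sup>2)"
    using Rsym[of g dl]
    unfolding v power2_norm_eq_inner linear_add[OF R(1)] pk
    by (simp add: algebra_simps inner_commute)
  also have "\<dots> \<ge> (dl \<bullet> R dl + (norm dm)\<^sup>2) - ((dl + g) \<bullet> R (dl + g) + (norm (dm + e))\<^sup>2)"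
    by (rule gen[OF iii iv ii pos])
  finally have "(lv - lk) \<bullet> R (lv - lk) + (norm (mv - mk))\<^sup>2
       - ((lv - lt) \<bullet> R (lv - lt) + (norm (mv - mt))\<^sup>2) \<le>
      2 * \<alpha> * ((1/2 * (norm (apv - yd))\<^sup>2 + 1/(2*\<alpha>) * (norm (pv - lv - mv))\<^sup>2 + pv \<bullet> yr + sv)
       - (1/2 * (norm (apk - yd))\<^sup>2 + 1/(2*\<alpha>) * (norm (pk - lk - mk))\<^sup>2 + pk \<bullet> yr + sk))"
    unfolding v by (simp add: algebra_simps)
  then show ?thesis
    unfolding right_diff_distrib[symmetric]
    using \<alpha> by (simp add: pos_divide_le_eq mult.commute)
qed

section \<open>Step sizes and the decay of the energy\<close>

lemma tk_ge: "k \<ge> 1 \<Longrightarrow> tk k \<ge> (real k + 1) / 2"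
proof (induction k rule: nat_induct_at_least)
  case (Suc k)
  then obtain j where k: "k = Suc j" by (metis Suc_le_D One_nat_def)
  \<comment> \<open>Each step thus adds at least one half to \<open>tk\<close>, starting from
    1.\<close>
  have "2 * tk k \<le> sqrt (1 + 4 * (tk k)\<^sup>2)"
    by (rule real_le_rsqrt) (simp add: power2_eq_square)
  then show ?case using Suc k by (simp add: field_simps)
qed simp

text \<open>\<open>tk (Suc k)\<close> is the positive root of
  \<open>x\<^sup>2 - x = (tk k)\<^sup>2\<close>; with this choice the weights of consecutive
  objective gaps match and the estimate telescopes.\<close>

lemma tk_rec:
  assumes "k \<ge> 1" shows "(tk (Suc k))\<^sup>2 - tk (Suc k) = (tk k)\<^sup>2"
proof -
  obtain j where k: "k = Suc j" using assms by (metis Suc_le_D One_nat_def)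
  have "(sqrt (1 + 4 * (tk k)\<^sup>2))\<^sup>2 = 1 + 4 * (tk k)\<^sup>2" by simp
  then show ?thesis unfolding k by (simp add: power2_eq_square field_simps)
qed

text \<open>The factor \<open>1 / (2 * \<alpha>)\<close> of \<open>H\<close> is kept outside, so
  that scaling and polarisation stay free of \<open>\<alpha>\<close>.\<close>

definition hquad :: "('h::real_inner \<Rightarrow> 'h) \<Rightarrow> 'h \<Rightarrow> 'h \<Rightarrow> real" where
  "hquad R l m = l \<bullet> R l + (norm m)\<^sup>2"

lemma hquad_scale:
  "linear R \<Longrightarrow> hquad R (c *\<^sub>R l) (c *\<^sub>R m) = c\<^sup>2 * hquad R l m"
  by (simp add: hquad_def linear_cmul power2_eq_square algebra_simps)

text \<open>Only differences of \<^const>\<open>hquad\<close> at two points are averaged; these are affine in the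
  base point, so the estimate may be evaluated separately at the previous iterate and at the
  solution.\<close>
lemma hquad_diff_convex:
  assumes R: "linear R" and t: "(t::real) \<noteq> 0"
    and sym: "\<And>f g. f \<bullet> R g = g \<bullet> R f"
  shows "t\<^sup>2 * ((1 - 1/t) * (hquad R (l1 - lk) (m1 - mk) - hquad R (l1 - lt) (m1 - mt))
          + (1/t) * (hquad R (ls - lk) (ms - mk) - hquad R (ls - lt) (ms - mt)))
       = hquad R (ls - (t *\<^sub>R lk - (t - 1) *\<^sub>R l1)) (ms - (t *\<^sub>R mk - (t - 1) *\<^sub>R m1))
         - hquad R (ls - (t *\<^sub>R lt - (t - 1) *\<^sub>R l1)) (ms - (t *\<^sub>R mt - (t - 1) *\<^sub>R m1))"
proof -
  have H: "hquad R (a - b) (c - d) = hquad R a c + hquad R b d - 2 * (a \<bullet> R b) - 2 * (c \<bullet> d)" for a b c d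
    using sym[of a b]
    by (simp add: hquad_def linear_diff[OF R] power2_norm_eq_inner algebra_simps inner_commute)
  have e: "ls - (t *\<^sub>R x - (t - 1) *\<^sub>R y) = (ls + (t - 1) *\<^sub>R y) - t *\<^sub>R x" for ls x y :: 'a
    by simp
  have "t\<^sup>2 * ((1 - 1/t) * X + (1/t) * Y) = t * ((t - 1) * X + Y)" for X Y
    using t by (simp add: power2_eq_square field_simps)
  then show ?thesis
    unfolding e H hquad_scale[OF R]
    by (simp add: linear_add[OF R] linear_cmul[OF R] algebra_simps power2_eq_square)
qed

text \<open>With v standing for both \<open>lam\<close> and \<open>mu\<close>, the energy consists
  of the gap times \<open>(tk k)\<^sup>2\<close> and of \<open>hquad\<close> of the distance from
  the solution to tk k * v k - (tk k - 1) * v (k - 1); it does not increase. Comparisons are made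
  with iterates of positive index and with the solution, because the objective may be infinite at
  the starting point.\<close>

theorem mabcd_rate:
  fixes G :: "('h::real_inner \<times> 'h) set" and R AR :: "'h \<Rightarrow> 'h" and \<alpha> :: real
    and lam p ap mu lt mt ph aph :: "nat \<Rightarrow> 'h" and s :: "nat \<Rightarrow> real"
  assumes \<alpha>: "\<alpha> > 0" and G: "subspace G"
    and R: "linear R" "\<And>f. (R f, AR f) \<in> G"
      "\<And>f v av. (v, av) \<in> G \<Longrightarrow> \<alpha> * (AR f \<bullet> av) + (R f - f) \<bullet> v = 0"
    and mem: "\<And>k. k \<ge> 1 \<Longrightarrow> (ph k, aph k) \<in> G" "\<And>k. k \<ge> 1 \<Longrightarrow> (p k, ap k) \<in> G" "(ps, aps) \<in> G"
    and opt_i: "\<And>k v av. k \<ge> 1 \<Longrightarrow> (v, av) \<in> G \<Longrightarrow>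
      (aph k - yd) \<bullet> av + (ph k - lt k - mt k) \<bullet> v / \<alpha> + v \<bullet> yr = 0"
    and opt_ii: "\<And>k j. k \<ge> 1 \<Longrightarrow> j \<ge> 1 \<Longrightarrow> (lam k + mt k - ph k) \<bullet> (lam j - lam k) \<ge> 0"
      "\<And>k. k \<ge> 1 \<Longrightarrow> (lam k + mt k - ph k) \<bullet> (ls - lam k) \<ge> 0"
    and opt_iii: "\<And>k v av. k \<ge> 1 \<Longrightarrow> (v, av) \<in> G \<Longrightarrow>
      (ap k - yd) \<bullet> av + (p k - lam k - mt k) \<bullet> v / \<alpha> + v \<bullet> yr = 0"
    and opt_iv: "\<And>k j. k \<ge> 1 \<Longrightarrow> j \<ge> 1 \<Longrightarrow> s j \<ge> s k + (p k - lam k - mu k) \<bullet> (mu j - mu k) / \<alpha>"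
      "\<And>k. k \<ge> 1 \<Longrightarrow> ss \<ge> s k + (p k - lam k - mu k) \<bullet> (ms - mu k) / \<alpha>"
    and start: "lt 1 = lam 0" "mt 1 = mu 0"
    and extra: "\<And>k. k \<ge> 1 \<Longrightarrow> lt (Suc k) = lam k + bk k *\<^sub>R (lam k - lam (k - 1))"
      "\<And>k. k \<ge> 1 \<Longrightarrow> mt (Suc k) = mu k + bk k *\<^sub>R (mu k - mu (k - 1))"
    and k: "k \<ge> 1"
  defines "F \<equiv> \<lambda>k. 1/2 * (norm (ap k - yd))\<^sup>2 + 1/(2*\<alpha>) * (norm (p k - lam k - mu k))\<^sup>2 + p k \<bullet> yr + s k"
    and "Fs \<equiv> 1/2 * (norm (aps - yd))\<^sup>2 + 1/(2*\<alpha>) * (norm (ps - ls - ms))\<^sup>2 + ps \<bullet> yr + ss"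
  shows "F k - Fs \<le> 4 * (1/(2*\<alpha>) * ((ls - lam 0) \<bullet> R (ls - lam 0)) + 1/(2*\<alpha>) * (norm (ms - mu 0))\<^sup>2)
            / (real k + 1)\<^sup>2"
proof -
  have Rform: "f \<bullet> R g = \<alpha> * (AR f \<bullet> AR g) + R f \<bullet> R g" for f g
    using R(3)[OF R(2)[of g], of f] by (simp add: inner_diff_left)
  have Rsym: "f \<bullet> R g = g \<bullet> R f" for f g
    using Rform[of f g] Rform[of g f] by (simp add: inner_commute)
  have hpos: "hquad R f m \<ge> 0" for f m
    using Rform[of f f] \<alpha> by (simp add: hquad_def)
  define c where "c = 1/(2*\<alpha>)"
  have c: "c > 0" using \<alpha> by (simp add: c_def)
  have step: "F j - F k \<ge> c * (hquad R (lam j - lam k) (mu j - mu k) - hquad R (lam j - lt k) (mu j - mt k))"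
    if "k \<ge> 1" "j \<ge> 1" for j k
    using mabcd_step[OF \<alpha> G R mem(1)[OF that(1)] mem(2)[OF that(1)] mem(2)[OF that(2)]
        opt_i[OF that(1)] opt_ii(1)[OF that] opt_iii[OF that(1)] opt_iv(1)[OF that]]
    unfolding F_def c_def hquad_def right_diff_distrib by simp
  have steps: "Fs - F k \<ge> c * (hquad R (ls - lam k) (ms - mu k) - hquad R (ls - lt k) (ms - mt k))"
    if "k \<ge> 1" for k
    using mabcd_step[OF \<alpha> G R mem(1)[OF that(1)] mem(2)[OF that(1)] mem(3)
        opt_i[OF that(1)] opt_ii(2)[OF that] opt_iii[OF that(1)] opt_iv(2)[OF that]]
    unfolding F_def Fs_def c_def hquad_def right_diff_distrib by simp
  define ul um where "ul = (\<lambda>k. tk k *\<^sub>R lam k - (tk k - 1) *\<^sub>R lam (k - 1))"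
    and "um = (\<lambda>k. tk k *\<^sub>R mu k - (tk k - 1) *\<^sub>R mu (k - 1))"
  have tpos: "tk k > 0" if "k \<ge> 1" for k using tk_ge[OF that] by simp
  \<comment> \<open>This inverts the extrapolation: since
    \<open>bk k = (tk k - 1) / tk (Suc k)\<close>, the auxiliary point built from the extrapolated
    values at \<open>Suc k\<close> is the one built from the iterates at \<open>k\<close>.\<close>
  have extrapol: "t *\<^sub>R (x + ((t0 - 1)/t) *\<^sub>R (x - y)) - (t - 1) *\<^sub>R x = t0 *\<^sub>R x - (t0 - 1) *\<^sub>R y"
    if "t \<noteq> 0" for t t0 :: real and x y :: 'h
  proof -
    have "t *\<^sub>R (x + ((t0 - 1)/t) *\<^sub>R (x - y)) = t *\<^sub>R x + (t0 - 1) *\<^sub>R (x - y)"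
      using that by (simp add: scaleR_add_right)
    then show ?thesis by (simp add: algebra_simps)
  qed
  have "(tk k)\<^sup>2 * (F k - Fs) + c * hquad R (ls - ul k) (ms - um k) \<le> c * hquad R (ls - lam 0) (ms - mu 0)"
    using k
  proof (induction k rule: nat_induct_at_least)
    case base
    \<comment> \<open>As \<open>tk 1 = 1\<close>, \<open>ul 1\<close> is \<open>lam 1\<close> and
      only the comparison with the solution enters.\<close>
    show ?case using steps[of 1] start by (simp add: ul_def um_def algebra_simps)
  next
    case (Suc k)
    define t where "t = tk (Suc k)"
    have t: "t > 0" using tpos[of "Suc k"] by (simp add: t_def)
    have t1: "t \<ge> 1" using tk_ge[of "Suc k"] Suc.hyps by (simp add: t_def)
    let ?D1 = "hquad R (lam k - lam (Suc k)) (mu k - mu (Suc k)) - hquad R (lam k - lt (Suc k)) (mu k - mt (Suc k))"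
    let ?D2 = "hquad R (ls - lam (Suc k)) (ms - mu (Suc k)) - hquad R (ls - lt (Suc k)) (ms - mt (Suc k))"
    have u: "t *\<^sub>R lt (Suc k) - (t - 1) *\<^sub>R lam k = ul k" "t *\<^sub>R mt (Suc k) - (t - 1) *\<^sub>R mu k = um k"
      using extra[OF Suc.hyps] t extrapol[of t] by (simp_all add: ul_def um_def bk_def t_def)
    have u': "t *\<^sub>R lam (Suc k) - (t - 1) *\<^sub>R lam k = ul (Suc k)"
      "t *\<^sub>R mu (Suc k) - (t - 1) *\<^sub>R mu k = um (Suc k)"
      by (simp_all add: ul_def um_def t_def)
    \<comment> \<open>Both weights are nonnegative because \<open>t \<ge> 1\<close>; after
      multiplication by \<open>t\<^sup>2\<close> the previous gap gets the coefficient
      \<open>t\<^sup>2 - t\<close>, which \<open>tk_rec\<close> evaluates.\<close>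
    have "(1 - 1/t) * (c * ?D1) + (1/t) * (c * ?D2) \<le> (1 - 1/t) * (F k - F (Suc k)) + (1/t) * (Fs - F (Suc k))"
      using step[of "Suc k" k] steps[of "Suc k"] Suc.hyps t t1
      by (intro add_mono mult_left_mono) (auto simp: field_simps)
    then have "t\<^sup>2 * ((1 - 1/t) * (c * ?D1) + (1/t) * (c * ?D2)) \<le> t\<^sup>2 * ((1 - 1/t) * (F k - F (Suc k)) + (1/t) * (Fs - F (Suc k)))"
      by (intro mult_left_mono) auto
    also have "\<dots> = (t\<^sup>2 - t) * (F k - Fs) - t\<^sup>2 * (F (Suc k) - Fs)"
      using t by (simp add: field_simps power2_eq_square)
    also have "t\<^sup>2 - t = (tk k)\<^sup>2" using tk_rec[OF Suc.hyps] by (simp add: t_def)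
    finally have "c * (t\<^sup>2 * ((1 - 1/t) * ?D1 + (1/t) * ?D2)) \<le> (tk k)\<^sup>2 * (F k - Fs) - t\<^sup>2 * (F (Suc k) - Fs)"
      by (simp add: algebra_simps)
    then have "c * (hquad R (ls - ul (Suc k)) (ms - um (Suc k)) - hquad R (ls - ul k) (ms - um k))
       \<le> (tk k)\<^sup>2 * (F k - Fs) - t\<^sup>2 * (F (Suc k) - Fs)"
      using hquad_diff_convex[OF R(1) _ Rsym, of t "lam k" "lam (Suc k)" "mu k" "mu (Suc k)" "lt (Suc k)" "mt (Suc k)" ls ms] t
      by (simp only: u u')
    with Suc.IH show ?case by (simp add: t_def algebra_simps)
  qed
  then have "(tk k)\<^sup>2 * (F k - Fs) \<le> c * hquad R (ls - lam 0) (ms - mu 0)"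
    using c hpos by (smt (verit) mult_nonneg_nonneg)
  moreover have "((real k + 1)/2)\<^sup>2 \<le> (tk k)\<^sup>2"
    using tk_ge[OF k] by (intro power_mono) auto
  \<comment> \<open>No sign of \<open>F k - Fs\<close> is assumed: a nonnegative gap lets
    \<open>tk k\<close> be replaced by its lower bound, and for a negative one the left side is
    nonpositive while the right side is nonnegative.\<close>
  ultimately have "((real k + 1)/2)\<^sup>2 * (F k - Fs) \<le> c * hquad R (ls - lam 0) (ms - mu 0)"
    using c hpos[of "ls - lam 0" "ms - mu 0"]
    by (smt (verit) mult_nonneg_nonneg mult_nonneg_nonpos mult_right_mono zero_le_power2)
  then have "F k - Fs \<le> 4 * (c * hquad R (ls - lam 0) (ms - mu 0)) / (real k + 1)\<^sup>2"
    by (simp add: pos_le_divide_eq power_divide mult.commute)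
  then show ?thesis by (simp add: c_def hquad_def algebra_simps)
qed

section \<open>The Lax--Milgram theorem\<close>

text \<open>Minimise \<open>v \<bullet> v - 2 * l v\<close> over \<open>S\<close>: the parallelogram
  law makes a minimising sequence Cauchy, and the first variation at its limit is the required
  identity. The relative form is chosen because H_0^1 will be a subset of a Hilbert type and not a
  type of its own.\<close>

lemma riesz_closed_subspace:
  fixes S :: "'h::{real_inner, banach} set" and l :: "'h \<Rightarrow> real"
  assumes S: "subspace S" "closed S" and l: "bounded_linear l"
  shows "\<exists>u\<in>S. \<forall>v\<in>S. u \<bullet> v = l v"
proof -
  interpret l: bounded_linear l by fact
  define J where "J = (\<lambda>v. v \<bullet> v - 2 * l v)"
  obtain K where K: "\<And>v. \<bar>l v\<bar> \<le> norm v * K"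
    using l.bounded by (auto simp: real_norm_def)
  have Jlow: "J v \<ge> - K\<^sup>2" for v
  proof -
    have "(norm v - K)\<^sup>2 \<ge> 0" by simp
    then have "- K\<^sup>2 \<le> (norm v)\<^sup>2 - 2 * (norm v * K)" by (simp add: power2_diff algebra_simps)
    also have "\<dots> \<le> J v" using K[of v] by (simp add: J_def power2_norm_eq_inner)
    finally show ?thesis .
  qed
  define m where "m = Inf (J ` S)"
  have bdd: "bdd_below (J ` S)" using Jlow by (intro bdd_belowI2)
  have ne: "J ` S \<noteq> {}" using S subspace_0 by auto
  have mle: "m \<le> J v" if "v \<in> S" for v
    unfolding m_def using bdd that by (intro cInf_lower) auto
  have "\<exists>v\<in>S. J v < m + inverse (real (Suc n))" for n
  proof -
    have "m < m + inverse (real (Suc n))" by simp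
    then show ?thesis unfolding m_def cInf_less_iff[OF ne bdd] by auto
  qed
  then obtain v where v: "\<And>n. v n \<in> S" "\<And>n. J (v n) < m + inverse (real (Suc n))" by metis
  \<comment> \<open>The linear part of \<open>J\<close> cancels between the midpoint and the two
    endpoints, leaving the parallelogram identity.\<close>
  have par: "(norm (v i - v j))\<^sup>2 \<le> 2 * (inverse (real (Suc i)) + inverse (real (Suc j)))" for i j
  proof -
    let ?w = "(1/2) *\<^sub>R (v i + v j)"
    have "?w \<in> S" using S v by (intro subspace_mul subspace_add)
    then have "m \<le> J ?w" by (rule mle)
    moreover have "(norm (v i - v j))\<^sup>2 = 2 * J (v i) + 2 * J (v j) - 4 * J ?w"
      by (simp add: J_def power2_norm_eq_inner l.scaleR l.add algebra_simps inner_commute)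
    ultimately show ?thesis using v(2)[of i] v(2)[of j] by simp
  qed
  have "Cauchy v"
  proof (rule metric_CauchyI)
    fix e :: real assume e: "e > 0"
    then obtain N where N: "inverse (real (Suc N)) < e\<^sup>2 / 4"
      using reals_Archimedean[of "e\<^sup>2 / 4"] by auto
    show "\<exists>M. \<forall>i\<ge>M. \<forall>j\<ge>M. dist (v i) (v j) < e"
    proof (intro exI allI impI)
      fix i j assume ij: "i \<ge> N" "j \<ge> N"
      have "inverse (real (Suc i)) \<le> inverse (real (Suc N))" "inverse (real (Suc j)) \<le> inverse (real (Suc N))"
        using ij by (auto intro!: le_imp_inverse_le)
      then have "2 * (inverse (real (Suc i)) + inverse (real (Suc j)))
          \<le> 2 * (inverse (real (Suc N)) + inverse (real (Suc N)))"
        by (intro mult_left_mono add_mono) auto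
      also have "\<dots> < e\<^sup>2" using N by simp
      finally have "(norm (v i - v j))\<^sup>2 < e\<^sup>2" using par[of i j] by (rule le_less_trans[rotated])
      then show "dist (v i) (v j) < e" using e by (auto simp: dist_norm intro: power2_less_imp_less)
    qed
  qed
  then obtain u where u: "v \<longlonglongrightarrow> u" using Cauchy_convergent convergent_def by blast
  have uS: "u \<in> S" using S(2) u v(1) closed_sequentially by blast
  have "(\<lambda>n. J (v n)) \<longlonglongrightarrow> J u"
    unfolding J_def by (intro tendsto_intros u l.tendsto)
  moreover have "(\<lambda>n. m + inverse (real (Suc n))) \<longlonglongrightarrow> m + 0"
    by (intro tendsto_intros LIMSEQ_inverse_real_of_nat)
  ultimately have Ju: "J u \<le> m"
    using LIMSEQ_le[of "\<lambda>n. J (v n)" "J u" "\<lambda>n. m + inverse (real (Suc n))" m] v(2) less_imp_le by auto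
  have "u \<bullet> w = l w" if w: "w \<in> S" for w
  proof -
    define d where "d = u \<bullet> w - l w"
    \<comment> \<open>Both signs of \<open>t\<close> are available, which leaves no room for a
      nonzero \<open>d\<close>; \<open>t = - d / (w \<bullet> w)\<close>, used below, is the vertex
      of this parabola.\<close>
    have *: "0 \<le> 2 * t * d + t\<^sup>2 * (w \<bullet> w)" for t
    proof -
      have "J u \<le> J (u + t *\<^sub>R w)"
        using Ju mle[OF subspace_add[OF S(1) uS subspace_mul[OF S(1) w]], of t] by linarith
      then show ?thesis
        by (simp add: J_def d_def l.add l.scaleR algebra_simps inner_commute power2_eq_square)
    qed
    have "d = 0"
    proof (cases "w \<bullet> w = 0")
      case True
      then show ?thesis using *[of 1] *[of "-1"] by simp
    next
      case False
      then have pos: "w \<bullet> w > 0" by simp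
      have "0 \<le> - (d\<^sup>2 / (w \<bullet> w))"
        using *[of "- d / (w \<bullet> w)"] pos by (simp add: power2_eq_square field_simps)
      then show ?thesis using pos by (simp add: divide_le_0_iff)
    qed
    then show ?thesis by (simp add: d_def)
  qed
  then show ?thesis using uS by blast
qed

text \<open>With \<open>T u\<close> representing \<open>B u\<close> on \<open>S\<close>, the map
  \<open>u - \<rho> *\<^sub>R (T u - r)\<close> contracts \<open>S\<close> for a suitable
  \<open>\<rho>\<close>, and its fixed point satisfies \<open>T u = r\<close>. A fixed point
  replaces a minimisation because the form of the coupled system is not symmetric.\<close>

lemma lax_milgram:
  fixes S :: "'h::{real_inner, banach} set" and B :: "'h \<Rightarrow> 'h \<Rightarrow> real"
  assumes S: "subspace S" "closed S" and l: "bounded_linear l" and B: "bounded_bilinear B"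
    and c: "c > 0" "\<And>v. v \<in> S \<Longrightarrow> c * (norm v)\<^sup>2 \<le> B v v"
  shows "\<exists>u\<in>S. \<forall>v\<in>S. B u v = l v"
proof -
  interpret B: bounded_bilinear B by fact
  obtain K where K: "K > 0" "\<And>u v. \<bar>B u v\<bar> \<le> norm u * norm v * K"
    using B.pos_bounded by (auto simp: real_norm_def)
  obtain r where r: "r \<in> S" "\<And>v. v \<in> S \<Longrightarrow> r \<bullet> v = l v"
    using riesz_closed_subspace[OF S l] by metis
  have "\<exists>w\<in>S. \<forall>v\<in>S. w \<bullet> v = B u v" for u
    by (rule riesz_closed_subspace[OF S B.bounded_linear_right])
  then obtain T where T: "\<And>u. T u \<in> S" "\<And>u v. v \<in> S \<Longrightarrow> T u \<bullet> v = B u v" by metis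
  have Tn: "norm (T u) \<le> K * norm u" for u
  proof (cases "T u = 0")
    case False
    have "norm (T u) * norm (T u) = B u (T u)"
      using T[of u] T(2)[of "T u" u] by (metis power2_eq_square power2_norm_eq_inner)
    also have "\<dots> \<le> (K * norm u) * norm (T u)" using K(2)[of u "T u"] by (simp add: mult.commute mult.left_commute)
    finally show ?thesis using False by (simp add: mult_le_cancel_right)
  qed (use K in simp)
  have Tdiff: "T u - T w = T (u - w)" for u w
  proof -
    have "(T u - T w - T (u - w)) \<bullet> v = 0" if "v \<in> S" for v
      using that by (simp add: T inner_diff_left B.diff_left)
    moreover have "T u - T w - T (u - w) \<in> S" using T S by (intro subspace_diff)
    ultimately have "(T u - T w - T (u - w)) \<bullet> (T u - T w - T (u - w)) = 0" by blast
    then show ?thesis by (simp only: inner_eq_zero_iff right_minus_eq)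
  qed
  \<comment> \<open>The expression \<open>1 - 2 * \<rho> * c + \<rho>\<^sup>2 * K\<^sup>2\<close> is
    smallest at \<open>c / K\<^sup>2\<close>; with \<open>c\<^sup>2\<close> added to the denominator
    the bound \<open>q\<close> lies in [0, 1) without any comparison of \<open>c\<close> and
    \<open>K\<close>.\<close>
  define \<rho> where "\<rho> = c / (K\<^sup>2 + c\<^sup>2)"
  define q where "q = 1 - c\<^sup>2 / (K\<^sup>2 + c\<^sup>2)"
  have den: "K\<^sup>2 + c\<^sup>2 > 0" using K c by (simp add: add_pos_pos)
  have \<rho>: "\<rho> > 0" using c den by (simp add: \<rho>_def)
  have q: "0 \<le> q" "q < 1" using c K den by (auto simp: q_def field_simps)
  have contr: "norm (d - \<rho> *\<^sub>R T d) \<le> sqrt q * norm d" if d: "d \<in> S" for d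
  proof -
    have "(norm (d - \<rho> *\<^sub>R T d))\<^sup>2 = (norm d)\<^sup>2 - 2 * \<rho> * B d d + \<rho>\<^sup>2 * (norm (T d))\<^sup>2"
      using T(2)[OF d, of d] unfolding power2_norm_eq_inner
      by (simp add: algebra_simps inner_commute power2_eq_square)
    also have "\<dots> \<le> (norm d)\<^sup>2 - 2 * \<rho> * (c * (norm d)\<^sup>2) + \<rho>\<^sup>2 * (K * norm d)\<^sup>2"
      using c(2)[OF d] \<rho> Tn[of d] by (intro add_mono diff_mono mult_left_mono power_mono) auto
    also have "\<dots> = (1 - 2 * \<rho> * c + \<rho>\<^sup>2 * K\<^sup>2) * (norm d)\<^sup>2" by (simp add: algebra_simps power_mult_distrib)
    also have "\<dots> \<le> q * (norm d)\<^sup>2"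
    proof (rule mult_right_mono)
      have "\<rho>\<^sup>2 * K\<^sup>2 \<le> \<rho>\<^sup>2 * (K\<^sup>2 + c\<^sup>2)" by (intro mult_left_mono) auto
      also have "\<dots> = \<rho> * c" using den by (simp add: \<rho>_def power2_eq_square)
      finally show "1 - 2 * \<rho> * c + \<rho>\<^sup>2 * K\<^sup>2 \<le> q" by (simp add: q_def \<rho>_def power2_eq_square)
    qed simp
    also have "\<dots> = (sqrt q * norm d)\<^sup>2" using q by (simp add: power_mult_distrib)
    finally show ?thesis using q by (intro power2_le_imp_le[of "norm (d - \<rho> *\<^sub>R T d)"]) auto
  qed
  let ?f = "\<lambda>u. u - \<rho> *\<^sub>R (T u - r)"
  have "\<exists>!u. u \<in> S \<and> ?f u = u"
  proof (rule Banach_fix[of S "sqrt q"])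
    show "complete S" using S(2) by (simp add: complete_eq_closed)
    show "S \<noteq> {}" using S(1) subspace_0 by auto
    show "?f ` S \<subseteq> S" using S(1) T r by (auto intro!: subspace_diff subspace_mul)
    fix x y assume xy: "x \<in> S" "y \<in> S"
    have "?f x - ?f y = (x - y) - \<rho> *\<^sub>R T (x - y)" by (simp add: Tdiff[symmetric] algebra_simps)
    then show "dist (?f x) (?f y) \<le> sqrt q * dist x y"
      using contr[OF subspace_diff[OF S(1) xy]] by (simp only: dist_norm)
  qed (use q in auto)
  then obtain u where u: "u \<in> S" "?f u = u" by blast
  then have "T u = r" using \<rho> by simp
  then show ?thesis using u(1) T(2)[of _ u] r(2) by (intro bexI[of _ u]) auto
qed

section \<open>The Hilbert space of square integrable functions\<close>

definition sqint :: "('a::euclidean_space \<Rightarrow> real) \<Rightarrow> bool" where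
  "sqint f \<longleftrightarrow> f \<in> borel_measurable lebesgue \<and> integrable lebesgue (\<lambda>x. (f x)\<^sup>2)"

lemma sqint_measurable: "sqint f \<Longrightarrow> f \<in> borel_measurable lebesgue"
  by (simp add: sqint_def)

lemma sqint_mult:
  assumes "sqint f" "sqint g" shows "integrable lebesgue (\<lambda>x. f x * g x)"
proof (rule Bochner_Integration.integrable_bound[of _ "\<lambda>x. (f x)\<^sup>2 + (g x)\<^sup>2"])
  show "(\<lambda>x. f x * g x) \<in> borel_measurable lebesgue"
    using assms by (auto simp: sqint_def)
  have "\<bar>a * b\<bar> \<le> a\<^sup>2 + b\<^sup>2" for a b :: real
    using sum_squares_bound[of "\<bar>a\<bar>" "\<bar>b\<bar>"] mult_nonneg_nonneg[OF abs_ge_zero[of a] abs_ge_zero[of b]]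
    unfolding abs_mult power2_abs by linarith
  then show "AE x in lebesgue. norm (f x * g x) \<le> norm ((f x)\<^sup>2 + (g x)\<^sup>2)" by auto
qed (use assms in \<open>auto simp: sqint_def\<close>)

lemma sqint_0: "sqint (\<lambda>x. 0)"
  by (simp add: sqint_def)

lemma sqint_add: "sqint f \<Longrightarrow> sqint g \<Longrightarrow> sqint (\<lambda>x. f x + g x)"
  using sqint_mult[of f g] by (auto simp: sqint_def power2_sum mult.assoc)

lemma sqint_cmult: "sqint f \<Longrightarrow> sqint (\<lambda>x. c * f x)"
  by (auto simp: sqint_def power_mult_distrib)

lemma sqint_uminus: "sqint f \<Longrightarrow> sqint (\<lambda>x. - f x)"
  using sqint_cmult[of f "-1"] by simp

lemma sqint_diff: "sqint f \<Longrightarrow> sqint g \<Longrightarrow> sqint (\<lambda>x. f x - g x)"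
  using sqint_add[OF _ sqint_uminus, of f g] by simp

\<comment> \<open>The relation is partial: a function is related to itself exactly when it is square
  integrable, so the restriction to L^2 and the passage to classes happen in one step.\<close>
quotient_type (overloaded) 'a l2 = "'a::euclidean_space \<Rightarrow> real" / partial:
  "\<lambda>f g. sqint f \<and> sqint g \<and> (AE x in lebesgue. f x = g x)"
proof (rule part_equivpI)
  show "\<exists>f::'a \<Rightarrow> real. sqint f \<and> sqint f \<and> (AE x in lebesgue. f x = f x)"
    using sqint_0 by auto
qed (auto intro!: sympI transpI elim: eventually_elim2 eventually_mono)

lemma sqint_rep: "sqint (rep_l2 h)"
  using Quotient_rep_reflp[OF Quotient_l2, of h] by simp

lemma abs_rep_l2 [simp]: "abs_l2 (rep_l2 h) = h"
  by (rule Quotient_abs_rep[OF Quotient_l2])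

lemma abs_l2_eq_iff:
  "sqint f \<Longrightarrow> sqint g \<Longrightarrow> abs_l2 f = abs_l2 g \<longleftrightarrow> (AE x in lebesgue. f x = g x)"
  using Quotient_rel[OF Quotient_l2, of f g] by auto

lemma rep_abs_l2: "sqint f \<Longrightarrow> AE x in lebesgue. rep_l2 (abs_l2 f) x = f x"
  by (subst abs_l2_eq_iff[symmetric]) (auto simp: sqint_rep)

instantiation l2 :: (euclidean_space) real_inner
begin

lift_definition zero_l2 :: "'a l2" is "\<lambda>x. 0" by (simp add: sqint_0)
lift_definition plus_l2 :: "'a l2 \<Rightarrow> 'a l2 \<Rightarrow> 'a l2" is "\<lambda>f g x. f x + g x"
  by (auto simp: sqint_add elim!: eventually_elim2)
lift_definition minus_l2 :: "'a l2 \<Rightarrow> 'a l2 \<Rightarrow> 'a l2" is "\<lambda>f g x. f x - g x"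
  by (auto simp: sqint_diff elim!: eventually_elim2)
lift_definition uminus_l2 :: "'a l2 \<Rightarrow> 'a l2" is "\<lambda>f x. - f x"
  by (auto simp: sqint_uminus elim!: eventually_mono)
lift_definition scaleR_l2 :: "real \<Rightarrow> 'a l2 \<Rightarrow> 'a l2" is "\<lambda>c f x. c * f x"
  by (auto simp: sqint_cmult elim!: eventually_mono)
lift_definition inner_l2 :: "'a l2 \<Rightarrow> 'a l2 \<Rightarrow> real" is "\<lambda>f g. \<integral>x. f x * g x \<partial>lebesgue"
  by (intro integral_cong_AE) (auto intro!: borel_measurable_times dest: sqint_measurable elim!: eventually_elim2)

definition norm_l2 :: "'a l2 \<Rightarrow> real" where "norm_l2 h = sqrt (h \<bullet> h)"
definition dist_l2 :: "'a l2 \<Rightarrow> 'a l2 \<Rightarrow> real" where "dist_l2 h k = norm (h - k)"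
definition sgn_l2 :: "'a l2 \<Rightarrow> 'a l2" where "sgn_l2 h = inverse (norm h) *\<^sub>R h"
definition uniformity_l2 :: "('a l2 \<times> 'a l2) filter"
  where "uniformity_l2 = (INF e\<in>{0 <..}. principal {(x, y). dist x y < e})"
definition open_l2 :: "'a l2 set \<Rightarrow> bool"
  where "open_l2 U = (\<forall>x\<in>U. eventually (\<lambda>(x', y). x' = x \<longrightarrow> y \<in> U) uniformity)"

instance
proof
  fix a b :: real and x y z :: "'a l2"
  show "x + y + z = x + (y + z)" by transfer (simp add: sqint_add add.assoc)
  show "x + y = y + x" by transfer (simp add: sqint_add add.commute)
  show "0 + x = x" by transfer simp
  show "- x + x = 0" by transfer (simp add: sqint_0)
  show "x - y = x + - y" by transfer (simp add: sqint_diff)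
  show "a *\<^sub>R (x + y) = a *\<^sub>R x + a *\<^sub>R y" by transfer (simp add: sqint_add sqint_cmult distrib_left)
  show "(a + b) *\<^sub>R x = a *\<^sub>R x + b *\<^sub>R x" by transfer (simp add: sqint_add sqint_cmult distrib_right)
  show "a *\<^sub>R b *\<^sub>R x = (a * b) *\<^sub>R x" by transfer (simp add: sqint_cmult mult.assoc)
  show "1 *\<^sub>R x = x" by transfer simp
  show "inner x y = inner y x" by transfer (simp add: mult.commute)
  show "inner (x + y) z = inner x z + inner y z"
    by transfer (simp add: distrib_right sqint_mult)
  show "inner (a *\<^sub>R x) y = a * inner x y"
    by transfer (simp add: mult.assoc)
  show "0 \<le> inner x x" by transfer simp
  show "inner x x = 0 \<longleftrightarrow> x = 0"
  proof transfer
    fix f :: "'a \<Rightarrow> real" assume f: "sqint f \<and> sqint f \<and> (AE x in lebesgue. f x = f x)"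
    have "(\<integral>x. f x * f x \<partial>lebesgue) = 0 \<longleftrightarrow> (AE x in lebesgue. f x * f x = 0)"
      using f by (intro integral_nonneg_eq_0_iff_AE sqint_mult) auto
    then show "(\<integral>x. f x * f x \<partial>lebesgue) = 0 \<longleftrightarrow> sqint f \<and> sqint (\<lambda>x. 0::real) \<and> (AE x in lebesgue. f x = 0)"
      using f by (simp add: sqint_0)
  qed
qed (simp_all add: norm_l2_def dist_l2_def sgn_l2_def uniformity_l2_def open_l2_def)

end

lemma abs_l2_add: "sqint f \<Longrightarrow> sqint g \<Longrightarrow> abs_l2 (\<lambda>x. f x + g x) = abs_l2 f + abs_l2 g"
  by (simp add: plus_l2.abs_eq)

lemma abs_l2_diff: "sqint f \<Longrightarrow> sqint g \<Longrightarrow> abs_l2 (\<lambda>x. f x - g x) = abs_l2 f - abs_l2 g"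
  by (simp add: minus_l2.abs_eq)

lemma abs_l2_cmult: "sqint f \<Longrightarrow> abs_l2 (\<lambda>x. c * f x) = c *\<^sub>R abs_l2 f"
  by (simp add: scaleR_l2.abs_eq)

lemma inner_abs_l2: "sqint f \<Longrightarrow> sqint g \<Longrightarrow> abs_l2 f \<bullet> abs_l2 g = (\<integral>x. f x * g x \<partial>lebesgue)"
  by (simp add: inner_l2.abs_eq)

lemma norm_abs_l2: "sqint f \<Longrightarrow> (norm (abs_l2 f))\<^sup>2 = (\<integral>x. (f x)\<^sup>2 \<partial>lebesgue)"
  unfolding power2_norm_eq_inner by (simp add: inner_abs_l2 power2_eq_square)

lemma nn_integral_abs_l2: "sqint f \<Longrightarrow> (\<integral>\<^sup>+x. ennreal ((f x)\<^sup>2) \<partial>lebesgue) = ennreal ((norm (abs_l2 f))\<^sup>2)"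
  by (subst nn_integral_eq_integral) (auto simp: norm_abs_l2 sqint_def)

lemma sqintI_nn:
  assumes "f \<in> borel_measurable lebesgue" "(\<integral>\<^sup>+x. ennreal ((f x)\<^sup>2) \<partial>lebesgue) < \<infinity>"
  shows "sqint f"
  using assms by (auto simp: sqint_def intro!: integrableI_nonneg)

text \<open>Riesz--Fischer: along a rapidly Cauchy subsequence the increments satisfy
  \<open>\<Sum>n. 2^n * (g n x)^2 < \<infinity>\<close> almost everywhere, so they are dominated by a geometric series.\<close>

lemma l2_rapid_Cauchy_converges:
  fixes Y :: "nat \<Rightarrow> 'a::euclidean_space l2"
  assumes Y: "\<And>m n. m \<ge> n \<Longrightarrow> norm (Y m - Y n) \<le> (1/2)^n"
  shows "\<exists>h. Y \<longlonglongrightarrow> h"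
proof -
  define f where "f = (\<lambda>n. rep_l2 (Y n))"
  have sq: "sqint (f n)" for n by (simp add: f_def sqint_rep)
  have meas [measurable]: "f n \<in> borel_measurable lebesgue" for n using sq sqint_measurable by blast
  have Yf: "abs_l2 (f n) = Y n" for n by (simp add: f_def)
  have dif: "(\<integral>\<^sup>+x. ennreal ((f m x - f n x)\<^sup>2) \<partial>lebesgue) = ennreal ((norm (Y m - Y n))\<^sup>2)" for m n
    using nn_integral_abs_l2[OF sqint_diff[OF sq sq, of m n]] by (simp add: abs_l2_diff sq Yf)
  define g where "g = (\<lambda>n x. f (Suc n) x - f n x)"
  have "(\<integral>\<^sup>+x. (\<Sum>n. ennreal (2^n * (g n x)\<^sup>2)) \<partial>lebesgue) = (\<Sum>n. \<integral>\<^sup>+x. ennreal (2^n * (g n x)\<^sup>2) \<partial>lebesgue)"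
    by (intro nn_integral_suminf) (simp add: g_def)
  also have "\<dots> = (\<Sum>n. ennreal (2^n * (norm (Y (Suc n) - Y n))\<^sup>2))"
    by (simp add: ennreal_mult nn_integral_cmult g_def dif)
  \<comment> \<open>The squared norms of the increments are at most \<open>(1/4)^n\<close>, so even
    with the weight \<open>2^n\<close> a convergent geometric series remains.\<close>
  also have "\<dots> \<le> (\<Sum>n. ennreal ((1/2)^n))"
  proof (intro suminf_le ennreal_leI)
    fix n
    have "2^n * (norm (Y (Suc n) - Y n))\<^sup>2 \<le> 2^n * ((1/2)^n)\<^sup>2"
      using Y[of n "Suc n"] by (intro mult_left_mono power_mono) auto
    also have "\<dots> = (1/2)^n" by (simp add: power2_eq_square power_divide)
    finally show "2^n * (norm (Y (Suc n) - Y n))\<^sup>2 \<le> (1/2::real)^n" .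
  qed auto
  also have "\<dots> = ennreal (\<Sum>n. (1/2)^n)" by (intro suminf_ennreal2) (auto intro: summable_geometric)
  also have "\<dots> < \<infinity>" by simp
  finally have "AE x in lebesgue. (\<Sum>n. ennreal (2^n * (g n x)\<^sup>2)) \<noteq> \<infinity>"
    by (intro nn_integral_noteq_infinite) (auto simp: g_def)
  moreover have "convergent (\<lambda>n. f n x)" if fin: "(\<Sum>n. ennreal (2^n * (g n x)\<^sup>2)) \<noteq> \<infinity>" for x
  proof -
    have "summable (\<lambda>n. 2^n * (g n x)\<^sup>2)"
      using fin by (intro summable_suminf_not_top) auto
    then have "(\<lambda>n. 2^n * (g n x)\<^sup>2) \<longlonglongrightarrow> 0" by (rule summable_LIMSEQ_zero)
    then have "Bseq (\<lambda>n. 2^n * (g n x)\<^sup>2)" by (intro convergent_imp_Bseq convergentI)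
    then obtain C where "C > 0" and C: "\<forall>n. norm (2^n * (g n x)\<^sup>2) \<le> C" by (rule BseqE)
    have "norm (g n x) \<le> sqrt C * (1 / sqrt 2)^n" for n
    proof -
      have "2^n * (g n x)\<^sup>2 \<le> C" using C[rule_format, of n] by (rule order_trans[rotated]) simp
      then have "2^n * (g n x)\<^sup>2 * (1/2)^n \<le> C * (1/2)^n" by (rule mult_right_mono) simp
      also have "2^n * (g n x)\<^sup>2 * (1/2)^n = (g n x)\<^sup>2 * (2 * (1/2))^n"
        unfolding power_mult_distrib by (simp only: mult_ac)
      finally have "(g n x)\<^sup>2 \<le> C * (1/2)^n" by simp
      then have "sqrt ((g n x)\<^sup>2) \<le> sqrt (C * (1/2)^n)" by (rule real_sqrt_le_mono)
      also have "sqrt (C * (1/2)^n) = sqrt C * (sqrt (1/2))^n"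
        by (simp only: real_sqrt_mult real_sqrt_power)
      finally show ?thesis by (simp add: real_sqrt_divide)
    qed
    moreover have "summable (\<lambda>n. sqrt C * (1 / sqrt 2)^n)"
      by (intro summable_mult summable_geometric) simp
    ultimately have "summable (\<lambda>n. g n x)"
      using summable_comparison_test[of "\<lambda>n. g n x" "\<lambda>n. sqrt C * (1 / sqrt 2)^n"] by blast
    then have "convergent (\<lambda>n. f n x - f 0 x)"
      unfolding summable_iff_convergent g_def sum_lessThan_telescope[of "\<lambda>n. f n x"] .
    from convergent_add[OF this convergent_const[of "f 0 x"]] show ?thesis by simp
  qed
  ultimately have conv: "AE x in lebesgue. (\<lambda>n. f n x) \<longlonglongrightarrow> lim (\<lambda>n. f n x)"
    unfolding convergent_LIMSEQ_iff[symmetric] by (rule eventually_mono)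
  define F where "F = (\<lambda>x. lim (\<lambda>n. f n x))"
  have [measurable]: "F \<in> borel_measurable lebesgue" unfolding F_def by measurable
  \<comment> \<open>Fatou's lemma in the index \<open>m\<close> shows at once that the limit is
    square integrable and how fast the sequence approaches it.\<close>
  have bound: "(\<integral>\<^sup>+x. ennreal ((F x - f n x)\<^sup>2) \<partial>lebesgue) \<le> ennreal (((1/2)^n)\<^sup>2)" for n
  proof -
    have "(\<integral>\<^sup>+x. ennreal ((F x - f n x)\<^sup>2) \<partial>lebesgue) =
        (\<integral>\<^sup>+x. liminf (\<lambda>m. ennreal ((f m x - f n x)\<^sup>2)) \<partial>lebesgue)"
    proof (rule nn_integral_cong_AE, use conv in eventually_elim)
      fix x assume "(\<lambda>n. f n x) \<longlonglongrightarrow> lim (\<lambda>n. f n x)"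
      then have "(\<lambda>m. ennreal ((f m x - f n x)\<^sup>2)) \<longlonglongrightarrow> ennreal ((F x - f n x)\<^sup>2)"
        unfolding F_def by (intro tendsto_intros)
      then show "ennreal ((F x - f n x)\<^sup>2) = liminf (\<lambda>m. ennreal ((f m x - f n x)\<^sup>2))"
        by (intro lim_imp_Liminf[symmetric]) auto
    qed
    also have "\<dots> \<le> liminf (\<lambda>m. \<integral>\<^sup>+x. ennreal ((f m x - f n x)\<^sup>2) \<partial>lebesgue)"
      by (intro nn_integral_liminf) measurable
    also have "\<dots> \<le> limsup (\<lambda>m. \<integral>\<^sup>+x. ennreal ((f m x - f n x)\<^sup>2) \<partial>lebesgue)"
      by (intro Liminf_le_Limsup) simp
    also have "\<dots> \<le> ennreal (((1/2)^n)\<^sup>2)"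
    proof (rule Limsup_bounded)
      show "\<forall>\<^sub>F m in sequentially. (\<integral>\<^sup>+x. ennreal ((f m x - f n x)\<^sup>2) \<partial>lebesgue) \<le> ennreal (((1/2)^n)\<^sup>2)"
        using eventually_ge_at_top[of n]
      proof eventually_elim
        case (elim m)
        then show ?case unfolding dif by (intro ennreal_leI power_mono Y) auto
      qed
    qed
    finally show ?thesis .
  qed
  have sqd: "sqint (\<lambda>x. F x - f n x)" for n
    using bound[of n] by (intro sqintI_nn) (auto intro: le_less_trans)
  have sqF: "sqint F" using sqint_add[OF sqd sq, of 0 0] by simp
  have "norm (Y n - abs_l2 F) \<le> (1/2)^n" for n
  proof -
    have "ennreal ((norm (abs_l2 F - Y n))\<^sup>2) \<le> ennreal (((1/2)^n)\<^sup>2)"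
      using bound[of n] nn_integral_abs_l2[OF sqd, of n] by (simp add: abs_l2_diff sqF sq Yf)
    then have "(norm (abs_l2 F - Y n))\<^sup>2 \<le> ((1/2)^n)\<^sup>2" by (simp add: ennreal_le_iff)
    then have "norm (abs_l2 F - Y n) \<le> (1/2)^n" by (rule power2_le_imp_le) simp
    then show ?thesis by (simp only: norm_minus_commute)
  qed
  moreover have "(\<lambda>n. (1/2::real)^n) \<longlonglongrightarrow> 0" by (intro LIMSEQ_realpow_zero) auto
  ultimately have "(\<lambda>n. Y n - abs_l2 F) \<longlonglongrightarrow> 0"
    by (intro Lim_null_comparison[of "\<lambda>n. Y n - abs_l2 F" "\<lambda>n. (1/2::real)^n"]) auto
  then show ?thesis using LIM_zero_cancel by blast
qed

instance l2 :: (euclidean_space) banach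
proof
  fix X :: "nat \<Rightarrow> 'a l2" assume X: "Cauchy X"
  have "\<exists>N. \<forall>m\<ge>N. \<forall>k\<ge>N. norm (X m - X k) < (1/2)^n" for n :: nat
    using X[unfolded Cauchy_iff] by simp
  then obtain N where N: "\<And>n m k. m \<ge> N n \<Longrightarrow> k \<ge> N n \<Longrightarrow> norm (X m - X k) < (1/2)^n" by metis
  \<comment> \<open>Adding the sum of all thresholds up to \<open>n\<close> makes \<open>r\<close>
    strictly increasing and keeps it above \<open>N n\<close>.\<close>
  define r where "r = (\<lambda>n. n + (\<Sum>i\<le>n. N i))"
  have r: "strict_mono r" by (rule strict_monoI_Suc) (simp add: r_def)
  have rN: "r n \<ge> N n" for n
    using member_le_sum[of n "{..n}" N] by (auto simp: r_def intro: trans_le_add2)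
  have "norm ((X \<circ> r) m - (X \<circ> r) n) \<le> (1/2)^n" if "m \<ge> n" for m n
  proof -
    have "r m \<ge> N n" using strict_mono_leD[OF r that] rN[of n] by linarith
    then show ?thesis using N[of n "r m" "r n"] rN[of n] by simp
  qed
  then obtain h where "(X \<circ> r) \<longlonglongrightarrow> h" using l2_rapid_Cauchy_converges by blast
  then have "X \<longlonglongrightarrow> h" by (intro Cauchy_converges_subseq[OF X r])
  then show "convergent X" by (rule convergentI)
qed

section \<open>Test functions\<close>

lemma partial_eq: "(f has_derivative F) (at x) \<Longrightarrow> partial f i x = F (axis i 1)"
  by (simp add: partial_def frechet_derivative_at[symmetric])

lemma partial_deriv:
  "f differentiable (at x) \<Longrightarrow> (f has_derivative frechet_derivative f (at x)) (at x)"
  by (simp add: frechet_derivative_works[symmetric])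

lemma partial_mult:
  assumes "f differentiable (at x)" "g differentiable (at x)"
  shows "partial (\<lambda>x. f x * g x) i x = f x * partial g i x + partial f i x * g x"
  by (subst partial_eq[OF has_derivative_mult[OF assms[THEN partial_deriv]]]) (simp add: partial_def)

lemma partial_add:
  assumes "f differentiable (at x)" "g differentiable (at x)"
  shows "partial (\<lambda>x. f x + g x) i x = partial f i x + partial g i x"
  by (subst partial_eq[OF has_derivative_add[OF assms[THEN partial_deriv]]]) (simp add: partial_def)

lemma partial_cmult:
  assumes "f differentiable (at x)"
  shows "partial (\<lambda>x. c * f x) i x = c * partial f i x"
  by (subst partial_eq[OF has_derivative_mult_right[OF assms[THEN partial_deriv]]]) (simp add: partial_def)

lemma partial_nth: "partial (\<lambda>x. x $ i) i x = 1"
  by (subst partial_eq[OF bounded_linear_imp_has_derivative[OF bounded_linear_vec_nth]]) simp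

lemma smooth_fn_differentiable: "smooth_fn \<phi> \<Longrightarrow> \<phi> differentiable (at x)"
  by (auto elim: smooth_fn.cases)

lemma smooth_fn_partial: "smooth_fn \<phi> \<Longrightarrow> smooth_fn (partial \<phi> i)"
  by (auto elim: smooth_fn.cases)

lemma smooth_fn_continuous: "smooth_fn \<phi> \<Longrightarrow> continuous_on UNIV \<phi>"
  by (simp add: smooth_fn_differentiable continuous_at_imp_continuous_on differentiable_imp_continuous_within)

text \<open>Linear combinations of smooth functions are stable under \<open>partial\<close> and
  hence form a coinduction invariant.\<close>

lemma smooth_fn_lincomb:
  assumes "smooth_fn \<phi>" "smooth_fn \<eta>"
  shows "smooth_fn (\<lambda>x. a * \<phi> x + b * \<eta> x)"
proof (rule smooth_fn.coinduct[of "\<lambda>\<psi>. \<exists>\<phi> \<eta>. smooth_fn \<phi> \<and> smooth_fn \<eta> \<and> \<psi> = (\<lambda>x. a * \<phi> x + b * \<eta> x)"])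
  show "\<exists>\<phi>' \<eta>'. smooth_fn \<phi>' \<and> smooth_fn \<eta>' \<and> (\<lambda>x. a * \<phi> x + b * \<eta> x) = (\<lambda>x. a * \<phi>' x + b * \<eta>' x)"
    by (rule exI[of _ \<phi>], rule exI[of _ \<eta>]) (simp add: assms)
next
  fix \<psi> :: "'a fn"
  assume "\<exists>\<phi> \<eta>. smooth_fn \<phi> \<and> smooth_fn \<eta> \<and> \<psi> = (\<lambda>x. a * \<phi> x + b * \<eta> x)"
  then obtain \<phi> \<eta> where s: "smooth_fn \<phi>" "smooth_fn \<eta>" and \<psi>: "\<psi> = (\<lambda>x. a * \<phi> x + b * \<eta> x)"
    by (elim exE conjE)
  have d: "\<phi> differentiable (at x)" "\<eta> differentiable (at x)" for x
    using s by (simp_all add: smooth_fn_differentiable)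
  have 1: "\<psi> differentiable (at x)" for x unfolding \<psi> using d by (intro derivative_intros)
  have 2: "partial \<psi> i = (\<lambda>x. a * partial \<phi> i x + b * partial \<eta> i x)" for i
  proof
    fix x
    have "(\<lambda>x. a * \<phi> x) differentiable (at x)" "(\<lambda>x. b * \<eta> x) differentiable (at x)"
      using d by (auto intro!: derivative_intros)
    then show "partial \<psi> i x = a * partial \<phi> i x + b * partial \<eta> i x"
      unfolding \<psi> by (simp add: partial_add partial_cmult d)
  qed
  have 3: "\<exists>\<phi>' \<eta>'. smooth_fn \<phi>' \<and> smooth_fn \<eta>' \<and> partial \<psi> i = (\<lambda>x. a * \<phi>' x + b * \<eta>' x)" for i
    by (rule exI[of _ "partial \<phi> i"], rule exI[of _ "partial \<eta> i"]) (simp add: 2 s smooth_fn_partial)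
  show "\<exists>\<phi>. \<psi> = \<phi> \<and> (\<forall>x. \<phi> differentiable (at x)) \<and>
     (\<forall>i. (\<exists>\<phi>' \<eta>'. smooth_fn \<phi>' \<and> smooth_fn \<eta>' \<and> partial \<phi> i = (\<lambda>x. a * \<phi>' x + b * \<eta>' x)) \<or> smooth_fn (partial \<phi> i))"
    by (rule exI[of _ \<psi>]) (use 1 3 in simp)
qed

lemma closure_support_zero: "x \<notin> closure {x. \<phi> x \<noteq> 0} \<Longrightarrow> \<phi> x = (0::real)"
  using closure_subset[of "{x. \<phi> x \<noteq> 0}"] by auto

lemma test_fn_smooth: "test_fn \<Omega> \<phi> \<Longrightarrow> smooth_fn \<phi>"
  by (simp add: test_fn_def)

lemma test_fn_outside: "test_fn \<Omega> \<phi> \<Longrightarrow> x \<notin> \<Omega> \<Longrightarrow> \<phi> x = 0"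
  using closure_support_zero[of x \<phi>] by (auto simp: test_fn_def)

lemma partial_outside_support:
  assumes "x \<notin> closure {x. \<phi> x \<noteq> 0}"
  shows "partial \<phi> i x = 0"
proof -
  let ?S = "- closure {x. \<phi> x \<noteq> 0}"
  have "(\<phi> has_derivative (\<lambda>h. 0)) (at x)"
  proof (rule has_derivative_transform_within_open)
    show "((\<lambda>x. 0) has_derivative (\<lambda>h. 0)) (at x)" by (rule has_derivative_const)
    show "open ?S" by (rule open_Compl[OF closed_closure])
    show "x \<in> ?S" using assms by simp
    show "0 = \<phi> y" if "y \<in> ?S" for y
      using closure_support_zero[of y \<phi>] that by simp
  qed
  then show ?thesis by (simp add: partial_eq)
qed

lemma test_fn_partial:
  assumes "test_fn \<Omega> \<phi>" shows "test_fn \<Omega> (partial \<phi> i)"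
proof -
  have "{x. partial \<phi> i x \<noteq> 0} \<subseteq> closure {x. \<phi> x \<noteq> 0}"
    using partial_outside_support[of _ \<phi> i] by blast
  then have sub: "closure {x. partial \<phi> i x \<noteq> 0} \<subseteq> closure {x. \<phi> x \<noteq> 0}"
    by (simp add: closure_minimal)
  moreover have "compact (closure {x. partial \<phi> i x \<noteq> 0})"
    using compact_Int_closed[of "closure {x. \<phi> x \<noteq> 0}" "closure {x. partial \<phi> i x \<noteq> 0}"] sub assms
    by (simp add: test_fn_def Int_absorb1)
  ultimately show ?thesis using assms smooth_fn_partial by (auto simp: test_fn_def)
qed

lemma test_fn_lincomb:
  assumes "test_fn \<Omega> \<phi>" "test_fn \<Omega> \<eta>"
  shows "test_fn \<Omega> (\<lambda>x. a * \<phi> x + b * \<eta> x)"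
proof -
  let ?S = "closure {x. \<phi> x \<noteq> 0} \<union> closure {x. \<eta> x \<noteq> 0}"
  have cS: "compact ?S" using assms by (auto simp: test_fn_def)
  have "{x. a * \<phi> x + b * \<eta> x \<noteq> 0} \<subseteq> ?S"
  proof (rule subsetI, rule ccontr)
    fix x assume "x \<in> {x. a * \<phi> x + b * \<eta> x \<noteq> 0}" "x \<notin> ?S"
    then show False using closure_support_zero[of x \<phi>] closure_support_zero[of x \<eta>] by simp
  qed
  then have sub: "closure {x. a * \<phi> x + b * \<eta> x \<noteq> 0} \<subseteq> ?S"
    by (intro closure_minimal) auto
  then have "compact (closure {x. a * \<phi> x + b * \<eta> x \<noteq> 0})"
    using compact_Int_closed[OF cS closed_closure, of "{x. a * \<phi> x + b * \<eta> x \<noteq> 0}"] by (simp add: Int_absorb1)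
  then show ?thesis using assms sub smooth_fn_lincomb by (auto simp: test_fn_def)
qed

lemma test_fn_zero: "test_fn \<Omega> (\<lambda>x. 0)"
proof -
  have p: "partial (\<lambda>x. 0) i = (\<lambda>x. 0)" for i :: 'a
    by (rule ext, subst partial_eq[of _ "\<lambda>h. 0"]) auto
  have "smooth_fn (\<lambda>x::real^'a. 0)"
    by (coinduction rule: smooth_fn.coinduct) (auto simp: p)
  then show ?thesis by (simp add: test_fn_def)
qed

text \<open>Difference quotients have integral zero by translation invariance.\<close>
lemma integral_partial_zero:
  fixes \<psi> :: "('n::finite) fn"
  assumes diff: "\<And>x. \<psi> differentiable (at x)" and cont: "continuous_on UNIV (partial \<psi> i)"
    and supp: "\<And>x. x \<notin> cball 0 R \<Longrightarrow> \<psi> x = 0"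
  shows "(\<integral>x. partial \<psi> i x \<partial>lebesgue) = 0"
proof -
  define e :: "real^'n" where "e = axis i 1"
  have ne: "norm e = 1" by (simp add: e_def)
  have der: "((\<lambda>t. \<psi> (x + t *\<^sub>R e)) has_real_derivative partial \<psi> i (x + t *\<^sub>R e)) (at t)" for x t
  proof -
    have "((\<lambda>t. x + t *\<^sub>R e) has_derivative (\<lambda>h. h *\<^sub>R e)) (at t)"
      by (auto intro!: derivative_eq_intros)
    from has_derivative_compose[OF this partial_deriv[OF diff]]
    have "((\<lambda>t. \<psi> (x + t *\<^sub>R e)) has_derivative (\<lambda>h. frechet_derivative \<psi> (at (x + t *\<^sub>R e)) (h *\<^sub>R e))) (at t)" .
    moreover have "frechet_derivative \<psi> (at (x + t *\<^sub>R e)) (h *\<^sub>R e) = partial \<psi> i (x + t *\<^sub>R e) * h" for h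
      using linear_cmul[OF linear_frechet_derivative[OF diff]] by (simp add: partial_def e_def mult.commute)
    ultimately show ?thesis by (simp add: has_field_derivative_def)
  qed
  have contp: "continuous_on UNIV \<psi>"
    by (simp add: diff continuous_at_imp_continuous_on differentiable_imp_continuous_within)
  have m [measurable]: "\<psi> \<in> borel_measurable borel" "partial \<psi> i \<in> borel_measurable borel"
    using contp cont by (auto intro: borel_measurable_continuous_onI)
  have "compact (partial \<psi> i ` cball 0 (R + 2))"
    by (intro compact_continuous_image continuous_on_subset[OF cont]) auto
  then have "bounded (partial \<psi> i ` cball 0 (R + 2))" by (rule compact_imp_bounded)
  then obtain M where "\<forall>y \<in> partial \<psi> i ` cball 0 (R + 2). norm y \<le> M"
    unfolding bounded_iff by (elim exE)
  then have M: "\<bar>partial \<psi> i x\<bar> \<le> M" if "x \<in> cball 0 (R + 2)" for x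
    using that by simp
  \<comment> \<open>Forward difference quotients with increments at most 1, so that all of them
    vanish outside radius \<open>R + 1\<close>.\<close>
  define D where "D = (\<lambda>k x. real (Suc k) * (\<psi> (x + (1 / real (Suc k)) *\<^sub>R e) - \<psi> x))"
  have int\<psi>: "integrable lborel \<psi>"
  proof -
    have "integrable lborel (\<lambda>x. indicator (cball 0 R) x *\<^sub>R \<psi> x)"
      by (rule borel_integrable_compact[OF compact_cball continuous_on_subset[OF contp]]) auto
    moreover have "(\<lambda>x. indicator (cball 0 R) x *\<^sub>R \<psi> x) = \<psi>"
      using supp by (auto simp: fun_eq_iff indicator_def)
    ultimately show ?thesis by simp
  qed
  have shift: "(\<integral>x. \<psi> (x + c) \<partial>lborel) = (\<integral>x. \<psi> x \<partial>lborel)" "integrable lborel (\<lambda>x. \<psi> (x + c))" for c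
  proof -
    show "(\<integral>x. \<psi> (x + c) \<partial>lborel) = (\<integral>x. \<psi> x \<partial>lborel)"
      by (subst (2) lborel_distr_plus[of c, symmetric]) (simp add: integral_distr add.commute)
    have "integrable (distr lborel borel ((+) c)) \<psi>" by (simp add: lborel_distr_plus int\<psi>)
    then show "integrable lborel (\<lambda>x. \<psi> (x + c))" by (simp add: integrable_distr_eq add.commute)
  qed
  have D0: "(\<integral>x. D k x \<partial>lborel) = 0" for k
    unfolding D_def using shift int\<psi> by simp
  have lim: "(\<lambda>k. D k x) \<longlonglongrightarrow> partial \<psi> i x" for x
  proof -
    have "((\<lambda>h. (\<psi> (x + h *\<^sub>R e) - \<psi> x) / h) \<longlongrightarrow> partial \<psi> i x) (at 0)"
      using der[of x 0] by (simp add: has_field_derivative_iff)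
    then have "((\<lambda>k. (\<psi> (x + inverse (real (Suc k)) *\<^sub>R e) - \<psi> x) / inverse (real (Suc k))) \<longlongrightarrow> partial \<psi> i x) sequentially"
      by (rule filterlim_compose)
        (auto simp: filterlim_at intro!: LIMSEQ_inverse_real_of_nat simp del: of_nat_Suc)
    then show ?thesis by (simp add: D_def field_simps del: of_nat_Suc)
  qed
  \<comment> \<open>Within radius \<open>R + 1\<close> the mean value theorem turns the quotient
    into a derivative at a point of \<open>cball 0 (R + 2)\<close>, where \<open>M\<close> bounds
    it; beyond, both evaluation points lie outside the support.\<close>
  have dom: "norm (D k x) \<le> indicator (cball 0 (R + 1)) x * M" for k x
  proof (cases "x \<in> cball 0 (R + 1)")
    case True
    define h where "h = 1 / real (Suc k)"
    have h: "0 < h" "h \<le> 1" by (auto simp: h_def)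
    obtain z where z: "0 < z" "z < h" "\<psi> (x + h *\<^sub>R e) - \<psi> (x + 0 *\<^sub>R e) = (h - 0) * partial \<psi> i (x + z *\<^sub>R e)"
      using MVT2[OF h(1), of "\<lambda>t. \<psi> (x + t *\<^sub>R e)" "\<lambda>t. partial \<psi> i (x + t *\<^sub>R e)"] der by auto
    have "D k x = partial \<psi> i (x + z *\<^sub>R e)"
      using z(3) h(1) by (simp add: D_def h_def field_simps)
    moreover have "x + z *\<^sub>R e \<in> cball 0 (R + 2)"
      using True norm_triangle_ineq[of x "z *\<^sub>R e"] z h by (simp add: ne)
    ultimately show ?thesis using M True by simp
  next
    case False
    have "x + (1 / real (Suc k)) *\<^sub>R e \<notin> cball 0 R"
    proof
      assume "x + (1 / real (Suc k)) *\<^sub>R e \<in> cball 0 R"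
      then have "norm x \<le> R + norm ((1 / real (Suc k)) *\<^sub>R e)"
        using norm_triangle_ineq4[of "x + (1 / real (Suc k)) *\<^sub>R e" "(1 / real (Suc k)) *\<^sub>R e"] by simp
      also have "norm ((1 / real (Suc k)) *\<^sub>R e) \<le> 1" using ne by (simp del: of_nat_Suc)
      finally show False using False by simp
    qed
    moreover have "x \<notin> cball 0 R" using False by simp
    ultimately show ?thesis using False by (simp add: D_def supp)
  qed
  have "(\<lambda>k. \<integral>x. D k x \<partial>lborel) \<longlonglongrightarrow> (\<integral>x. partial \<psi> i x \<partial>lborel)"
  proof (rule integral_dominated_convergence)
    show "integrable lborel (\<lambda>x. indicator (cball 0 (R + 1)) x * M)"
      using emeasure_lborel_cball_finite[of 0 "R + 1"]
      by (intro integrable_mult_left integrable_real_indicator) auto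
    show "AE x in lborel. (\<lambda>k. D k x) \<longlonglongrightarrow> partial \<psi> i x" using lim by auto
    show "AE x in lborel. norm (D k x) \<le> indicator (cball 0 (R + 1)) x * M" for k using dom by auto
  qed (auto simp: D_def)
  then have "(\<integral>x. partial \<psi> i x \<partial>lborel) = 0" using D0 LIMSEQ_unique by (metis tendsto_const ext)
  then show ?thesis by (simp add: integral_completion)
qed

lemma test_fn_support_ball:
  assumes "test_fn \<Omega> \<phi>"
  obtains R where "\<And>x. x \<notin> cball 0 R \<Longrightarrow> \<phi> x = 0"
proof -
  have "bounded (closure {x. \<phi> x \<noteq> 0})" using assms by (simp add: test_fn_def compact_imp_bounded)
  then obtain R where R: "\<And>x. x \<in> closure {x. \<phi> x \<noteq> 0} \<Longrightarrow> norm x \<le> R"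
    by (auto simp: bounded_iff)
  have "\<phi> x = 0" if "x \<notin> cball 0 R" for x
    using R[of x] that closure_support_zero[of x \<phi>] by auto
  then show ?thesis using that by blast
qed

lemma compact_support_integrable:
  fixes f :: "'a::euclidean_space \<Rightarrow> real"
  assumes "continuous_on UNIV f" "\<And>x. x \<notin> cball 0 R \<Longrightarrow> f x = 0"
  shows "integrable lebesgue f"
proof -
  have "integrable lborel (\<lambda>x. indicator (cball 0 R) x *\<^sub>R f x)"
    by (rule borel_integrable_compact[OF compact_cball continuous_on_subset[OF assms(1)]]) auto
  moreover have "(\<lambda>x. indicator (cball 0 R) x *\<^sub>R f x) = f"
    using assms(2) by (auto simp: fun_eq_iff indicator_def)
  ultimately show ?thesis
    using assms(1) by (simp add: integrable_completion borel_measurable_continuous_onI)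
qed

lemma test_fn_mult_integrable:
  assumes "test_fn \<Omega> \<phi>" "continuous_on UNIV f"
  shows "integrable lebesgue (\<lambda>x. f x * \<phi> x)"
proof -
  obtain R where "\<And>x. x \<notin> cball 0 R \<Longrightarrow> \<phi> x = 0" using test_fn_support_ball[OF assms(1)] by blast
  then show ?thesis
    by (intro compact_support_integrable[of _ R] continuous_intros assms
          smooth_fn_continuous[OF test_fn_smooth[OF assms(1)]]) auto
qed

text \<open>The product has compact support, so the integral of its partial derivative
  vanishes.\<close>

lemma test_fn_by_parts:
  assumes \<phi>: "test_fn \<Omega> \<phi>" and \<eta>: "test_fn \<Omega>' \<eta>"
  shows "(\<integral>x. \<phi> x * partial \<eta> i x \<partial>lebesgue) = - (\<integral>x. partial \<phi> i x * \<eta> x \<partial>lebesgue)"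
proof -
  have d: "\<phi> differentiable (at x)" "\<eta> differentiable (at x)" for x
    using \<phi> \<eta> test_fn_smooth smooth_fn_differentiable by blast+
  have c: "continuous_on UNIV \<phi>" "continuous_on UNIV \<eta>" "continuous_on UNIV (partial \<phi> i)" "continuous_on UNIV (partial \<eta> i)"
    using \<phi> \<eta> test_fn_smooth test_fn_partial smooth_fn_continuous by blast+
  obtain R where R: "\<And>x. x \<notin> cball 0 R \<Longrightarrow> \<phi> x = 0" using test_fn_support_ball[OF \<phi>] by blast
  have p: "partial (\<lambda>x. \<phi> x * \<eta> x) i = (\<lambda>x. \<phi> x * partial \<eta> i x + partial \<phi> i x * \<eta> x)"
    using d by (intro ext partial_mult)
  have "(\<integral>x. partial (\<lambda>x. \<phi> x * \<eta> x) i x \<partial>lebesgue) = 0"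
    by (rule integral_partial_zero[of _ _ R]) (use d c R p in \<open>auto intro!: derivative_intros continuous_intros\<close>)
  moreover have "integrable lebesgue (\<lambda>x. \<phi> x * partial \<eta> i x)" "integrable lebesgue (\<lambda>x. partial \<phi> i x * \<eta> x)"
    using test_fn_mult_integrable[OF test_fn_partial[OF \<eta>] c(1)] test_fn_mult_integrable[OF \<eta> c(3)] by auto
  ultimately show ?thesis unfolding p by simp
qed

text \<open>Integrate the derivative of \<open>x\<^sub>i * \<phi>\<^sup>2\<close>.\<close>
lemma test_fn_poincare:
  assumes \<phi>: "test_fn \<Omega> \<phi>" and \<Omega>: "\<Omega> \<subseteq> cball 0 R"
  shows "(\<integral>x. (\<phi> x)\<^sup>2 \<partial>lebesgue) \<le> 4 * R\<^sup>2 * (\<integral>x. (partial \<phi> i x)\<^sup>2 \<partial>lebesgue)"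
proof -
  have d: "\<phi> differentiable (at x)" for x
    using \<phi> test_fn_smooth smooth_fn_differentiable by blast
  have c: "continuous_on UNIV \<phi>" "continuous_on UNIV (partial \<phi> i)"
    using \<phi> test_fn_smooth test_fn_partial smooth_fn_continuous by blast+
  let ?\<psi> = "\<lambda>x. x $ i * (\<phi> x * \<phi> x)"
  have dn: "(\<lambda>x. x $ i) differentiable (at x)" for x :: "real^'a"
    using bounded_linear_imp_has_derivative[OF bounded_linear_vec_nth[of i]] by (auto simp: differentiable_def)
  have p: "partial ?\<psi> i x = 2 * (x $ i * \<phi> x * partial \<phi> i x) + (\<phi> x)\<^sup>2" for x
    by (subst partial_mult[OF dn])
      (auto simp: partial_mult[OF d d] partial_nth d power2_eq_square algebra_simps intro!: derivative_intros)
  have "(\<integral>x. partial ?\<psi> i x \<partial>lebesgue) = 0"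
  proof (rule integral_partial_zero[of _ _ R])
    show "continuous_on UNIV (partial ?\<psi> i)"
      unfolding p[abs_def] using c by (intro continuous_intros)
    show "?\<psi> x = 0" if "x \<notin> cball 0 R" for x using test_fn_outside[OF \<phi>, of x] subsetD[OF \<Omega>, of x] that by auto
  qed (use d dn in \<open>auto intro!: derivative_intros\<close>)
  moreover have i2: "integrable lebesgue (\<lambda>x. (\<phi> x)\<^sup>2)"
    using test_fn_mult_integrable[OF \<phi> c(1)] by (simp add: power2_eq_square)
  moreover have i1: "integrable lebesgue (\<lambda>x. x $ i * \<phi> x * partial \<phi> i x)"
    by (intro test_fn_mult_integrable[OF test_fn_partial[OF \<phi>]]
        continuous_on_mult[OF linear_continuous_on[OF bounded_linear_vec_nth] c(1)])
  ultimately have "(\<integral>x. (\<phi> x)\<^sup>2 \<partial>lebesgue) = (\<integral>x. - 2 * (x $ i * \<phi> x * partial \<phi> i x) \<partial>lebesgue)"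
    unfolding p by simp
  \<comment> \<open>Young's inequality together with \<open>\<bar>x $ i\<bar> \<le> R\<close>. The
    weight 1/2 lets half of the left side be absorbed, which produces the constant
    \<open>4 * R\<^sup>2\<close>.\<close>
  also have "\<dots> \<le> (\<integral>x. 1/2 * (\<phi> x)\<^sup>2 + 2 * R\<^sup>2 * (partial \<phi> i x)\<^sup>2 \<partial>lebesgue)"
  proof (rule integral_mono)
    show "integrable lebesgue (\<lambda>x. 1/2 * (\<phi> x)\<^sup>2 + 2 * R\<^sup>2 * (partial \<phi> i x)\<^sup>2)"
      using i2 test_fn_mult_integrable[OF test_fn_partial[OF \<phi>] c(2)]
      by (intro Bochner_Integration.integrable_add integrable_mult_right) (simp_all add: power2_eq_square)
    fix x
    show "- 2 * (x $ i * \<phi> x * partial \<phi> i x) \<le> 1/2 * (\<phi> x)\<^sup>2 + 2 * R\<^sup>2 * (partial \<phi> i x)\<^sup>2"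
    proof (cases "x \<in> \<Omega>")
      case True
      then have "\<bar>x $ i\<bar> \<le> R" using \<Omega> component_le_norm_cart[of x i] by auto
      then have "(x $ i)\<^sup>2 \<le> R\<^sup>2" by (metis abs_le_square_iff abs_of_nonneg order_trans abs_ge_zero)
      then have "(x $ i)\<^sup>2 * (partial \<phi> i x)\<^sup>2 \<le> R\<^sup>2 * (partial \<phi> i x)\<^sup>2" by (rule mult_right_mono) simp
      moreover have "0 \<le> (\<phi> x + 2 * (x $ i * partial \<phi> i x))\<^sup>2" by simp
      ultimately show ?thesis by (simp add: power2_eq_square algebra_simps)
    next
      case False
      then show ?thesis using test_fn_outside[OF \<phi>] by simp
    qed
  qed (use i1 in simp)
  also have "\<dots> = 1/2 * (\<integral>x. (\<phi> x)\<^sup>2 \<partial>lebesgue) + 2 * R\<^sup>2 * (\<integral>x. (partial \<phi> i x)\<^sup>2 \<partial>lebesgue)"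
    using i2 test_fn_mult_integrable[OF test_fn_partial[OF \<phi>] c(2)] by (simp add: power2_eq_square)
  finally show ?thesis by simp
qed

section \<open>Smooth bumps that fill a box\<close>

definition expdec :: "nat \<Rightarrow> real \<Rightarrow> real" where
  "expdec k t = (if t > 0 then (1/t)^k * exp (- (1/t)) else 0)"

lemma expdec_tendsto_0: "((\<lambda>t. expdec k t) \<longlongrightarrow> 0) (at 0)"
proof -
  have "((\<lambda>t. (1/t)^k / exp (1/t)) \<longlongrightarrow> 0) (at_right (0::real))"
    by (rule filterlim_compose[OF tendsto_power_div_exp_0])
      (simp add: inverse_eq_divide[symmetric] filterlim_inverse_at_top_right)
  then have r: "((\<lambda>t. expdec k t) \<longlongrightarrow> 0) (at_right 0)"
    by (rule Lim_transform_eventually)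
      (auto simp: expdec_def exp_minus divide_inverse eventually_at_right_less intro: eventually_mono[OF eventually_at_right_less])
  have "((\<lambda>t. expdec k t) \<longlongrightarrow> 0) (at_left 0)"
    by (rule tendsto_eventually) (auto simp: expdec_def eventually_at_filter)
  with r show ?thesis by (simp add: filterlim_at_split)
qed

text \<open>The powers of \<open>1/t\<close> are there for this formula: differentiating the flat
  exponential, cut off at zero, only raises the power, so the family stays closed up to linear
  combinations.\<close>

lemma expdec_deriv:
  "(expdec k has_real_derivative (- real k * expdec (Suc k) t + expdec (Suc (Suc k)) t)) (at t)"
proof -
  consider "t > 0" | "t < 0" | "t = 0" by linarith
  then show ?thesis
  proof cases
    case 1
    have "((\<lambda>t. (1/t)^k * exp (- (1/t))) has_real_derivative
       (real k * (1/t)^(k - 1) * (- (1/t\<^sup>2)) * exp (- (1/t)) + (1/t)^k * (exp (- (1/t)) * (1/t\<^sup>2)))) (at t)"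
      using 1 by (auto intro!: derivative_eq_intros simp: power2_eq_square)
    moreover have "real k * (1/t)^(k - 1) * (- (1/t\<^sup>2)) * exp (- (1/t)) + (1/t)^k * (exp (- (1/t)) * (1/t\<^sup>2))
        = - real k * expdec (Suc k) t + expdec (Suc (Suc k)) t"
      using 1 by (cases k) (simp_all add: expdec_def power2_eq_square, simp add: field_simps)
    ultimately have "((\<lambda>t. (1/t)^k * exp (- (1/t))) has_real_derivative
       (- real k * expdec (Suc k) t + expdec (Suc (Suc k)) t)) (at t)" by simp
    then show ?thesis
      by (rule has_field_derivative_transform_within_open[of _ _ _ "{0<..}"]) (use 1 in \<open>auto simp: expdec_def\<close>)
  next
    case 2
    have "((\<lambda>t. 0) has_real_derivative 0) (at t)" by simp
    then have "(expdec k has_real_derivative 0) (at t)"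
      by (rule has_field_derivative_transform_within_open[of _ _ _ "{..<0}"]) (use 2 in \<open>auto simp: expdec_def\<close>)
    then show ?thesis using 2 by (simp add: expdec_def)
  next
    case 3
    \<comment> \<open>At zero the difference quotient of \<open>expdec k\<close> is literally
      \<open>expdec (Suc k)\<close>, which tends to zero from both sides.\<close>
    have "((\<lambda>h. (expdec k (0 + h) - expdec k 0) / h) \<longlongrightarrow> 0) (at 0)"
    proof (rule Lim_transform_eventually[OF expdec_tendsto_0[of "Suc k"]])
      have "expdec (Suc k) h = (expdec k (0 + h) - expdec k 0) / h" for h
        by (simp add: expdec_def)
      then show "\<forall>\<^sub>F h in at 0. expdec (Suc k) h = (expdec k (0 + h) - expdec k 0) / h" by simp
    qed
    then have "(expdec k has_real_derivative 0) (at 0)" by (simp only: DERIV_def)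
    then show ?thesis using 3 by (simp add: expdec_def)
  qed
qed

text \<open>A class of explicit functions closed under directional derivatives, made to be the
  coinduction invariant for \<open>smooth_fn\<close>. The second clause admits affine functions of
  one coordinate so that the chain rule stays inside the class.\<close>

inductive bump_alg :: "('n::finite) fn \<Rightarrow> bool" where
  const: "bump_alg (\<lambda>x. c)"
| expdec: "bump_alg (\<lambda>x. expdec k (c * x $ i + d))"
| add: "bump_alg f \<Longrightarrow> bump_alg g \<Longrightarrow> bump_alg (\<lambda>x. f x + g x)"
| mult: "bump_alg f \<Longrightarrow> bump_alg g \<Longrightarrow> bump_alg (\<lambda>x. f x * g x)"

lemma bump_alg_deriv:
  "bump_alg f \<Longrightarrow> \<exists>F. (\<forall>x. (f has_derivative F x) (at x)) \<and> (\<forall>v. bump_alg (\<lambda>x. F x v))"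
proof (induction rule: bump_alg.induct)
  case (const c)
  show ?case by (rule exI[of _ "\<lambda>x h. 0"]) (auto intro: bump_alg.const)
next
  case (expdec k c i d)
  let ?d = "\<lambda>t. - real k * expdec (Suc k) t + expdec (Suc (Suc k)) t"
  let ?F = "\<lambda>x h. (c * h $ i) * ?d (c * x $ i + d)"
  have "((\<lambda>x. expdec k (c * x $ i + d)) has_derivative ?F x) (at x)" for x
  proof -
    have "((\<lambda>x. c * x $ i + d) has_derivative (\<lambda>h. c * h $ i)) (at x)"
      using bounded_linear_imp_has_derivative[OF bounded_linear_vec_nth[of i], of "at x"]
      by (auto intro!: derivative_eq_intros)
    from has_derivative_compose[OF this expdec_deriv[unfolded has_field_derivative_def]]
    show ?thesis by (simp add: mult.commute)
  qed
  moreover have "bump_alg (\<lambda>x. ?F x v)" for v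
    by (intro bump_alg.intros)
  ultimately show ?case by (intro exI[of _ ?F] conjI allI)
next
  case (add f g)
  then obtain F G where F: "\<forall>x. (f has_derivative F x) (at x)" "\<forall>v. bump_alg (\<lambda>x. F x v)"
    and G: "\<forall>x. (g has_derivative G x) (at x)" "\<forall>v. bump_alg (\<lambda>x. G x v)" by (elim exE conjE)
  show ?case
    by (rule exI[of _ "\<lambda>x h. F x h + G x h"]) (use F G in \<open>auto intro!: has_derivative_add bump_alg.add\<close>)
next
  case (mult f g)
  then obtain F G where F: "\<forall>x. (f has_derivative F x) (at x)" "\<forall>v. bump_alg (\<lambda>x. F x v)"
    and G: "\<forall>x. (g has_derivative G x) (at x)" "\<forall>v. bump_alg (\<lambda>x. G x v)" by (elim exE conjE)
  show ?case
    by (rule exI[of _ "\<lambda>x h. f x * G x h + F x h * g x"])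
      (use F G mult.hyps in \<open>auto intro!: has_derivative_mult bump_alg.add bump_alg.mult\<close>)
qed

lemma bump_alg_smooth:
  assumes "bump_alg f" shows "smooth_fn f"
proof (rule smooth_fn.coinduct[of bump_alg, OF assms])
  fix f :: "'a fn" assume "bump_alg f"
  then obtain F where F: "\<forall>x. (f has_derivative F x) (at x)" "\<forall>v. bump_alg (\<lambda>x. F x v)"
    using bump_alg_deriv by blast
  have "partial f i = (\<lambda>x. F x (axis i 1))" for i
    using F(1) by (auto simp: partial_eq)
  then show "\<exists>\<phi>. f = \<phi> \<and> (\<forall>x. \<phi> differentiable (at x)) \<and> (\<forall>i. bump_alg (partial \<phi> i) \<or> smooth_fn (partial \<phi> i))"
    using F by (intro exI[of _ f]) (auto simp: differentiable_def)
qed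

lemma bump_alg_prod: "finite S \<Longrightarrow> (\<And>i. i \<in> S \<Longrightarrow> bump_alg (f i)) \<Longrightarrow> bump_alg (\<lambda>x. \<Prod>i\<in>S. f i x)"
  by (induction S rule: finite_induct) (auto intro: bump_alg.const bump_alg.mult)

text \<open>Two flat exponentials per coordinate, one for each face, with arguments steepened by
  \<open>m\<close>: for \<open>s > 0\<close> the value exp (- 1 / (m s)) tends to 1. The arguments
  are spelled in the shape \<open>c * x $ i + d\<close> to fit the clause
  \<open>bump_alg.expdec\<close>.\<close>

definition box_bump :: "real^'n \<Rightarrow> real^'n \<Rightarrow> nat \<Rightarrow> ('n::finite) fn" where
  "box_bump a b m x = (\<Prod>i\<in>UNIV. expdec 0 (real m * x $ i + - (real m * a $ i)) * expdec 0 (- real m * x $ i + real m * b $ i))"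

lemma expdec0_range: "0 \<le> expdec 0 t" "expdec 0 t \<le> 1"
  by (auto simp: expdec_def)

lemma expdec0_limit:
  assumes "\<And>m. g m = real m * s"
  shows "(\<lambda>m. expdec 0 (g m)) \<longlonglongrightarrow> (if s > 0 then 1 else 0)"
proof (cases "s > 0")
  case True
  have "(\<lambda>m. exp (- (1 / s * inverse (real m)))) \<longlonglongrightarrow> exp (- (1 / s * 0))"
    by (intro tendsto_intros lim_inverse_n)
  moreover have "\<forall>\<^sub>F m in sequentially. exp (- (1 / s * inverse (real m))) = expdec 0 (g m)"
    using eventually_gt_at_top[of 0]
  proof eventually_elim
    case (elim m)
    then show ?case using True by (simp add: expdec_def assms field_simps)
  qed
  ultimately have "(\<lambda>m. expdec 0 (g m)) \<longlonglongrightarrow> exp (- (1 / s * 0))" by (rule Lim_transform_eventually)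
  then show ?thesis using True by simp
next
  case False
  then have "g m \<le> 0" for m by (simp add: assms mult_nonneg_nonpos)
  then have "expdec 0 (g m) = 0" for m by (simp add: expdec_def not_less)
  then show ?thesis using False by simp
qed

lemma box_bump_limit: "(\<lambda>m. box_bump a b m x) \<longlonglongrightarrow> indicator (box a b) x"
proof -
  have "(\<lambda>m. box_bump a b m x) \<longlonglongrightarrow>
    (\<Prod>i\<in>UNIV. (if x $ i - a $ i > 0 then 1 else 0) * (if b $ i - x $ i > 0 then 1 else 0))"
    unfolding box_bump_def
    by (intro tendsto_prod tendsto_mult expdec0_limit) (simp_all add: algebra_simps)
  also have "(\<Prod>i\<in>UNIV. (if x $ i - a $ i > 0 then 1 else 0) * (if b $ i - x $ i > 0 then 1 else 0 :: real))
     = indicator (box a b) x"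
  proof (cases "x \<in> box a b")
    case False
    then obtain i where i: "\<not> (a $ i < x $ i \<and> x $ i < b $ i)" by (auto simp: mem_box_cart)
    have "(\<Prod>i\<in>UNIV. (if x $ i - a $ i > 0 then 1 else 0) * (if b $ i - x $ i > 0 then 1 else 0 :: real)) = 0"
      by (rule prod_zero) (use i in auto)
    then show ?thesis using False by simp
  qed (simp add: mem_box_cart)
  finally show ?thesis .
qed

lemma box_bump_range: "\<bar>box_bump a b m x\<bar> \<le> 1"
proof -
  have "0 \<le> box_bump a b m x" unfolding box_bump_def
    by (intro prod_nonneg mult_nonneg_nonneg ballI expdec0_range)
  moreover have "box_bump a b m x \<le> 1" unfolding box_bump_def
    by (intro prod_le_1 conjI mult_nonneg_nonneg mult_le_one expdec0_range)
  ultimately show ?thesis by simp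
qed

lemma box_bump_test_fn:
  assumes "cbox a b \<subseteq> \<Omega>"
  shows "test_fn \<Omega> (box_bump a b m)"
proof -
  have "bump_alg (box_bump a b m)"
    unfolding box_bump_def[abs_def] by (intro bump_alg_prod bump_alg.mult bump_alg.expdec) auto
  then have 1: "smooth_fn (box_bump a b m)" by (rule bump_alg_smooth)
  have "box_bump a b m x = 0" if x: "x \<notin> cbox a b" for x
  proof -
    obtain i where "x $ i < a $ i \<or> b $ i < x $ i"
      using x by (auto simp: mem_box_cart not_le)
    then have "real m * x $ i \<le> real m * a $ i \<or> real m * b $ i \<le> real m * x $ i"
      by (auto intro: mult_left_mono)
    then show ?thesis
      unfolding box_bump_def by (intro prod_zero) (auto simp: expdec_def intro!: exI[of _ i])
  qed
  then have "{x. box_bump a b m x \<noteq> 0} \<subseteq> cbox a b" by blast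
  then have sub: "closure {x. box_bump a b m x \<noteq> 0} \<subseteq> cbox a b"
    by (intro closure_minimal) auto
  then have "compact (closure {x. box_bump a b m x \<noteq> 0})"
    using compact_Int_closed[OF compact_cbox closed_closure, of a b "{x. box_bump a b m x \<noteq> 0}"]
    by (simp add: Int_absorb1)
  then show ?thesis using 1 sub assms by (simp add: test_fn_def)
qed

text \<open>The box averages of \<open>f\<close> vanish, and almost every point is a Lebesgue point.\<close>
lemma fundamental_lemma:
  fixes f :: "('n::finite) fn"
  assumes "open \<Omega>" and f: "integrable lebesgue f"
    and orth: "\<And>\<phi>. test_fn \<Omega> \<phi> \<Longrightarrow> (\<integral>x. f x * \<phi> x \<partial>lebesgue) = 0"
  shows "AE x in lebesgue. x \<in> \<Omega> \<longrightarrow> f x = 0"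
proof -
  have si: "set_integrable lebesgue S f" if "S \<in> sets lebesgue" for S
    using integrable_mult_indicator[OF that f] by (simp add: set_integrable_def)
  \<comment> \<open>The bumps are bounded by 1, so dominated convergence with majorant
    \<open>\<bar>f x\<bar>\<close> replaces them by the indicator of the open box; open and closed
    box have the same integral.\<close>
  have box0: "integral (cbox a b) f = 0" if sub: "cbox a b \<subseteq> \<Omega>" for a b
  proof -
    have "(\<lambda>m. \<integral>x. f x * box_bump a b m x \<partial>lebesgue) \<longlonglongrightarrow> (\<integral>x. f x * indicator (box a b) x \<partial>lebesgue)"
    proof (rule integral_dominated_convergence)
      show "integrable lebesgue (\<lambda>x. \<bar>f x\<bar>)" using f by simp
      show "(\<lambda>x. f x * indicator (box a b) x) \<in> borel_measurable lebesgue"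
        using f by (intro borel_measurable_times borel_measurable_indicator) auto
      show "(\<lambda>x. f x * box_bump a b m x) \<in> borel_measurable lebesgue" for m
      proof (intro borel_measurable_times)
        have "box_bump a b m \<in> borel_measurable borel"
          by (intro borel_measurable_continuous_onI smooth_fn_continuous test_fn_smooth[OF box_bump_test_fn[OF sub]])
        then show "(\<lambda>x. box_bump a b m x) \<in> borel_measurable lebesgue"
          by (intro measurable_completion) simp
      qed (use f in auto)
      show "AE x in lebesgue. (\<lambda>m. f x * box_bump a b m x) \<longlonglongrightarrow> f x * indicator (box a b) x"
        by (intro AE_I2 tendsto_intros box_bump_limit)
      have "\<bar>f x\<bar> * \<bar>box_bump a b m x\<bar> \<le> \<bar>f x\<bar> * 1" for m x
        by (intro mult_left_mono box_bump_range) auto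
      then show "AE x in lebesgue. norm (f x * box_bump a b m x) \<le> \<bar>f x\<bar>" for m
        by (simp add: abs_mult)
    qed
    moreover have "(\<integral>x. f x * box_bump a b m x \<partial>lebesgue) = 0" for m
      by (rule orth[OF box_bump_test_fn[OF sub]])
    ultimately have "(\<integral>x. f x * indicator (box a b) x \<partial>lebesgue) = 0"
      by (simp add: LIMSEQ_const_iff)
    then have "(LINT x:box a b|lebesgue. f x) = 0" by (simp add: set_lebesgue_integral_def mult.commute)
    then have "integral (box a b) f = 0"
      using set_lebesgue_integral_eq_integral(2)[OF si[of "box a b"]] by simp
    then show ?thesis by (simp add: integral_open_interval)
  qed
  have "f integrable_on cbox a b" for a b
    by (rule set_lebesgue_integral_eq_integral(1)[OF si]) simp
  then obtain N where N: "negligible N"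
    "\<And>x e. \<lbrakk>x \<notin> N; 0 < e\<rbrakk> \<Longrightarrow> \<exists>d>0. \<forall>h. 0 < h \<and> h < d \<longrightarrow>
        norm (integral (cbox x (x + h *\<^sub>R One)) f /\<^sub>R h ^ DIM(real^'n) - f x) < e"
    using integrable_ccontinuous_explicit by blast
  have z: "f x = 0" if x: "x \<in> \<Omega>" "x \<notin> N" for x
  proof (rule ccontr)
    assume "f x \<noteq> 0"
    then obtain d where d: "d > 0" "\<And>h. 0 < h \<Longrightarrow> h < d \<Longrightarrow>
        norm (integral (cbox x (x + h *\<^sub>R One)) f /\<^sub>R h ^ DIM(real^'n) - f x) < \<bar>f x\<bar>"
      using N(2)[OF x(2), of "\<bar>f x\<bar>"] by auto
    obtain r where r: "r > 0" "ball x r \<subseteq> \<Omega>" using \<open>open \<Omega>\<close> x(1) by (auto simp: open_contains_ball)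
    define n where "n = norm (One :: real^'n)"
    have n0: "n \<ge> 0" by (simp add: n_def)
    \<comment> \<open>\<open>h\<close> has to undercut \<open>d\<close> and to keep a cube of
      diameter \<open>h * n\<close> inside \<open>ball x r\<close>; adding 1 to \<open>n\<close>
      keeps the denominator positive.\<close>
    define h where "h = min (d/2) (r / (2 * (n + 1)))"
    have h: "0 < h" "h < d" using d(1) r(1) n0 by (auto simp: h_def)
    have hn: "h * n < r"
    proof -
      have "h * n \<le> r / (2 * (n + 1)) * n" using n0 by (intro mult_right_mono) (simp_all add: h_def)
      also have "\<dots> < r" using r(1) n0 by (simp add: field_simps add_nonneg_pos)
      finally show ?thesis .
    qed
    have "cbox x (x + h *\<^sub>R One) \<subseteq> ball x r"
    proof
      fix y assume y: "y \<in> cbox x (x + h *\<^sub>R One)"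
      have "norm (y - x) \<le> norm (h *\<^sub>R One :: real^'n)"
        using y by (intro norm_le_componentwise) (auto simp: mem_box inner_diff_left inner_add_left)
      also have "\<dots> = h * n" using h by (simp add: n_def)
      finally show "y \<in> ball x r" using hn by (simp add: dist_norm norm_minus_commute)
    qed
    then have "integral (cbox x (x + h *\<^sub>R One)) f = 0" using r(2) by (intro box0) auto
    then show False using d(2)[OF h] by simp
  qed
  have "AE x in lebesgue. x \<notin> N" using N(1) by (simp add: negligible_iff_null_sets AE_not_in)
  then show ?thesis by eventually_elim (use z in auto)
qed

section \<open>Functions on the domain\<close>

text \<open>The type \<open>l2\<close> cannot depend on \<open>\<Omega>\<close>: functions on \<open>\<Omega>\<close> are extended by zero.\<close>
definition emb :: "(real^'n::finite) set \<Rightarrow> 'n fn \<Rightarrow> (real^'n) l2" where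
  "emb \<Omega> f = abs_l2 (\<lambda>x. indicator \<Omega> x * f x)"

lemma open_lebesgue: "open \<Omega> \<Longrightarrow> \<Omega> \<inter> space lebesgue \<in> sets lebesgue"
  by simp

lemma L2_iff_sqint:
  assumes "open \<Omega>" shows "L2 \<Omega> f \<longleftrightarrow> sqint (\<lambda>x. indicator \<Omega> x * f x)"
proof -
  have e: "(\<lambda>x. indicator \<Omega> x * (f x)\<^sup>2) = (\<lambda>x. (indicator \<Omega> x * f x)\<^sup>2)"
    by (auto simp: fun_eq_iff indicator_def)
  show ?thesis
    unfolding L2_def sqint_def borel_measurable_restrict_space_iff[OF open_lebesgue[OF assms]]
      integrable_restrict_space[OF open_lebesgue[OF assms]] real_scaleR_def e ..
qed

lemma L2_measurable: "L2 \<Omega> f \<Longrightarrow> f \<in> borel_measurable (lebesgue_on \<Omega>)"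
  by (simp add: L2_def)

lemma L2_lincomb:
  assumes "open \<Omega>" "L2 \<Omega> f" "L2 \<Omega> g" shows "L2 \<Omega> (\<lambda>x. a * f x + b * g x)"
    and "emb \<Omega> (\<lambda>x. a * f x + b * g x) = a *\<^sub>R emb \<Omega> f + b *\<^sub>R emb \<Omega> g"
proof -
  have s: "sqint (\<lambda>x. indicator \<Omega> x * f x)" "sqint (\<lambda>x. indicator \<Omega> x * g x)"
    using assms by (simp_all add: L2_iff_sqint)
  have e: "(\<lambda>x. indicator \<Omega> x * (a * f x + b * g x)) = (\<lambda>x. a * (indicator \<Omega> x * f x) + b * (indicator \<Omega> x * g x))"
    by (auto simp: fun_eq_iff algebra_simps)
  show "L2 \<Omega> (\<lambda>x. a * f x + b * g x)"
    unfolding L2_iff_sqint[OF assms(1)] e using s by (intro sqint_add sqint_cmult)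
  show "emb \<Omega> (\<lambda>x. a * f x + b * g x) = a *\<^sub>R emb \<Omega> f + b *\<^sub>R emb \<Omega> g"
    unfolding emb_def e using s by (simp add: abs_l2_add abs_l2_cmult sqint_cmult)
qed

lemma L2_add:
  assumes "open \<Omega>" "L2 \<Omega> f" "L2 \<Omega> g" shows "L2 \<Omega> (\<lambda>x. f x + g x)"
    and "emb \<Omega> (\<lambda>x. f x + g x) = emb \<Omega> f + emb \<Omega> g"
  using L2_lincomb[OF assms, of 1 1] by simp_all

lemma L2_diff:
  assumes "open \<Omega>" "L2 \<Omega> f" "L2 \<Omega> g" shows "L2 \<Omega> (\<lambda>x. f x - g x)"
    and "emb \<Omega> (\<lambda>x. f x - g x) = emb \<Omega> f - emb \<Omega> g"
  using L2_lincomb[OF assms, of 1 "-1"] by simp_all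

lemma L2_cmult:
  assumes "open \<Omega>" "L2 \<Omega> f" shows "L2 \<Omega> (\<lambda>x. c * f x)"
    and "emb \<Omega> (\<lambda>x. c * f x) = c *\<^sub>R emb \<Omega> f"
  using L2_lincomb[OF assms assms(2), of c 0] by simp_all

lemma L2_mult_integrable:
  assumes "open \<Omega>" "L2 \<Omega> f" "L2 \<Omega> g" shows "integrable (lebesgue_on \<Omega>) (\<lambda>x. f x * g x)"
proof -
  have "(\<lambda>x. indicator \<Omega> x *\<^sub>R (f x * g x)) = (\<lambda>x. (indicator \<Omega> x * f x) * (indicator \<Omega> x * g x))"
    by (auto simp: fun_eq_iff indicator_def)
  then show ?thesis
    using sqint_mult[of "\<lambda>x. indicator \<Omega> x * f x" "\<lambda>x. indicator \<Omega> x * g x"] assms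
    by (simp add: integrable_restrict_space L2_iff_sqint open_lebesgue)
qed

lemma inner_emb:
  assumes "open \<Omega>" "L2 \<Omega> f" "L2 \<Omega> g" shows "emb \<Omega> f \<bullet> emb \<Omega> g = ipL2 \<Omega> f g"
proof -
  have "(\<lambda>x. indicator \<Omega> x *\<^sub>R (f x * g x)) = (\<lambda>x. (indicator \<Omega> x * f x) * (indicator \<Omega> x * g x))"
    by (auto simp: fun_eq_iff indicator_def)
  then show ?thesis
    using assms by (simp add: emb_def inner_abs_l2 L2_iff_sqint ipL2_def integral_restrict_space open_lebesgue)
qed

lemma norm_emb:
  assumes "open \<Omega>" "L2 \<Omega> f" shows "norm (emb \<Omega> f) = nrmL2 \<Omega> f"
  by (simp add: norm_eq_sqrt_inner inner_emb[OF assms assms(2)] nrmL2_def)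

lemma finite_measure_lebesgue_on_bounded:
  assumes "open \<Omega>" "bounded \<Omega>" shows "finite_measure (lebesgue_on \<Omega>)"
proof
  have "\<Omega> \<in> lmeasurable" using assms by (simp add: lmeasurable_open)
  then show "emeasure (lebesgue_on \<Omega>) (space (lebesgue_on \<Omega>)) \<noteq> \<infinity>"
    using assms by (simp add: emeasure_restrict_space fmeasurable_def)
qed

lemma L2_bounded_fun:
  assumes \<Omega>: "open \<Omega>" "bounded \<Omega>" and f: "f \<in> borel_measurable (lebesgue_on \<Omega>)"
    and B: "\<And>x. \<bar>f x\<bar> \<le> B"
  shows "L2 \<Omega> f"
proof -
  interpret finite_measure "lebesgue_on \<Omega>" by (rule finite_measure_lebesgue_on_bounded[OF \<Omega>])
  have "integrable (lebesgue_on \<Omega>) (\<lambda>x. (f x)\<^sup>2)"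
  proof (rule integrable_const_bound[of _ "B\<^sup>2"])
    have "(f x)\<^sup>2 \<le> B\<^sup>2" for x using B[of x] by (metis abs_ge_zero order_trans abs_le_square_iff abs_of_nonneg)
    then show "AE x in lebesgue_on \<Omega>. norm ((f x)\<^sup>2) \<le> B\<^sup>2" by simp
  qed (use f in simp)
  then show ?thesis using f by (simp add: L2_def)
qed

lemma L2_integrable:
  assumes "open \<Omega>" "bounded \<Omega>" "L2 \<Omega> f" shows "integrable (lebesgue_on \<Omega>) f"
  using L2_mult_integrable[OF assms(1,3) L2_bounded_fun[OF assms(1,2), of "\<lambda>x. 1" 1]] by simp

lemma test_fn_sqint:
  assumes "test_fn \<Omega> \<phi>" shows "sqint \<phi>"
proof -
  have c: "continuous_on UNIV \<phi>" by (rule smooth_fn_continuous[OF test_fn_smooth[OF assms]])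
  then have "\<phi> \<in> borel_measurable lebesgue"
    by (intro measurable_completion) (simp add: borel_measurable_continuous_onI)
  then show ?thesis using test_fn_mult_integrable[OF assms c] by (simp add: sqint_def power2_eq_square)
qed

lemma test_fn_indicator: "test_fn \<Omega> \<phi> \<Longrightarrow> (\<lambda>x. indicator \<Omega> x * \<phi> x) = \<phi>"
  using test_fn_outside[of \<Omega> \<phi>] by (auto simp: fun_eq_iff indicator_def)

lemma test_fn_L2:
  assumes "open \<Omega>" "test_fn \<Omega> \<phi>" shows "L2 \<Omega> \<phi>" "emb \<Omega> \<phi> = abs_l2 \<phi>"
  using assms by (simp_all add: L2_iff_sqint emb_def test_fn_indicator test_fn_sqint)

text \<open>The fundamental lemma in Hilbert space form, on which uniqueness of weak gradients and
  of \<open>A p\<close> rests. Boundedness of the domain turns square integrability into the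
  integrability that the pointwise version asks for.\<close>

lemma orthogonal_test_fns_zero:
  assumes \<Omega>: "open \<Omega>" "bounded \<Omega>" and f: "L2 \<Omega> f"
    and orth: "\<And>\<phi>. test_fn \<Omega> \<phi> \<Longrightarrow> emb \<Omega> f \<bullet> emb \<Omega> \<phi> = 0"
  shows "emb \<Omega> f = 0"
proof -
  let ?f = "\<lambda>x. indicator \<Omega> x * f x"
  have sf: "sqint ?f" using f \<Omega> by (simp add: L2_iff_sqint)
  have "integrable lebesgue ?f"
    using L2_integrable[OF \<Omega> f] \<Omega> by (simp add: integrable_restrict_space)
  moreover have "(\<integral>x. ?f x * \<phi> x \<partial>lebesgue) = 0" if "test_fn \<Omega> \<phi>" for \<phi>
    using orth[OF that, unfolded test_fn_L2(2)[OF \<Omega>(1) that]] unfolding emb_def inner_abs_l2[OF sf test_fn_sqint[OF that]] .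
  ultimately have "AE x in lebesgue. x \<in> \<Omega> \<longrightarrow> ?f x = 0"
    by (intro fundamental_lemma[OF \<Omega>(1)])
  then have "AE x in lebesgue. ?f x = 0" by (rule eventually_mono) (auto simp: indicator_def)
  then have "abs_l2 ?f = abs_l2 (\<lambda>x. 0)" using sf by (simp add: abs_l2_eq_iff sqint_0)
  then show ?thesis by (simp add: emb_def zero_l2.abs_eq)
qed

section \<open>Multiplication by bounded coefficients\<close>

definition bdd_coef :: "('a::euclidean_space \<Rightarrow> real) \<Rightarrow> bool" where
  "bdd_coef m \<longleftrightarrow> m \<in> borel_measurable lebesgue \<and> (\<exists>M. AE x in lebesgue. \<bar>m x\<bar> \<le> M)"

text \<open>Another representative changes the product on a null set only, so picking
  \<open>rep_l2 h\<close> is harmless; an essentially bounded coefficient thus becomes a bounded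
  operator on classes.\<close>

definition mulop :: "('a::euclidean_space \<Rightarrow> real) \<Rightarrow> 'a l2 \<Rightarrow> 'a l2" where
  "mulop m h = abs_l2 (\<lambda>x. m x * rep_l2 h x)"

lemma sqint_bdd_mult:
  assumes "bdd_coef m" "sqint f" shows "sqint (\<lambda>x. m x * f x)"
    and "AE x in lebesgue. \<bar>m x\<bar> \<le> M \<Longrightarrow> norm (abs_l2 (\<lambda>x. m x * f x)) \<le> \<bar>M\<bar> * norm (abs_l2 f)"
proof -
  have m: "m \<in> borel_measurable lebesgue" using assms by (simp add: bdd_coef_def)
  have f: "f \<in> borel_measurable lebesgue" "integrable lebesgue (\<lambda>x. (f x)\<^sup>2)" using assms by (simp_all add: sqint_def)
  have *: "AE x in lebesgue. (m x * f x)\<^sup>2 \<le> M\<^sup>2 * (f x)\<^sup>2" if "AE x in lebesgue. \<bar>m x\<bar> \<le> M" for M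
    using that
  proof eventually_elim
    case (elim x)
    then have "(m x)\<^sup>2 \<le> M\<^sup>2" by (metis abs_ge_zero order_trans abs_le_square_iff abs_of_nonneg)
    then show ?case by (simp add: power_mult_distrib mult_right_mono)
  qed
  obtain K where K: "AE x in lebesgue. \<bar>m x\<bar> \<le> K" using assms(1) unfolding bdd_coef_def by (elim conjE exE)
  have "integrable lebesgue (\<lambda>x. (m x * f x)\<^sup>2)"
  proof (rule Bochner_Integration.integrable_bound[of _ "\<lambda>x. K\<^sup>2 * (f x)\<^sup>2"])
    show "AE x in lebesgue. norm ((m x * f x)\<^sup>2) \<le> norm (K\<^sup>2 * (f x)\<^sup>2)" using *[OF K] by simp
  qed (use m f in simp_all)
  then show s: "sqint (\<lambda>x. m x * f x)" using m f by (simp add: sqint_def)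
  show "norm (abs_l2 (\<lambda>x. m x * f x)) \<le> \<bar>M\<bar> * norm (abs_l2 f)" if "AE x in lebesgue. \<bar>m x\<bar> \<le> M"
  proof (rule power2_le_imp_le)
    have "(norm (abs_l2 (\<lambda>x. m x * f x)))\<^sup>2 \<le> (\<integral>x. M\<^sup>2 * (f x)\<^sup>2 \<partial>lebesgue)"
      unfolding norm_abs_l2[OF s] using s f by (intro integral_mono_AE *[OF that]) (simp_all add: sqint_def)
    also have "\<dots> = (\<bar>M\<bar> * norm (abs_l2 f))\<^sup>2"
      by (simp add: power_mult_distrib norm_abs_l2[OF assms(2)])
    finally show "(norm (abs_l2 (\<lambda>x. m x * f x)))\<^sup>2 \<le> (\<bar>M\<bar> * norm (abs_l2 f))\<^sup>2" .
  qed simp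
qed

lemma mulop_abs:
  assumes "bdd_coef m" "sqint f" shows "mulop m (abs_l2 f) = abs_l2 (\<lambda>x. m x * f x)"
  unfolding mulop_def
  using rep_abs_l2[OF assms(2)] assms
  by (subst abs_l2_eq_iff) (auto intro: sqint_bdd_mult sqint_rep elim!: eventually_mono)

lemma bounded_linear_mulop:
  assumes "bdd_coef m" shows "bounded_linear (mulop m)"
proof -
  obtain M where M: "AE x in lebesgue. \<bar>m x\<bar> \<le> M" using assms unfolding bdd_coef_def by (elim conjE exE)
  show ?thesis
  proof (rule bounded_linear_intro[of _ "\<bar>M\<bar>"])
    fix h k :: "'a l2" and c :: real
    let ?f = "rep_l2 h" and ?g = "rep_l2 k"
    have s: "sqint ?f" "sqint ?g" by (rule sqint_rep)+
    have h: "h = abs_l2 ?f" "k = abs_l2 ?g" by simp_all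
    have "mulop m (abs_l2 (\<lambda>x. ?f x + ?g x)) = mulop m (abs_l2 ?f) + mulop m (abs_l2 ?g)"
      using s by (simp add: mulop_abs[OF assms] sqint_add sqint_bdd_mult[OF assms] abs_l2_add[symmetric] distrib_left
          del: abs_rep_l2)
    then show "mulop m (h + k) = mulop m h + mulop m k" using s by (simp add: abs_l2_add)
    have "mulop m (abs_l2 (\<lambda>x. c * ?f x)) = c *\<^sub>R mulop m (abs_l2 ?f)"
      using s by (simp add: mulop_abs[OF assms] sqint_cmult sqint_bdd_mult[OF assms] abs_l2_cmult[symmetric] mult.left_commute
          del: abs_rep_l2)
    then show "mulop m (c *\<^sub>R h) = c *\<^sub>R mulop m h" using s by (simp add: abs_l2_cmult)
    show "norm (mulop m h) \<le> norm h * \<bar>M\<bar>"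
      using sqint_bdd_mult(2)[OF assms s(1) M] by (simp add: mulop_def mult.commute)
  qed
qed

lemma mulop_sym:
  assumes "bdd_coef m" shows "mulop m f \<bullet> g = f \<bullet> mulop m g"
proof -
  have s: "sqint (rep_l2 f)" "sqint (rep_l2 g)" by (rule sqint_rep)+
  have "mulop m (abs_l2 (rep_l2 f)) \<bullet> abs_l2 (rep_l2 g) = abs_l2 (rep_l2 f) \<bullet> mulop m (abs_l2 (rep_l2 g))"
    using s by (simp add: mulop_abs[OF assms] inner_abs_l2 sqint_bdd_mult[OF assms] mult_ac del: abs_rep_l2)
  then show ?thesis by simp
qed

lemma mulop_cong_AE:
  assumes "bdd_coef m" "bdd_coef m'" "AE x in lebesgue. m x = m' x"
  shows "mulop m h = mulop m' h"
  unfolding mulop_def using assms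
  by (subst abs_l2_eq_iff) (auto intro: sqint_bdd_mult sqint_rep elim!: eventually_mono)

lemma bdd_coef_indicator:
  assumes \<Omega>: "open \<Omega>" and m: "m \<in> borel_measurable (lebesgue_on \<Omega>)" "AE x in lebesgue_on \<Omega>. \<bar>m x\<bar> \<le> M"
  shows "bdd_coef (\<lambda>x. indicator \<Omega> x * m x)"
proof -
  have "AE x in lebesgue. \<bar>indicator \<Omega> x * m x\<bar> \<le> \<bar>M\<bar>"
    using m(2) unfolding AE_restrict_space_iff[OF open_lebesgue[OF \<Omega>]]
    by (rule eventually_mono) (auto simp: indicator_def)
  moreover have "(\<lambda>x. indicator \<Omega> x * m x) \<in> borel_measurable lebesgue"
    using m(1) \<Omega> by (simp add: borel_measurable_restrict_space_iff)
  ultimately show ?thesis by (auto simp: bdd_coef_def)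
qed

lemma mulop_emb:
  assumes \<Omega>: "open \<Omega>" and m: "m \<in> borel_measurable (lebesgue_on \<Omega>)" "AE x in lebesgue_on \<Omega>. \<bar>m x\<bar> \<le> M"
    and f: "L2 \<Omega> f"
  shows "L2 \<Omega> (\<lambda>x. m x * f x)" "mulop (\<lambda>x. indicator \<Omega> x * m x) (emb \<Omega> f) = emb \<Omega> (\<lambda>x. m x * f x)"
proof -
  note b = bdd_coef_indicator[OF \<Omega> m]
  have s: "sqint (\<lambda>x. indicator \<Omega> x * f x)" using f \<Omega> by (simp add: L2_iff_sqint)
  have e: "(\<lambda>x. indicator \<Omega> x * m x * (indicator \<Omega> x * f x)) = (\<lambda>x. indicator \<Omega> x * (m x * f x))"
    by (auto simp: fun_eq_iff indicator_def)
  show "L2 \<Omega> (\<lambda>x. m x * f x)"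
    using sqint_bdd_mult(1)[OF b s] \<Omega> by (simp add: e L2_iff_sqint)
  show "mulop (\<lambda>x. indicator \<Omega> x * m x) (emb \<Omega> f) = emb \<Omega> (\<lambda>x. m x * f x)"
    using mulop_abs[OF b s] by (simp add: emb_def e)
qed

section \<open>The Sobolev space\<close>

type_synonym 'n jet = "(real^'n) l2 \<times> ((real^'n) l2 ^ 'n)"

definition mk_jet :: "(real^'n::finite) set \<Rightarrow> 'n fn \<Rightarrow> (real^'n \<Rightarrow> real^'n) \<Rightarrow> 'n jet" where
  "mk_jet \<Omega> p g = (emb \<Omega> p, \<chi> i. emb \<Omega> (\<lambda>x. g x $ i))"

definition test_jet :: "(real^'n::finite) set \<Rightarrow> 'n fn \<Rightarrow> 'n jet" where
  "test_jet \<Omega> \<phi> = mk_jet \<Omega> \<phi> (\<lambda>x. \<chi> i. partial \<phi> i x)"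

text \<open>The space \<open>H_0^1\<close>, realised as the closure of the test functions paired with their gradients.\<close>
definition jets :: "(real^'n::finite) set \<Rightarrow> 'n jet set" where
  "jets \<Omega> = closure (test_jet \<Omega> ` Collect (test_fn \<Omega>))"

lemma subspace_closure:
  fixes S :: "'a::real_normed_vector set"
  assumes "subspace S" shows "subspace (closure S)"
proof (rule subspaceI)
  show "0 \<in> closure S" by (rule subsetD[OF closure_subset subspace_0[OF assms]])
next
  fix x y assume "x \<in> closure S" "y \<in> closure S"
  then obtain f g where "\<forall>n. f n \<in> S" "f \<longlonglongrightarrow> x" "\<forall>n. g n \<in> S" "g \<longlonglongrightarrow> y"
    unfolding closure_sequential by (elim exE conjE)
  then show "x + y \<in> closure S"
    unfolding closure_sequential
    by (intro exI[of _ "\<lambda>n. f n + g n"]) (auto intro: tendsto_add subspace_add[OF assms])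
next
  fix c x assume "x \<in> closure S"
  then obtain f where "\<forall>n. f n \<in> S" "f \<longlonglongrightarrow> x" unfolding closure_sequential by (elim exE conjE)
  then show "c *\<^sub>R x \<in> closure S"
    unfolding closure_sequential
    by (intro exI[of _ "\<lambda>n. c *\<^sub>R f n"]) (auto intro: tendsto_scaleR subspace_mul[OF assms])
qed

lemma test_jet_components:
  "fst (test_jet \<Omega> \<phi>) = emb \<Omega> \<phi>" "snd (test_jet \<Omega> \<phi>) $ i = emb \<Omega> (partial \<phi> i)"
  by (simp_all add: test_jet_def mk_jet_def)

lemma test_jet_lincomb:
  assumes "open \<Omega>" "test_fn \<Omega> \<phi>" "test_fn \<Omega> \<eta>"
  shows "test_jet \<Omega> (\<lambda>x. a * \<phi> x + b * \<eta> x) = a *\<^sub>R test_jet \<Omega> \<phi> + b *\<^sub>R test_jet \<Omega> \<eta>"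
proof -
  have d: "\<phi> differentiable (at x)" "\<eta> differentiable (at x)" for x
    using assms by (simp_all add: smooth_fn_differentiable[OF test_fn_smooth])
  have "partial (\<lambda>x. a * \<phi> x + b * \<eta> x) i = (\<lambda>x. a * partial \<phi> i x + b * partial \<eta> i x)" for i
  proof
    fix x
    have "(\<lambda>x. a * \<phi> x) differentiable (at x)" "(\<lambda>x. b * \<eta> x) differentiable (at x)"
      using d by (auto intro!: derivative_intros)
    then show "partial (\<lambda>x. a * \<phi> x + b * \<eta> x) i x = a * partial \<phi> i x + b * partial \<eta> i x"
      by (simp add: partial_add partial_cmult d)
  qed
  moreover have "L2 \<Omega> \<phi>" "L2 \<Omega> \<eta>" "L2 \<Omega> (partial \<phi> i)" "L2 \<Omega> (partial \<eta> i)" for i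
    using assms by (simp_all add: test_fn_L2 test_fn_partial)
  ultimately show ?thesis
    by (simp add: prod_eq_iff vec_eq_iff test_jet_components L2_lincomb[OF assms(1)])
qed

lemma subspace_jets:
  assumes "open \<Omega>" shows "subspace (jets \<Omega>)"
  unfolding jets_def
proof (intro subspace_closure subspaceI)
  show "0 \<in> test_jet \<Omega> ` Collect (test_fn \<Omega>)"
    using test_jet_lincomb[OF assms test_fn_zero test_fn_zero, of 0 0]
    by (intro image_eqI[of _ _ "\<lambda>x. 0"]) (simp_all add: test_fn_zero)
next
  fix x y assume "x \<in> test_jet \<Omega> ` Collect (test_fn \<Omega>)" "y \<in> test_jet \<Omega> ` Collect (test_fn \<Omega>)"
  then obtain \<phi> \<eta> where t: "test_fn \<Omega> \<phi>" "x = test_jet \<Omega> \<phi>" "test_fn \<Omega> \<eta>" "y = test_jet \<Omega> \<eta>" by auto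
  then show "x + y \<in> test_jet \<Omega> ` Collect (test_fn \<Omega>)"
    using test_jet_lincomb[OF assms t(1,3), of 1 1] test_fn_lincomb[OF t(1,3), of 1 1]
    by (intro image_eqI[of _ _ "\<lambda>x. 1 * \<phi> x + 1 * \<eta> x"]) simp_all
next
  fix c x assume "x \<in> test_jet \<Omega> ` Collect (test_fn \<Omega>)"
  then obtain \<phi> where t: "test_fn \<Omega> \<phi>" "x = test_jet \<Omega> \<phi>" by auto
  then show "c *\<^sub>R x \<in> test_jet \<Omega> ` Collect (test_fn \<Omega>)"
    using test_jet_lincomb[OF assms t(1,1), of c 0] test_fn_lincomb[OF t(1,1), of c 0]
    by (intro image_eqI[of _ _ "\<lambda>x. c * \<phi> x + 0 * \<phi> x"]) simp_all
qed

lemma closed_jets: "closed (jets \<Omega>)"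
  by (simp add: jets_def)

text \<open>Density packaged as an induction rule: identities and estimates on H_0^1 are reduced by
  it to smooth functions.\<close>

lemma jets_induct:
  assumes "w \<in> jets \<Omega>" "closed (Collect P)" "\<And>\<phi>. test_fn \<Omega> \<phi> \<Longrightarrow> P (test_jet \<Omega> \<phi>)"
  shows "P w"
proof -
  have "jets \<Omega> \<subseteq> Collect P" unfolding jets_def
    by (intro closure_minimal assms(2)) (use assms(3) in auto)
  from subsetD[OF this assms(1)] show ?thesis by simp
qed

lemma jets_weak_grad:
  assumes "open \<Omega>" "w \<in> jets \<Omega>" "test_fn \<Omega> \<eta>"
  shows "fst w \<bullet> emb \<Omega> (partial \<eta> i) = - (snd w $ i \<bullet> emb \<Omega> \<eta>)"
  using assms(2)
proof (rule jets_induct[where P = "\<lambda>w. fst w \<bullet> emb \<Omega> (partial \<eta> i) = - (snd w $ i \<bullet> emb \<Omega> \<eta>)"])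
  show "closed (Collect (\<lambda>w. fst w \<bullet> emb \<Omega> (partial \<eta> i) = - (snd w $ i \<bullet> emb \<Omega> \<eta>)))"
    by (intro closed_Collect_eq continuous_intros)
  fix \<phi> assume \<phi>: "test_fn \<Omega> \<phi>"
  note t = test_fn_L2(2)[OF assms(1)]
  note s = test_fn_sqint[OF \<phi>] test_fn_sqint[OF test_fn_partial[OF \<phi>]]
    test_fn_sqint[OF assms(3)] test_fn_sqint[OF test_fn_partial[OF assms(3)]]
  show "fst (test_jet \<Omega> \<phi>) \<bullet> emb \<Omega> (partial \<eta> i) = - (snd (test_jet \<Omega> \<phi>) $ i \<bullet> emb \<Omega> \<eta>)"
    using test_fn_by_parts[OF \<phi> assms(3), of i]
    unfolding test_jet_components t[OF \<phi>] t[OF assms(3)] t[OF test_fn_partial[OF \<phi>]]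
      t[OF test_fn_partial[OF assms(3)]]
    by (simp add: inner_abs_l2 s)
qed

text \<open>Limits of functions vanishing outside \<open>\<Omega>\<close> vanish there almost
  everywhere, because multiplication by the indicator is continuous and fixes every test jet. A
  representative may therefore be cut off outside \<open>\<Omega>\<close> without changing its
  class.\<close>

lemma emb_rep_jets:
  assumes "open \<Omega>" "w \<in> jets \<Omega>"
  shows "emb \<Omega> (rep_l2 (fst w)) = fst w" "emb \<Omega> (rep_l2 (snd w $ i)) = snd w $ i"
    "L2 \<Omega> (rep_l2 (fst w))" "L2 \<Omega> (rep_l2 (snd w $ i))"
proof -
  have bi: "bdd_coef (indicator \<Omega> :: real^'a \<Rightarrow> real)"
    using bdd_coef_indicator[OF assms(1), of "\<lambda>x. 1" 1] by simp
  have m: "emb \<Omega> (rep_l2 h) = mulop (indicator \<Omega>) h" for h by (simp add: emb_def mulop_def)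
  have e: "mulop (indicator \<Omega>) (emb \<Omega> f) = emb \<Omega> f" if "L2 \<Omega> f" for f
    using mulop_emb(2)[OF assms(1) _ _ that, of "\<lambda>x. 1" 1] by simp
  have bl: "bounded_linear (mulop (indicator \<Omega> :: real^'a \<Rightarrow> real))" by (rule bounded_linear_mulop[OF bi])
  show "emb \<Omega> (rep_l2 (fst w)) = fst w" unfolding m
    using assms(2)
  proof (rule jets_induct[where P = "\<lambda>w. mulop (indicator \<Omega>) (fst w) = fst w"])
    show "closed {w. mulop (indicator \<Omega>) (fst w) = fst w}"
      by (intro closed_Collect_eq continuous_intros bounded_linear.continuous_on[OF bl])
  qed (simp add: test_jet_components e test_fn_L2(1) assms(1))
  show "emb \<Omega> (rep_l2 (snd w $ i)) = snd w $ i" unfolding m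
    using assms(2)
  proof (rule jets_induct[where P = "\<lambda>w. mulop (indicator \<Omega>) (snd w $ i) = snd w $ i"])
    show "closed {w. mulop (indicator \<Omega>) (snd w $ i) = snd w $ i}"
      by (intro closed_Collect_eq continuous_intros bounded_linear.continuous_on[OF bl])
  qed (simp add: test_jet_components e test_fn_L2(1) assms(1) test_fn_partial)
  show "L2 \<Omega> (rep_l2 (fst w))" "L2 \<Omega> (rep_l2 (snd w $ i))"
    using sqint_bdd_mult(1)[OF bi sqint_rep] by (simp_all add: L2_iff_sqint[OF assms(1)])
qed

text \<open>This is closability of the gradient: a limit jet with zero function part has a gradient
  part orthogonal to all test functions. It allows H_0^1, a space of functions, to be identified
  with a space of pairs.\<close>

lemma jets_fst_inj:
  assumes \<Omega>: "open \<Omega>" "bounded \<Omega>" and w: "w \<in> jets \<Omega>" "w' \<in> jets \<Omega>" "fst w = fst w'"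
  shows "w = w'"
proof -
  let ?d = "w - w'"
  have d: "?d \<in> jets \<Omega>" using subspace_diff[OF subspace_jets[OF \<Omega>(1)] w(1,2)] .
  have "snd ?d $ i = 0" for i
  proof -
    have "emb \<Omega> (rep_l2 (snd ?d $ i)) = 0"
    proof (rule orthogonal_test_fns_zero[OF \<Omega> emb_rep_jets(4)[OF \<Omega>(1) d]])
      fix \<phi> assume "test_fn \<Omega> \<phi>"
      from jets_weak_grad[OF \<Omega>(1) d this, of i]
      show "emb \<Omega> (rep_l2 (snd ?d $ i)) \<bullet> emb \<Omega> \<phi> = 0"
        unfolding emb_rep_jets(2)[OF \<Omega>(1) d] using w(3) by simp
    qed
    then show ?thesis unfolding emb_rep_jets(2)[OF \<Omega>(1) d] .
  qed
  then show ?thesis using w(3) by (simp add: prod_eq_iff vec_eq_iff)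
qed

lemma nrmL2_emb_diff:
  assumes "open \<Omega>" "L2 \<Omega> f" "L2 \<Omega> g"
  shows "nrmL2 \<Omega> (\<lambda>x. f x - g x) = dist (emb \<Omega> f) (emb \<Omega> g)"
  by (simp add: dist_norm L2_diff(2)[OF assms, symmetric] norm_emb[OF assms(1) L2_diff(1)[OF assms]])

lemma weak_grad_emb:
  assumes "open \<Omega>" "L2 \<Omega> p" "\<And>i. L2 \<Omega> (\<lambda>x. g x $ i)"
  shows "weak_grad \<Omega> p g \<longleftrightarrow>
    (\<forall>\<phi>. test_fn \<Omega> \<phi> \<longrightarrow> (\<forall>i. emb \<Omega> p \<bullet> emb \<Omega> (partial \<phi> i) = - (emb \<Omega> (\<lambda>x. g x $ i) \<bullet> emb \<Omega> \<phi>)))"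
  unfolding weak_grad_def
  using assms by (simp add: inner_emb test_fn_L2(1) test_fn_partial)

text \<open>The weak gradient demanded by \<open>H01\<close> comes with the limit, since limits of
  test jets inherit integration by parts; it remains to pick representatives of the gradient
  components.\<close>

lemma H01_iff_jet:
  assumes \<Omega>: "open \<Omega>"
  shows "H01 \<Omega> p \<longleftrightarrow> L2 \<Omega> p \<and> (\<exists>G. (emb \<Omega> p, G) \<in> jets \<Omega>)"
proof
  assume "H01 \<Omega> p"
  then obtain g \<phi> where p: "L2 \<Omega> p" and all: "\<forall>i. L2 \<Omega> (\<lambda>x. g x $ i)" "\<forall>k. test_fn \<Omega> (\<phi> k)"
      "\<forall>i. (\<lambda>k. nrmL2 \<Omega> (\<lambda>x. partial (\<phi> k) i x - g x $ i)) \<longlonglongrightarrow> 0"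
    and lim1: "(\<lambda>k. nrmL2 \<Omega> (\<lambda>x. \<phi> k x - p x)) \<longlonglongrightarrow> 0"
    unfolding H01_def by (elim conjE exE)
  note g = all(1)[rule_format] and \<phi> = all(2)[rule_format] and lim2 = all(3)[rule_format]
  have t: "L2 \<Omega> (\<phi> k)" "L2 \<Omega> (partial (\<phi> k) i)" for k i
    using \<phi> \<Omega> by (simp_all add: test_fn_L2 test_fn_partial)
  have "(\<lambda>k. emb \<Omega> (\<phi> k)) \<longlonglongrightarrow> emb \<Omega> p"
    using lim1 unfolding nrmL2_emb_diff[OF \<Omega> t(1) p] by (rule tendsto_dist_iff[THEN iffD2])
  moreover have "(\<lambda>k. emb \<Omega> (partial (\<phi> k) i)) \<longlonglongrightarrow> emb \<Omega> (\<lambda>x. g x $ i)" for i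
    using lim2[of i] unfolding nrmL2_emb_diff[OF \<Omega> t(2) g] by (rule tendsto_dist_iff[THEN iffD2])
  ultimately have "(\<lambda>k. (emb \<Omega> (\<phi> k), \<chi> i. emb \<Omega> (partial (\<phi> k) i))) \<longlonglongrightarrow> (emb \<Omega> p, \<chi> i. emb \<Omega> (\<lambda>x. g x $ i))"
    by (intro tendsto_Pair vec_tendstoI) simp_all
  then have "(emb \<Omega> p, \<chi> i. emb \<Omega> (\<lambda>x. g x $ i)) \<in> jets \<Omega>"
    unfolding jets_def closure_sequential
    by (intro exI[of _ "\<lambda>k. test_jet \<Omega> (\<phi> k)"] conjI) (simp_all add: \<phi> test_jet_def mk_jet_def)
  then show "L2 \<Omega> p \<and> (\<exists>G. (emb \<Omega> p, G) \<in> jets \<Omega>)" using p by blast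
next
  assume "L2 \<Omega> p \<and> (\<exists>G. (emb \<Omega> p, G) \<in> jets \<Omega>)"
  then obtain G where p: "L2 \<Omega> p" and G: "(emb \<Omega> p, G) \<in> jets \<Omega>" by blast
  define g where "g = (\<lambda>x. \<chi> i. rep_l2 (G $ i) x)"
  have gi: "(\<lambda>x. g x $ i) = rep_l2 (G $ i)" for i by (simp add: g_def)
  have g: "L2 \<Omega> (\<lambda>x. g x $ i)" "emb \<Omega> (\<lambda>x. g x $ i) = G $ i" for i
    unfolding gi using emb_rep_jets[OF \<Omega> G] by simp_all
  have wg: "weak_grad \<Omega> p g"
    unfolding weak_grad_emb[OF \<Omega> p g(1)] g(2) using jets_weak_grad[OF \<Omega> G] by simp
  obtain x where x: "\<forall>n. x n \<in> test_jet \<Omega> ` Collect (test_fn \<Omega>)" "x \<longlonglongrightarrow> (emb \<Omega> p, G)"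
    using G unfolding jets_def closure_sequential by (elim exE conjE)
  then have "\<forall>n. \<exists>\<phi>. test_fn \<Omega> \<phi> \<and> x n = test_jet \<Omega> \<phi>" by auto
  then obtain \<phi> where \<phi>: "\<And>n. test_fn \<Omega> (\<phi> n)" "\<And>n. x n = test_jet \<Omega> (\<phi> n)" by metis
  have t: "L2 \<Omega> (\<phi> k)" "L2 \<Omega> (partial (\<phi> k) i)" for k i
    using \<phi> \<Omega> by (simp_all add: test_fn_L2 test_fn_partial)
  have "(\<lambda>k. emb \<Omega> (\<phi> k)) \<longlonglongrightarrow> emb \<Omega> p"
    using tendsto_fst[OF x(2)] by (simp add: \<phi>(2) test_jet_components)
  then have l1: "(\<lambda>k. nrmL2 \<Omega> (\<lambda>x. \<phi> k x - p x)) \<longlonglongrightarrow> 0"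
    unfolding nrmL2_emb_diff[OF \<Omega> t(1) p] by (rule tendsto_dist_iff[THEN iffD1])
  have "(\<lambda>k. emb \<Omega> (partial (\<phi> k) i)) \<longlonglongrightarrow> emb \<Omega> (\<lambda>x. g x $ i)" for i
    using tendsto_vec_nth[OF tendsto_snd[OF x(2)], of i] by (simp add: \<phi>(2) test_jet_components g(2))
  then have l2: "(\<lambda>k. nrmL2 \<Omega> (\<lambda>x. partial (\<phi> k) i x - g x $ i)) \<longlonglongrightarrow> 0" for i
    unfolding nrmL2_emb_diff[OF \<Omega> t(2) g(1)] by (rule tendsto_dist_iff[THEN iffD1])
  show "H01 \<Omega> p"
    unfolding H01_def using p wg g(1) \<phi>(1) l1 l2
    by (intro conjI exI[of _ g] exI[of _ \<phi>] allI) assumption+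
qed

definition jet :: "(real^'n::finite) set \<Rightarrow> 'n fn \<Rightarrow> 'n jet" where
  "jet \<Omega> p = mk_jet \<Omega> p (grad \<Omega> p)"

lemma fst_jet: "fst (jet \<Omega> p) = emb \<Omega> p"
  by (simp add: jet_def mk_jet_def)

lemma snd_jet: "snd (jet \<Omega> p) $ i = emb \<Omega> (\<lambda>x. grad \<Omega> p x $ i)"
  by (simp add: jet_def mk_jet_def)

lemma H01_I:
  assumes "open \<Omega>" "L2 \<Omega> p" "w \<in> jets \<Omega>" "emb \<Omega> p = fst w"
  shows "H01 \<Omega> p"
proof -
  have "(emb \<Omega> p, snd w) \<in> jets \<Omega>" using assms(3,4) by simp
  then show ?thesis unfolding H01_iff_jet[OF assms(1)] using assms(2) by (intro conjI exI)
qed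

lemma H01_L2: "H01 \<Omega> p \<Longrightarrow> L2 \<Omega> p"
  by (simp add: H01_def)

text \<open>\<open>grad\<close> selects some square integrable weak gradient, while
  \<open>jets\<close> speaks about the limit of the approximating gradients. Both satisfy the same
  integration by parts identity, so they agree as classes.\<close>

lemma H01_jet:
  assumes \<Omega>: "open \<Omega>" "bounded \<Omega>" and p: "H01 \<Omega> p"
  shows "jet \<Omega> p \<in> jets \<Omega>" "L2 \<Omega> (\<lambda>x. grad \<Omega> p x $ i)"
proof -
  have pL: "L2 \<Omega> p" using p by (rule H01_L2)
  from p obtain g where "weak_grad \<Omega> p g" "\<forall>i. L2 \<Omega> (\<lambda>x. g x $ i)"
    unfolding H01_def by (elim conjE exE)
  then have "\<exists>g. weak_grad \<Omega> p g \<and> (\<forall>i. L2 \<Omega> (\<lambda>x. g x $ i))" by (intro exI conjI)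
  from someI_ex[OF this] have gr: "weak_grad \<Omega> p (grad \<Omega> p)" "\<And>i. L2 \<Omega> (\<lambda>x. grad \<Omega> p x $ i)"
    unfolding grad_def by simp_all
  show "L2 \<Omega> (\<lambda>x. grad \<Omega> p x $ i)" by (rule gr(2))
  obtain G where G: "(emb \<Omega> p, G) \<in> jets \<Omega>" using p H01_iff_jet[OF \<Omega>(1)] by blast
  have "emb \<Omega> (\<lambda>x. grad \<Omega> p x $ i) = G $ i" for i
  proof -
    let ?r = "rep_l2 (G $ i)"
    have r: "L2 \<Omega> ?r" "emb \<Omega> ?r = G $ i" using emb_rep_jets[OF \<Omega>(1) G] by simp_all
    have "emb \<Omega> (\<lambda>x. grad \<Omega> p x $ i - ?r x) = 0"
    proof (rule orthogonal_test_fns_zero[OF \<Omega> L2_diff(1)[OF \<Omega>(1) gr(2) r(1)]])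
      fix \<phi> assume \<phi>: "test_fn \<Omega> \<phi>"
      have "emb \<Omega> p \<bullet> emb \<Omega> (partial \<phi> i) = - (emb \<Omega> (\<lambda>x. grad \<Omega> p x $ i) \<bullet> emb \<Omega> \<phi>)"
        using gr(1) \<phi> unfolding weak_grad_emb[OF \<Omega>(1) pL gr(2)] by simp
      then show "emb \<Omega> (\<lambda>x. grad \<Omega> p x $ i - ?r x) \<bullet> emb \<Omega> \<phi> = 0"
        using jets_weak_grad[OF \<Omega>(1) G \<phi>, of i] r(2)
        by (simp add: L2_diff(2)[OF \<Omega>(1) gr(2) r(1)] inner_diff_left)
    qed
    then show ?thesis by (simp add: L2_diff(2)[OF \<Omega>(1) gr(2) r(1)] r(2))
  qed
  then have "jet \<Omega> p = (emb \<Omega> p, G)" by (simp add: prod_eq_iff vec_eq_iff fst_jet snd_jet)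
  then show "jet \<Omega> p \<in> jets \<Omega>" using G by simp
qed

lemma jets_obtain:
  assumes \<Omega>: "open \<Omega>" "bounded \<Omega>" and w: "w \<in> jets \<Omega>"
  obtains p where "H01 \<Omega> p" "jet \<Omega> p = w"
proof -
  let ?p = "rep_l2 (fst w)"
  have e: "emb \<Omega> ?p = fst w" "L2 \<Omega> ?p" using emb_rep_jets[OF \<Omega>(1) w] by simp_all
  have h: "H01 \<Omega> ?p" by (rule H01_I[OF \<Omega>(1) e(2) w e(1)])
  have "jet \<Omega> ?p = w" by (rule jets_fst_inj[OF \<Omega> H01_jet(1)[OF \<Omega> h] w]) (simp add: fst_jet e)
  from that[OF h this] show ?thesis .
qed

lemma jet_eqI:
  assumes \<Omega>: "open \<Omega>" "bounded \<Omega>" and "H01 \<Omega> p" "w \<in> jets \<Omega>" "emb \<Omega> p = fst w"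
  shows "jet \<Omega> p = w"
  using assms by (intro jets_fst_inj[OF \<Omega> H01_jet(1)[OF \<Omega>]]) (simp_all add: fst_jet)

lemma H01_lincomb:
  assumes \<Omega>: "open \<Omega>" "bounded \<Omega>" and pq: "H01 \<Omega> p" "H01 \<Omega> q"
  shows "H01 \<Omega> (\<lambda>x. a * p x + b * q x)"
    "jet \<Omega> (\<lambda>x. a * p x + b * q x) = a *\<^sub>R jet \<Omega> p + b *\<^sub>R jet \<Omega> q"
proof -
  let ?w = "a *\<^sub>R jet \<Omega> p + b *\<^sub>R jet \<Omega> q"
  have w: "?w \<in> jets \<Omega>"
    using H01_jet(1)[OF \<Omega>] pq subspace_jets[OF \<Omega>(1)] by (intro subspace_add subspace_mul) auto
  note L = L2_lincomb[OF \<Omega>(1) H01_L2[OF pq(1)] H01_L2[OF pq(2)], of a b]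
  have e: "emb \<Omega> (\<lambda>x. a * p x + b * q x) = fst ?w" by (simp add: L(2) fst_jet)
  show h: "H01 \<Omega> (\<lambda>x. a * p x + b * q x)" by (rule H01_I[OF \<Omega>(1) L(1) w e])
  show "jet \<Omega> (\<lambda>x. a * p x + b * q x) = ?w" by (rule jet_eqI[OF \<Omega> h w e])
qed

lemma test_fn_H01:
  assumes "open \<Omega>" "test_fn \<Omega> \<phi>" shows "H01 \<Omega> \<phi>"
proof -
  have "test_jet \<Omega> \<phi> \<in> jets \<Omega>" unfolding jets_def by (rule subsetD[OF closure_subset]) (simp add: assms(2))
  from H01_I[OF assms(1) test_fn_L2(1)[OF assms] this] show ?thesis by (simp add: test_jet_components)
qed

lemma jets_poincare:
  assumes \<Omega>: "open \<Omega>" "\<Omega> \<subseteq> cball 0 R" and w: "w \<in> jets \<Omega>"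
  shows "(norm (fst w))\<^sup>2 \<le> 4 * R\<^sup>2 * (norm (snd w $ i))\<^sup>2"
  using w
proof (rule jets_induct[where P = "\<lambda>w. (norm (fst w))\<^sup>2 \<le> 4 * R\<^sup>2 * (norm (snd w $ i))\<^sup>2"])
  show "closed (Collect (\<lambda>w. (norm (fst w))\<^sup>2 \<le> 4 * R\<^sup>2 * (norm (snd w $ i))\<^sup>2))"
    by (intro closed_Collect_le continuous_intros)
  fix \<phi> assume \<phi>: "test_fn \<Omega> \<phi>"
  then show "(norm (fst (test_jet \<Omega> \<phi>)))\<^sup>2 \<le> 4 * R\<^sup>2 * (norm (snd (test_jet \<Omega> \<phi>) $ i))\<^sup>2"
    using test_fn_poincare[OF \<phi> \<Omega>(2), of i]
    unfolding test_jet_components test_fn_L2(2)[OF \<Omega>(1) \<phi>] test_fn_L2(2)[OF \<Omega>(1) test_fn_partial[OF \<phi>]]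
    by (simp add: norm_abs_l2 test_fn_sqint[OF \<phi>] test_fn_sqint[OF test_fn_partial[OF \<phi>]])
qed

section \<open>The elliptic operator and its resolvent\<close>

lemma bounded_bilinear_add:
  assumes "bounded_bilinear f" "bounded_bilinear g"
  shows "bounded_bilinear (\<lambda>x y. f x y + g x y)"
proof -
  interpret f: bounded_bilinear f by fact
  interpret g: bounded_bilinear g by fact
  show ?thesis
  proof
    obtain K L where K: "\<forall>a b. norm (f a b) \<le> norm a * norm b * K" and L: "\<forall>a b. norm (g a b) \<le> norm a * norm b * L"
      using f.bounded g.bounded by (elim exE)
    show "\<exists>K. \<forall>a b. norm (f a b + g a b) \<le> norm a * norm b * K"
    proof (intro exI allI)
      fix a b
      show "norm (f a b + g a b) \<le> norm a * norm b * (K + L)"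
        using norm_triangle_ineq[of "f a b" "g a b"] K[rule_format, of a b] L[rule_format, of a b] by (simp add: distrib_left)
    qed
  qed (simp_all add: f.add_left f.add_right g.add_left g.add_right f.scaleR_left f.scaleR_right
      g.scaleR_left g.scaleR_right scaleR_add_right)
qed

lemma bounded_bilinear_sum:
  assumes "finite I" "\<And>i. i \<in> I \<Longrightarrow> bounded_bilinear (f i)"
  shows "bounded_bilinear (\<lambda>x y. \<Sum>i\<in>I. f i x y)"
  using assms
proof (induction I rule: finite_induct)
  case empty
  show ?case by (rule bounded_bilinear.intro) (simp_all, rule exI[of _ 0], simp)
next
  case (insert i I)
  have "bounded_bilinear (f i)" "bounded_bilinear (\<lambda>x y. \<Sum>i\<in>I. f i x y)"
    using insert by simp_all
  from bounded_bilinear_add[OF this] show ?case using insert by simp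
qed

lemma norm_sq_prod: "(norm w)\<^sup>2 = (norm (fst w))\<^sup>2 + (norm (snd w))\<^sup>2"
  by (simp add: norm_prod_def)

lemma norm_sq_vec: "(norm (v :: 'a::real_inner^'n::finite))\<^sup>2 = (\<Sum>i\<in>UNIV. (norm (v $ i))\<^sup>2)"
  by (simp add: power2_norm_eq_inner inner_vec_def)

locale elliptic_problem =
  fixes \<Omega> :: "(real^'n::finite) set"
    and aa :: "real^'n \<Rightarrow> real^'n^'n" and c0 :: "'n fn" and \<theta> :: real
  assumes dom: "open \<Omega>" "bounded \<Omega>"
    and coef_meas: "\<forall>i j. (\<lambda>x. aa x $ i $ j) \<in> borel_measurable (lebesgue_on \<Omega>)"
    and coef_bdd: "\<exists>M. \<forall>i j. AE x in lebesgue_on \<Omega>. \<bar>aa x $ i $ j\<bar> \<le> M"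
    and coef_sym: "\<forall>i j. AE x in lebesgue_on \<Omega>. aa x $ i $ j = aa x $ j $ i"
    and c0_meas: "c0 \<in> borel_measurable (lebesgue_on \<Omega>)"
    and c0_bdd: "\<exists>M. AE x in lebesgue_on \<Omega>. \<bar>c0 x\<bar> \<le> M"
    and c0_nonneg: "AE x in lebesgue_on \<Omega>. c0 x \<ge> 0"
    and elliptic: "\<theta> > 0"
      "AE x in lebesgue_on \<Omega>. \<forall>\<xi>::real^'n.
          (\<Sum>i\<in>UNIV. \<Sum>j\<in>UNIV. aa x $ i $ j * \<xi> $ i * \<xi> $ j) \<ge> \<theta> * (norm \<xi>)\<^sup>2"
begin

section \<open>The bilinear form on jets\<close>

definition coef :: "'n \<Rightarrow> 'n \<Rightarrow> 'n fn" where
  "coef i j = (\<lambda>x. indicator \<Omega> x * aa x $ j $ i)"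

definition coef0 :: "'n fn" where
  "coef0 = (\<lambda>x. indicator \<Omega> x * c0 x)"

text \<open>\<open>aform\<close> on the level of classes: its continuity becomes a property of
  operators on a Hilbert space, and no chosen gradient is left in it. The transposed indices in
  \<open>coef\<close> copy those of \<open>aform\<close>; coefficients are extended by zero because
  \<open>mulop\<close> acts on functions on the whole space.\<close>

definition jform :: "'n jet \<Rightarrow> 'n jet \<Rightarrow> real" where
  "jform y v = (\<Sum>i\<in>UNIV. \<Sum>j\<in>UNIV. mulop (coef i j) (snd y $ i) \<bullet> snd v $ j) + mulop coef0 (fst y) \<bullet> fst v"

lemma coef_bddE:
  obtains M where "\<forall>i j. AE x in lebesgue_on \<Omega>. \<bar>aa x $ i $ j\<bar> \<le> M"
  using coef_bdd by (elim exE)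

lemma coef_bdd_coef: "bdd_coef (coef i j)" "bdd_coef coef0"
proof -
  obtain M where "\<forall>i j. AE x in lebesgue_on \<Omega>. \<bar>aa x $ i $ j\<bar> \<le> M" by (rule coef_bddE)
  then show "bdd_coef (coef i j)"
    unfolding coef_def by (intro bdd_coef_indicator[OF dom(1) coef_meas[rule_format], where M = M]) simp
  obtain M where "AE x in lebesgue_on \<Omega>. \<bar>c0 x\<bar> \<le> M" using c0_bdd by (elim exE)
  then show "bdd_coef coef0"
    unfolding coef0_def by (rule bdd_coef_indicator[OF dom(1) c0_meas])
qed

lemma bounded_bilinear_jform: "bounded_bilinear jform"
proof -
  have "bounded_bilinear (\<lambda>y v :: 'n jet. mulop (coef i j) (snd y $ i) \<bullet> snd v $ j)" for i j
    by (intro bounded_bilinear.comp[OF bounded_bilinear_inner] bounded_linear_compose[OF bounded_linear_mulop]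
        bounded_linear_compose[OF bounded_linear_vec_nth] bounded_linear_snd coef_bdd_coef)
  moreover have "bounded_bilinear (\<lambda>y v :: 'n jet. mulop coef0 (fst y) \<bullet> fst v)"
    by (intro bounded_bilinear.comp[OF bounded_bilinear_inner] bounded_linear_compose[OF bounded_linear_mulop]
        bounded_linear_fst coef_bdd_coef)
  ultimately show ?thesis
    unfolding jform_def[abs_def] by (intro bounded_bilinear_add bounded_bilinear_sum) auto
qed

lemma jform_sym: "jform y v = jform v y"
proof -
  have s: "mulop (coef i j) h = mulop (coef j i) h" for i j h
  proof (rule mulop_cong_AE)
    have "AE x in lebesgue. x \<in> \<Omega> \<longrightarrow> aa x $ j $ i = aa x $ i $ j"
      using coef_sym unfolding AE_restrict_space_iff[OF open_lebesgue[OF dom(1)]] by simp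
    then show "AE x in lebesgue. coef i j x = coef j i x"
      by (rule eventually_mono) (simp add: coef_def indicator_def)
  qed (rule coef_bdd_coef)+
  have "(\<Sum>i\<in>UNIV. \<Sum>j\<in>UNIV. mulop (coef i j) (snd y $ i) \<bullet> snd v $ j)
      = (\<Sum>i\<in>UNIV. \<Sum>j\<in>UNIV. mulop (coef j i) (snd v $ j) \<bullet> snd y $ i)"
    by (intro sum.cong refl) (metis s mulop_sym coef_bdd_coef(1) inner_commute)
  also have "\<dots> = (\<Sum>i\<in>UNIV. \<Sum>j\<in>UNIV. mulop (coef i j) (snd v $ i) \<bullet> snd y $ j)" by (rule sum.swap)
  finally show ?thesis unfolding jform_def using mulop_sym[OF coef_bdd_coef(2), of "fst y" "fst v"]
    by (simp add: inner_commute)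
qed

lemma aform_integrands:
  assumes y: "H01 \<Omega> y" and v: "H01 \<Omega> v"
  shows "integrable (lebesgue_on \<Omega>) (\<lambda>x. aa x $ j $ i * grad \<Omega> y x $ i * grad \<Omega> v x $ j)"
    "(\<integral>x. aa x $ j $ i * grad \<Omega> y x $ i * grad \<Omega> v x $ j \<partial>lebesgue_on \<Omega>)
       = mulop (coef i j) (snd (jet \<Omega> y) $ i) \<bullet> snd (jet \<Omega> v) $ j"
    "integrable (lebesgue_on \<Omega>) (\<lambda>x. c0 x * y x * v x)"
    "(\<integral>x. c0 x * y x * v x \<partial>lebesgue_on \<Omega>) = mulop coef0 (fst (jet \<Omega> y)) \<bullet> fst (jet \<Omega> v)"
proof -
  note gy = H01_jet(2)[OF dom y] and gv = H01_jet(2)[OF dom v]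
  obtain M where M: "\<forall>i j. AE x in lebesgue_on \<Omega>. \<bar>aa x $ i $ j\<bar> \<le> M" by (rule coef_bddE)
  note m = mulop_emb[OF dom(1) coef_meas[rule_format] M[rule_format] gy]
  show "integrable (lebesgue_on \<Omega>) (\<lambda>x. aa x $ j $ i * grad \<Omega> y x $ i * grad \<Omega> v x $ j)"
    by (rule L2_mult_integrable[OF dom(1) m(1) gv])
  show "(\<integral>x. aa x $ j $ i * grad \<Omega> y x $ i * grad \<Omega> v x $ j \<partial>lebesgue_on \<Omega>)
       = mulop (coef i j) (snd (jet \<Omega> y) $ i) \<bullet> snd (jet \<Omega> v) $ j"
    unfolding snd_jet coef_def m(2) inner_emb[OF dom(1) m(1) gv] ipL2_def ..
  obtain M where M: "AE x in lebesgue_on \<Omega>. \<bar>c0 x\<bar> \<le> M" using c0_bdd by (elim exE)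
  note m = mulop_emb[OF dom(1) c0_meas M H01_L2[OF y]]
  show "integrable (lebesgue_on \<Omega>) (\<lambda>x. c0 x * y x * v x)"
    by (rule L2_mult_integrable[OF dom(1) m(1) H01_L2[OF v]])
  show "(\<integral>x. c0 x * y x * v x \<partial>lebesgue_on \<Omega>) = mulop coef0 (fst (jet \<Omega> y)) \<bullet> fst (jet \<Omega> v)"
    unfolding fst_jet coef0_def m(2) inner_emb[OF dom(1) m(1) H01_L2[OF v]] ipL2_def ..
qed

lemma aform_jform:
  assumes "H01 \<Omega> y" "H01 \<Omega> v"
  shows "aform \<Omega> aa c0 y v = jform (jet \<Omega> y) (jet \<Omega> v)"
  unfolding aform_def jform_def
  using aform_integrands[OF assms] by (simp add: Bochner_Integration.integral_sum)

text \<open>Ellipticity is a pointwise inequality, so the jet is first represented by a function of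
  H_0^1 and the integrands are compared almost everywhere; the zero order term helps because
  \<open>c0\<close> is nonnegative.\<close>

lemma jform_elliptic:
  assumes "w \<in> jets \<Omega>" shows "\<theta> * (norm (snd w))\<^sup>2 \<le> jform w w"
proof -
  obtain p where p: "H01 \<Omega> p" "jet \<Omega> p = w" by (rule jets_obtain[OF dom assms])
  note g = H01_jet(2)[OF dom p(1)]
  have gi: "integrable (lebesgue_on \<Omega>) (\<lambda>x. (grad \<Omega> p x $ i)\<^sup>2)" for i
    using g[of i] by (simp add: L2_def)
  have n: "(norm (snd w $ i))\<^sup>2 = (\<integral>x. (grad \<Omega> p x $ i)\<^sup>2 \<partial>lebesgue_on \<Omega>)" for i
    unfolding p(2)[symmetric] snd_jet power2_norm_eq_inner inner_emb[OF dom(1) g g] ipL2_def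
    by (simp add: power2_eq_square)
  have "\<theta> * (norm (snd w))\<^sup>2 = (\<integral>x. \<theta> * (norm (grad \<Omega> p x))\<^sup>2 \<partial>lebesgue_on \<Omega>)"
    unfolding norm_sq_vec n using gi by (simp add: Bochner_Integration.integral_sum)
  also have "\<dots> \<le> aform \<Omega> aa c0 p p"
    unfolding aform_def
  proof (rule integral_mono_AE)
    show "integrable (lebesgue_on \<Omega>) (\<lambda>x. \<theta> * (norm (grad \<Omega> p x))\<^sup>2)"
      unfolding norm_sq_vec using gi by simp
    show "integrable (lebesgue_on \<Omega>) (\<lambda>x. (\<Sum>i\<in>UNIV. \<Sum>j\<in>UNIV. aa x $ j $ i * grad \<Omega> p x $ i * grad \<Omega> p x $ j) + c0 x * p x * p x)"
      using aform_integrands[OF p(1) p(1)] by simp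
    show "AE x in lebesgue_on \<Omega>. \<theta> * (norm (grad \<Omega> p x))\<^sup>2
      \<le> (\<Sum>i\<in>UNIV. \<Sum>j\<in>UNIV. aa x $ j $ i * grad \<Omega> p x $ i * grad \<Omega> p x $ j) + c0 x * p x * p x"
      using elliptic(2) c0_nonneg
    proof eventually_elim
      case (elim x)
      have "\<theta> * (norm (grad \<Omega> p x))\<^sup>2 \<le> (\<Sum>j\<in>UNIV. \<Sum>i\<in>UNIV. aa x $ j $ i * grad \<Omega> p x $ j * grad \<Omega> p x $ i)"
        using elim(1) by simp
      also have "\<dots> = (\<Sum>i\<in>UNIV. \<Sum>j\<in>UNIV. aa x $ j $ i * grad \<Omega> p x $ i * grad \<Omega> p x $ j)"
        by (subst sum.swap) (simp add: mult_ac)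
      moreover have "0 \<le> c0 x * p x * p x" using elim(2) by (simp add: mult.assoc)
      ultimately show ?case by linarith
    qed
  qed
  also have "\<dots> = jform w w" using aform_jform[OF p(1) p(1)] p(2) by simp
  finally show ?thesis .
qed

lemma jform_coercive:
  "\<exists>c>0. \<forall>w\<in>jets \<Omega>. c * (norm w)\<^sup>2 \<le> jform w w"
proof -
  obtain R where "\<forall>x\<in>\<Omega>. norm x \<le> R" using dom(2) unfolding bounded_iff by (elim exE)
  then have R: "\<Omega> \<subseteq> cball 0 R" by auto
  \<comment> \<open>In the denominator \<open>4 * R\<^sup>2\<close> is the Poincare constant and 1
    accounts for the gradient part of the norm.\<close>
  define c where "c = \<theta> / (4 * R\<^sup>2 + 1)"
  have d: "4 * R\<^sup>2 + 1 > 0" by (simp add: add_nonneg_pos)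
  have "c * (norm w)\<^sup>2 \<le> jform w w" if w: "w \<in> jets \<Omega>" for w
  proof -
    \<comment> \<open>Any coordinate direction serves, as the Poincare inequality holds for each
      partial derivative separately.\<close>
    obtain i :: 'n where True by simp
    have "(norm (snd w $ i))\<^sup>2 \<le> (norm (snd w))\<^sup>2"
      using Finite_Cartesian_Product.norm_nth_le[of "snd w" i] by (intro power_mono) auto
    then have "4 * R\<^sup>2 * (norm (snd w $ i))\<^sup>2 \<le> 4 * R\<^sup>2 * (norm (snd w))\<^sup>2" by (intro mult_left_mono) auto
    then have "(norm (fst w))\<^sup>2 \<le> 4 * R\<^sup>2 * (norm (snd w))\<^sup>2"
      using jets_poincare[OF dom(1) R w, of i] by linarith
    then have "(norm w)\<^sup>2 \<le> (4 * R\<^sup>2 + 1) * (norm (snd w))\<^sup>2"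
      unfolding norm_sq_prod by (simp add: distrib_right)
    then have "c * (norm w)\<^sup>2 \<le> c * ((4 * R\<^sup>2 + 1) * (norm (snd w))\<^sup>2)"
      using d elliptic(1) by (intro mult_left_mono) (simp_all add: c_def)
    also have "\<dots> = \<theta> * (norm (snd w))\<^sup>2" using d by (simp add: c_def)
    also have "\<dots> \<le> jform w w" by (rule jform_elliptic[OF w])
    finally show ?thesis .
  qed
  moreover have "c > 0" using d elliptic(1) by (simp add: c_def)
  ultimately show ?thesis by (intro exI[of _ c] conjI ballI)
qed

text \<open>The coupled system is a coercive problem on the product of two copies of the space: testing
  with the solution itself, the two skew coupling terms cancel.\<close>
lemma coupled_system_solvable:
  assumes \<alpha>: "\<alpha> > 0"
  shows "\<exists>q r. H01 \<Omega> q \<and> H01 \<Omega> r \<and>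
    (\<forall>v. H01 \<Omega> v \<longrightarrow> aform \<Omega> aa c0 q v = emb \<Omega> r \<bullet> emb \<Omega> v) \<and>
    (\<forall>v. H01 \<Omega> v \<longrightarrow> \<alpha> * aform \<Omega> aa c0 r v + emb \<Omega> q \<bullet> emb \<Omega> v = h \<bullet> emb \<Omega> v)"
proof -
  obtain c where c: "c > 0" "\<forall>w\<in>jets \<Omega>. c * (norm w)\<^sup>2 \<le> jform w w"
    using jform_coercive by (elim exE conjE)
  \<comment> \<open>Each test slot carries one equation, and the coupling terms have opposite signs.
    The minus sign and \<open>\<alpha>\<close> sit inside the arguments, so that every summand is a
    known bilinear map composed with linear ones.\<close>
  define B where "B = (\<lambda>q v :: 'n jet \<times> 'n jet. (jform (fst q) (fst v) + jform (\<alpha> *\<^sub>R snd q) (snd v))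
    + (fst (- snd q) \<bullet> fst (fst v) + fst (fst q) \<bullet> fst (snd v)))"
  let ?S = "jets \<Omega> \<times> jets \<Omega>"
  note bl = bounded_linear_fst bounded_linear_snd bounded_linear_compose[OF bounded_linear_fst]
  have bm: "bounded_linear (\<lambda>q :: 'n jet \<times> 'n jet. \<alpha> *\<^sub>R snd q)" "bounded_linear (\<lambda>q :: 'n jet \<times> 'n jet. - snd q)"
    by (intro bounded_linear_compose[OF bounded_linear_scaleR_right] bounded_linear_minus bounded_linear_snd)+
  have B: "bounded_bilinear B"
    unfolding B_def
    by (intro bounded_bilinear_add bounded_bilinear.comp[OF bounded_bilinear_jform]
        bounded_bilinear.comp[OF bounded_bilinear_inner] bl bm)
  have l: "bounded_linear (\<lambda>v :: 'n jet \<times> 'n jet. h \<bullet> fst (snd v))"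
    by (intro bounded_linear_compose[OF bounded_bilinear.bounded_linear_right[OF bounded_bilinear_inner]] bl)
  have S: "subspace ?S" "closed ?S"
    using subspace_jets[OF dom(1)] closed_jets[of \<Omega>] by (auto intro: subspace_Times closed_Times)
  have coer: "c * min 1 \<alpha> * (norm w)\<^sup>2 \<le> B w w" if w: "w \<in> ?S" for w
  proof -
    have w': "fst w \<in> jets \<Omega>" "snd w \<in> jets \<Omega>" using w by (simp_all add: mem_Times_iff)
    have "c * min 1 \<alpha> * (norm w)\<^sup>2 = min 1 \<alpha> * (c * (norm (fst w))\<^sup>2) + min 1 \<alpha> * (c * (norm (snd w))\<^sup>2)"
      unfolding norm_sq_prod[of w] by (simp add: algebra_simps)
    also have "\<dots> \<le> 1 * (c * (norm (fst w))\<^sup>2) + \<alpha> * (c * (norm (snd w))\<^sup>2)"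
      using c(1) by (intro add_mono mult_right_mono) auto
    also have "\<dots> \<le> 1 * jform (fst w) (fst w) + \<alpha> * jform (snd w) (snd w)"
      using \<alpha> by (intro add_mono mult_left_mono c(2)[rule_format] w') auto
    also have "\<dots> = B w w"
      unfolding B_def
      by (simp add: bounded_bilinear.scaleR_left[OF bounded_bilinear_jform] inner_commute)
    finally show ?thesis .
  qed
  have "c * min 1 \<alpha> > 0" using c(1) \<alpha> by simp
  then have "\<exists>u\<in>?S. \<forall>v\<in>?S. B u v = h \<bullet> fst (snd v)"
    by (rule lax_milgram[OF S l B]) (rule coer)
  then obtain u where u: "u \<in> ?S" "\<forall>v\<in>?S. B u v = h \<bullet> fst (snd v)" by (elim bexE)
  have u': "fst u \<in> jets \<Omega>" "snd u \<in> jets \<Omega>" using u(1) by (simp_all add: mem_Times_iff)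
  obtain q where q: "H01 \<Omega> q" "jet \<Omega> q = fst u" by (rule jets_obtain[OF dom u'(1)])
  obtain r where r: "H01 \<Omega> r" "jet \<Omega> r = snd u" by (rule jets_obtain[OF dom u'(2)])
  have z: "(0 :: 'n jet) \<in> jets \<Omega>" by (rule subspace_0[OF subspace_jets[OF dom(1)]])
  note jz = bounded_bilinear.zero_right[OF bounded_bilinear_jform]
  show ?thesis
  proof (rule exI[of _ q], rule exI[of _ r], intro conjI q(1) r(1) allI impI)
    fix v assume v: "H01 \<Omega> v"
    \<comment> \<open>The test pairs \<open>(jet \<Omega> v, 0)\<close> and
      \<open>(0, jet \<Omega> v)\<close> separate the two equations.\<close>
    have jv: "jet \<Omega> v \<in> jets \<Omega>" by (rule H01_jet(1)[OF dom v])
    show "aform \<Omega> aa c0 q v = emb \<Omega> r \<bullet> emb \<Omega> v"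
      using u(2)[rule_format, of "(jet \<Omega> v, 0)"] jv z unfolding aform_jform[OF q(1) v]
      by (simp add: B_def q(2)[symmetric] r(2)[symmetric] jz fst_jet)
    show "\<alpha> * aform \<Omega> aa c0 r v + emb \<Omega> q \<bullet> emb \<Omega> v = h \<bullet> emb \<Omega> v"
      using u(2)[rule_format, of "(0, jet \<Omega> v)"] jv z unfolding aform_jform[OF r(1) v]
      by (simp add: B_def q(2)[symmetric] r(2)[symmetric] jz fst_jet
          bounded_bilinear.scaleR_left[OF bounded_bilinear_jform])
  qed
qed

text \<open>The graph of \<open>A\<close> as an operator in L^2. Its domain consists of those
  elements of H_0^1 at which the \<open>p\<close>-part of the objective is finite.\<close>

definition graph :: "((real^'n) l2 \<times> (real^'n) l2) set" where
  "graph = {(emb \<Omega> p, emb \<Omega> f) | p f. H01 \<Omega> p \<and> AstarL2 \<Omega> aa c0 p f}"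

lemma AstarL2_lincomb:
  assumes "H01 \<Omega> p" "AstarL2 \<Omega> aa c0 p f" "H01 \<Omega> q" "AstarL2 \<Omega> aa c0 q g"
  shows "AstarL2 \<Omega> aa c0 (\<lambda>x. a * p x + b * q x) (\<lambda>x. a * f x + b * g x)"
proof -
  interpret jform: bounded_bilinear jform by (rule bounded_bilinear_jform)
  have L: "L2 \<Omega> f" "L2 \<Omega> g" using assms by (simp_all add: AstarL2_def)
  note lc = L2_lincomb[OF dom(1) L, of a b] and hc = H01_lincomb[OF dom assms(1,3), of a b]
  show ?thesis
    unfolding AstarL2_def
  proof (intro conjI allI impI lc(1))
    fix v assume v: "H01 \<Omega> v"
    have e: "aform \<Omega> aa c0 v p = emb \<Omega> f \<bullet> emb \<Omega> v" "aform \<Omega> aa c0 v q = emb \<Omega> g \<bullet> emb \<Omega> v"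
      using assms(2,4) v by (simp_all add: AstarL2_def inner_emb[OF dom(1) _ H01_L2[OF v]])
    show "aform \<Omega> aa c0 v (\<lambda>x. a * p x + b * q x) = ipL2 \<Omega> (\<lambda>x. a * f x + b * g x) v"
      using e unfolding aform_jform[OF v hc(1)] hc(2) aform_jform[OF v assms(1)] aform_jform[OF v assms(3)]
        inner_emb[OF dom(1) lc(1) H01_L2[OF v], symmetric] lc(2)
      by (simp add: jform.add_right jform.scaleR_right inner_add_left)
  qed
qed

lemma AstarL2_unique:
  assumes "AstarL2 \<Omega> aa c0 p f" "AstarL2 \<Omega> aa c0 p g"
  shows "emb \<Omega> f = emb \<Omega> g"
proof -
  have L: "L2 \<Omega> f" "L2 \<Omega> g" using assms by (simp_all add: AstarL2_def)
  have "emb \<Omega> (\<lambda>x. f x - g x) = 0"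
  proof (rule orthogonal_test_fns_zero[OF dom L2_diff(1)[OF dom(1) L]])
    fix \<phi> assume "test_fn \<Omega> \<phi>"
    then have h: "H01 \<Omega> \<phi>" by (rule test_fn_H01[OF dom(1)])
    have "ipL2 \<Omega> f \<phi> = ipL2 \<Omega> g \<phi>" using assms h by (simp add: AstarL2_def)
    then show "emb \<Omega> (\<lambda>x. f x - g x) \<bullet> emb \<Omega> \<phi> = 0"
      unfolding L2_diff(2)[OF dom(1) L] inner_diff_left inner_emb[OF dom(1) L(1) H01_L2[OF h]]
        inner_emb[OF dom(1) L(2) H01_L2[OF h]] by simp
  qed
  then show ?thesis unfolding L2_diff(2)[OF dom(1) L] by simp
qed

lemma AstarL2_Astar: "AstarL2 \<Omega> aa c0 p f \<Longrightarrow> AstarL2 \<Omega> aa c0 p (Astar \<Omega> aa c0 p)"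
  unfolding Astar_def by (rule someI[of "AstarL2 \<Omega> aa c0 p"])

lemma zero_graph: "H01 \<Omega> (\<lambda>x. 0)" "AstarL2 \<Omega> aa c0 (\<lambda>x. 0) (\<lambda>x. 0)"
proof -
  show h: "H01 \<Omega> (\<lambda>x. 0)" by (rule test_fn_H01[OF dom(1) test_fn_zero])
  have z: "emb \<Omega> (\<lambda>x. 0) = 0" by (simp add: emb_def zero_l2.abs_eq)
  have "jet \<Omega> (\<lambda>x. 0) = 0"
    by (rule jet_eqI[OF dom h subspace_0[OF subspace_jets[OF dom(1)]]]) (simp add: z)
  then show "AstarL2 \<Omega> aa c0 (\<lambda>x. 0) (\<lambda>x. 0)"
    unfolding AstarL2_def using test_fn_L2(1)[OF dom(1) test_fn_zero]
    by (simp add: aform_jform h bounded_bilinear.zero_right[OF bounded_bilinear_jform] ipL2_def)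
qed

lemma graph_I: "H01 \<Omega> p \<Longrightarrow> AstarL2 \<Omega> aa c0 p f \<Longrightarrow> (emb \<Omega> p, emb \<Omega> f) \<in> graph"
  unfolding graph_def by (simp, intro exI conjI) (rule refl | assumption)+

lemma subspace_graph: "subspace graph"
proof (rule subspaceI)
  show "0 \<in> graph"
    using graph_I[OF zero_graph] by (simp add: emb_def zero_l2.abs_eq[symmetric] zero_prod_def)
next
  fix x y assume "x \<in> graph" "y \<in> graph"
  then obtain p f q g where p: "H01 \<Omega> p" "AstarL2 \<Omega> aa c0 p f" "x = (emb \<Omega> p, emb \<Omega> f)"
    and q: "H01 \<Omega> q" "AstarL2 \<Omega> aa c0 q g" "y = (emb \<Omega> q, emb \<Omega> g)"
    unfolding graph_def by (elim CollectE exE conjE)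
  have L: "L2 \<Omega> f" "L2 \<Omega> g" using p q by (simp_all add: AstarL2_def)
  from graph_I[OF H01_lincomb(1)[OF dom p(1) q(1)] AstarL2_lincomb[OF p(1,2) q(1,2)], of 1 1]
  show "x + y \<in> graph"
    using L2_add(2)[OF dom(1) L] L2_add(2)[OF dom(1) H01_L2[OF p(1)] H01_L2[OF q(1)]] by (simp add: p(3) q(3))
next
  fix c x assume "x \<in> graph"
  then obtain p f where p: "H01 \<Omega> p" "AstarL2 \<Omega> aa c0 p f" "x = (emb \<Omega> p, emb \<Omega> f)"
    unfolding graph_def by (elim CollectE exE conjE)
  have L: "L2 \<Omega> f" using p by (simp add: AstarL2_def)
  from graph_I[OF H01_lincomb(1)[OF dom p(1) p(1)] AstarL2_lincomb[OF p(1,2) p(1,2)], of c 0]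
  show "c *\<^sub>R x \<in> graph"
    using L2_cmult(2)[OF dom(1) L] L2_cmult(2)[OF dom(1) H01_L2[OF p(1)]] by (simp add: p(3))
qed

text \<open>The equation \<alpha> A (A q) + q = h with the outer \<open>A\<close> moved to the test
  function, so that \<open>A\<close> has to be applied to \<open>q\<close> only once. It has the
  shape that \<open>mabcd_rate\<close> asks of \<open>R\<close> and \<open>AR\<close>.\<close>

definition is_resolvent :: "real \<Rightarrow> (real^'n) l2 \<Rightarrow> (real^'n) l2 \<Rightarrow> (real^'n) l2 \<Rightarrow> bool" where
  "is_resolvent \<alpha> h q aq \<longleftrightarrow> (q, aq) \<in> graph \<and> (\<forall>(v, av) \<in> graph. \<alpha> * (aq \<bullet> av) + (q - h) \<bullet> v = 0)"

text \<open>By symmetry of the form, the first equation says that \<open>r\<close> is the image of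
  \<open>q\<close> under \<open>A\<close>. In the second, a test function from the domain of
  \<open>A\<close> takes the form over to itself.\<close>

lemma coupled_is_resolvent:
  assumes "H01 \<Omega> q" "H01 \<Omega> r"
    "\<forall>v. H01 \<Omega> v \<longrightarrow> aform \<Omega> aa c0 q v = emb \<Omega> r \<bullet> emb \<Omega> v"
    "\<forall>v. H01 \<Omega> v \<longrightarrow> \<alpha> * aform \<Omega> aa c0 r v + emb \<Omega> q \<bullet> emb \<Omega> v = h \<bullet> emb \<Omega> v"
  shows "is_resolvent \<alpha> h (emb \<Omega> q) (emb \<Omega> r)"
proof -
  have "AstarL2 \<Omega> aa c0 q r"
    unfolding AstarL2_def
    using assms(3) by (simp add: H01_L2 assms(1,2) aform_jform jform_sym inner_emb dom)
  then have "(emb \<Omega> q, emb \<Omega> r) \<in> graph" by (rule graph_I[OF assms(1)])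
  moreover have "\<alpha> * (emb \<Omega> r \<bullet> av) + (emb \<Omega> q - h) \<bullet> v = 0" if "(v, av) \<in> graph" for v av
  proof -
    obtain u f where u: "H01 \<Omega> u" "AstarL2 \<Omega> aa c0 u f" "v = emb \<Omega> u" "av = emb \<Omega> f"
      using \<open>(v, av) \<in> graph\<close> unfolding graph_def by (elim CollectE exE conjE Pair_inject)
    have f: "L2 \<Omega> f" using u by (simp add: AstarL2_def)
    have "aform \<Omega> aa c0 r u = emb \<Omega> r \<bullet> av"
      using u(2) assms(2) by (simp add: AstarL2_def u(4) inner_commute inner_emb[OF dom(1) f H01_L2[OF assms(2)]])
    then show ?thesis using assms(4)[rule_format, OF u(1)] by (simp add: u(3) inner_diff_left)
  qed
  ultimately show ?thesis unfolding is_resolvent_def by auto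
qed

lemma is_resolvent_unique:
  assumes "\<alpha> > 0" "is_resolvent \<alpha> h q aq" "is_resolvent \<alpha> h q' aq'"
  shows "q = q'"
proof -
  have g: "(q - q', aq - aq') \<in> graph"
    using subspace_diff[OF subspace_graph, of "(q, aq)" "(q', aq')"] assms by (simp add: is_resolvent_def)
  have 1: "\<alpha> * (aq \<bullet> (aq - aq')) + (q - h) \<bullet> (q - q') = 0"
    using assms(2) g unfolding is_resolvent_def by blast
  have 2: "\<alpha> * (aq' \<bullet> (aq - aq')) + (q' - h) \<bullet> (q - q') = 0"
    using assms(3) g unfolding is_resolvent_def by blast
  have "\<alpha> * ((aq - aq') \<bullet> (aq - aq')) + (q - q') \<bullet> (q - q') = 0"
    using 1 2 by (simp add: algebra_simps)
  moreover have "0 \<le> \<alpha> * ((aq - aq') \<bullet> (aq - aq'))" using assms(1) by simp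
  ultimately have "(q - q') \<bullet> (q - q') = 0" using inner_ge_zero[of "q - q'"] by linarith
  then show ?thesis by simp
qed

lemma is_resolvent_lincomb:
  assumes "is_resolvent \<alpha> h q aq" "is_resolvent \<alpha> h' q' aq'"
  shows "is_resolvent \<alpha> (a *\<^sub>R h + b *\<^sub>R h') (a *\<^sub>R q + b *\<^sub>R q') (a *\<^sub>R aq + b *\<^sub>R aq')"
proof -
  have "a *\<^sub>R (q, aq) + b *\<^sub>R (q', aq') \<in> graph"
    using assms by (intro subspace_add subspace_mul subspace_graph) (auto simp: is_resolvent_def)
  moreover have "\<alpha> * ((a *\<^sub>R aq + b *\<^sub>R aq') \<bullet> av) + (a *\<^sub>R q + b *\<^sub>R q' - (a *\<^sub>R h + b *\<^sub>R h')) \<bullet> v = 0"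
    if "(v, av) \<in> graph" for v av
  proof -
    have "\<alpha> * (aq \<bullet> av) + (q - h) \<bullet> v = 0" "\<alpha> * (aq' \<bullet> av) + (q' - h') \<bullet> v = 0"
      using assms that unfolding is_resolvent_def by blast+
    then have "a * (\<alpha> * (aq \<bullet> av) + (q - h) \<bullet> v) + b * (\<alpha> * (aq' \<bullet> av) + (q' - h') \<bullet> v) = 0" by simp
    then show ?thesis by (simp add: algebra_simps)
  qed
  ultimately show ?thesis unfolding is_resolvent_def by auto
qed

lemma resolvent_exists:
  assumes \<alpha>: "\<alpha> > 0"
  shows "\<exists>R AR. linear R \<and> (\<forall>h. is_resolvent \<alpha> h (R h) (AR h))"
proof -
  have "\<exists>q aq. is_resolvent \<alpha> h q aq" for h
  proof -
    obtain q r where qr: "H01 \<Omega> q" "H01 \<Omega> r"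
      "\<forall>v. H01 \<Omega> v \<longrightarrow> aform \<Omega> aa c0 q v = emb \<Omega> r \<bullet> emb \<Omega> v"
      "\<forall>v. H01 \<Omega> v \<longrightarrow> \<alpha> * aform \<Omega> aa c0 r v + emb \<Omega> q \<bullet> emb \<Omega> v = h \<bullet> emb \<Omega> v"
      using coupled_system_solvable[OF \<alpha>, of h] by (elim exE conjE)
    show ?thesis by (intro exI) (rule coupled_is_resolvent[OF qr])
  qed
  then obtain R AR where R: "\<And>h. is_resolvent \<alpha> h (R h) (AR h)" by metis
  \<comment> \<open>The values of \<open>R\<close> were chosen one by one, without regard to
    linearity; uniqueness of the resolvent restores it.\<close>
  have lc: "R (a *\<^sub>R h + b *\<^sub>R k) = a *\<^sub>R R h + b *\<^sub>R R k" for a b h k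
    by (rule is_resolvent_unique[OF \<alpha> R is_resolvent_lincomb[OF R R]])
  have "linear R"
    by (rule linearI) (use lc[of 1 _ 1] lc[of _ _ 0] in simp_all)
  with R show ?thesis by (intro exI[of _ R] exI[of _ AR]) simp
qed

text \<open>Whichever solution of the coupled system \<open>Rop\<close> picks, its class is forced
  by uniqueness of the resolvent. This links the scalar product in the claimed constant with the
  abstract \<open>R\<close>.\<close>

lemma Rop_resolvent:
  assumes \<alpha>: "\<alpha> > 0" and f: "L2 \<Omega> f" and res: "is_resolvent \<alpha> (emb \<Omega> f) q aq"
  shows "L2 \<Omega> (Rop \<Omega> aa c0 \<alpha> f)" "emb \<Omega> (Rop \<Omega> aa c0 \<alpha> f) = q"
proof -
  let ?P = "\<lambda>q1. \<exists>q2. H01 \<Omega> q1 \<and> H01 \<Omega> q2 \<and>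
      (\<forall>v. H01 \<Omega> v \<longrightarrow> aform \<Omega> aa c0 q1 v = ipL2 \<Omega> q2 v) \<and>
      (\<forall>v. H01 \<Omega> v \<longrightarrow> \<alpha> * aform \<Omega> aa c0 q2 v + ipL2 \<Omega> q1 v = ipL2 \<Omega> f v)"
  obtain q1 q2 where "H01 \<Omega> q1" "H01 \<Omega> q2"
      "\<forall>v. H01 \<Omega> v \<longrightarrow> aform \<Omega> aa c0 q1 v = emb \<Omega> q2 \<bullet> emb \<Omega> v"
      "\<forall>v. H01 \<Omega> v \<longrightarrow> \<alpha> * aform \<Omega> aa c0 q2 v + emb \<Omega> q1 \<bullet> emb \<Omega> v = emb \<Omega> f \<bullet> emb \<Omega> v"
    using coupled_system_solvable[OF \<alpha>, of "emb \<Omega> f"] by (elim exE conjE)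
  then have "?P q1" by (intro exI[of _ q2]) (simp add: inner_emb[OF dom(1)] H01_L2 f)
  then have "?P (Rop \<Omega> aa c0 \<alpha> f)" unfolding Rop_def by (rule someI[of ?P])
  then obtain q2 where q2: "H01 \<Omega> (Rop \<Omega> aa c0 \<alpha> f)" "H01 \<Omega> q2"
      "\<forall>v. H01 \<Omega> v \<longrightarrow> aform \<Omega> aa c0 (Rop \<Omega> aa c0 \<alpha> f) v = ipL2 \<Omega> q2 v"
      "\<forall>v. H01 \<Omega> v \<longrightarrow> \<alpha> * aform \<Omega> aa c0 q2 v + ipL2 \<Omega> (Rop \<Omega> aa c0 \<alpha> f) v = ipL2 \<Omega> f v"
    by (elim exE conjE)
  show "L2 \<Omega> (Rop \<Omega> aa c0 \<alpha> f)" by (rule H01_L2[OF q2(1)])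
  have "is_resolvent \<alpha> (emb \<Omega> f) (emb \<Omega> (Rop \<Omega> aa c0 \<alpha> f)) (emb \<Omega> q2)"
    using q2(3,4) by (intro coupled_is_resolvent[OF q2(1,2)]) (simp_all add: inner_emb[OF dom(1)] H01_L2 q2(1,2) f)
  then show "emb \<Omega> (Rop \<Omega> aa c0 \<alpha> f) = q" by (rule is_resolvent_unique[OF \<alpha> _ res])
qed

end

section \<open>The rate of convergence\<close>

lemma quadratic_nonneg_linear_coeff_zero:
  fixes E C :: real
  assumes "\<And>t. 0 \<le> t * E + t\<^sup>2 * C"
  shows "E = 0"
proof (rule ccontr)
  assume E: "E \<noteq> 0"
  \<comment> \<open>The modulus covers either sign of \<open>C\<close> and the added 1 keeps
    \<open>D\<close> positive; \<open>- E / (2 * D)\<close> minimises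
    \<open>t * E + t\<^sup>2 * D\<close>.\<close>
  define D where "D = \<bar>C\<bar> + 1"
  have D: "D > 0" "C \<le> D" by (auto simp: D_def)
  have "0 \<le> (- E / (2 * D)) * E + (- E / (2 * D))\<^sup>2 * C" by (rule assms)
  also have "\<dots> \<le> (- E / (2 * D)) * E + (- E / (2 * D))\<^sup>2 * D"
    using D by (intro add_left_mono mult_left_mono) auto
  also have "\<dots> = - (E\<^sup>2 / (4 * D))" using D by (simp add: power2_eq_square field_simps)
  also have "\<dots> < 0" using E D by simp
  finally show False by simp
qed

section \<open>Projections onto intervals and support functions\<close>

lemma proj_range: "lo \<le> hi \<Longrightarrow> lo \<le> proj lo hi s" "lo \<le> hi \<Longrightarrow> proj lo hi s \<le> hi"
  by (auto simp: proj_def)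

lemma proj_abs_le: "lo \<le> hi \<Longrightarrow> \<bar>proj lo hi s\<bar> \<le> \<bar>lo\<bar> + \<bar>hi\<bar>"
  by (auto simp: proj_def)

lemma proj_variational:
  assumes "lo \<le> l" "l \<le> hi" shows "0 \<le> (proj lo hi s - s) * (l - proj lo hi s)"
proof -
  consider "s \<le> lo" | "lo < s" "s < hi" | "hi \<le> s" by linarith
  then show ?thesis
    using assms by cases (auto simp: proj_def intro: mult_nonneg_nonneg mult_nonpos_nonpos)
qed

lemma proj_measurable:
  "f \<in> borel_measurable M \<Longrightarrow> (\<lambda>x. proj lo hi (f x)) \<in> borel_measurable M"
  unfolding proj_def by (intro borel_measurable_max borel_measurable_min) auto

text \<open>Moreau's decomposition in one dimension: the remainder \<open>m\<close> of the
  projection is an outward normal of the interval at the projected point, so this point attains the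
  support function at \<open>m\<close>.\<close>

lemma proj_support_function:
  assumes "lo \<le> hi" "\<alpha> > 0" "m = z - \<alpha> * proj lo hi (z / \<alpha>)"
  shows "proj lo hi (z / \<alpha>) * m = max (lo * m) (hi * m)"
proof -
  define y where "y = z / \<alpha>"
  have m: "m = \<alpha> * (y - proj lo hi y)" using assms(2,3) by (simp add: y_def right_diff_distrib)
  consider "y \<le> lo" | "lo < y" "y < hi" | "hi \<le> y" by linarith
  then show ?thesis unfolding y_def[symmetric]
  proof cases
    case 1
    then have "proj lo hi y = lo" "m \<le> 0" using assms(1,2) m by (auto simp: proj_def mult_nonneg_nonpos)
    then show "proj lo hi y * m = max (lo * m) (hi * m)"
      using mult_right_mono_neg[OF assms(1), of m] by (simp only: max_absorb1)
  next
    case 2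
    then have "m = 0" using m by (simp add: proj_def)
    then show "proj lo hi y * m = max (lo * m) (hi * m)" by simp
  next
    case 3
    then have "proj lo hi y = hi" "m \<ge> 0" using assms(1,2) m by (auto simp: proj_def)
    then show "proj lo hi y * m = max (lo * m) (hi * m)"
      using mult_right_mono[OF assms(1), of m] by (simp only: max_absorb2)
  qed
qed

text \<open>An admissible \<open>u\<close> that attains the supremum pointwise at
  \<open>\<mu>\<close> is a subgradient there, since its product with any other \<open>m\<close>
  stays below the support function pointwise.\<close>

lemma dstar_Uad_subgradient:
  assumes \<Omega>: "open \<Omega>" "bounded \<Omega>" and L: "L2 \<Omega> u" "L2 \<Omega> \<mu>" "L2 \<Omega> m"
    and u: "\<And>x. lo \<le> u x" "\<And>x. u x \<le> hi" "\<And>x. u x * \<mu> x = max (lo * \<mu> x) (hi * \<mu> x)"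
  shows "dstar_Uad \<Omega> lo hi \<mu> + ipL2 \<Omega> u (\<lambda>x. m x - \<mu> x) \<le> dstar_Uad \<Omega> lo hi m"
proof -
  have i: "integrable (lebesgue_on \<Omega>) (\<lambda>x. u x * \<mu> x)" "integrable (lebesgue_on \<Omega>) (\<lambda>x. u x * m x)"
    using L2_mult_integrable[OF \<Omega>(1)] L by blast+
  have im: "integrable (lebesgue_on \<Omega>) (\<lambda>x. max (lo * m x) (hi * m x))"
    using L2_integrable[OF \<Omega> L(3)] by (intro integrable_max integrable_mult_right)
  have "dstar_Uad \<Omega> lo hi \<mu> + ipL2 \<Omega> u (\<lambda>x. m x - \<mu> x) = (\<integral>x. u x * m x \<partial>lebesgue_on \<Omega>)"
    using i by (simp add: dstar_Uad_def ipL2_def u(3)[symmetric] right_diff_distrib)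
  also have "\<dots> \<le> dstar_Uad \<Omega> lo hi m"
    unfolding dstar_Uad_def
  proof (rule integral_mono[OF i(2) im])
    fix x
    show "u x * m x \<le> max (lo * m x) (hi * m x)"
      using mult_right_mono[OF u(2)[of x], of "m x"] mult_right_mono_neg[OF u(1)[of x], of "m x"]
      by (cases "0 \<le> m x") (auto simp: le_max_iff_disj)
  qed
  finally show ?thesis .
qed

section \<open>The subproblems in p and the objective in Hilbert space terms\<close>

context elliptic_problem
begin

text \<open>The image under \<open>A\<close> is a separate argument, so that the objective becomes
  an explicit quadratic polynomial along lines in \<open>graph\<close>.\<close>

definition Jsq :: "'n fn \<Rightarrow> 'n fn \<Rightarrow> real \<Rightarrow> 'n fn \<Rightarrow> (real^'n) l2 \<Rightarrow> (real^'n) l2 \<Rightarrow> real" where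
  "Jsq yd yr \<alpha> w h a = 1/2 * (norm (a - emb \<Omega> yd))\<^sup>2 + 1/(2*\<alpha>) * (norm (h - emb \<Omega> w))\<^sup>2 + h \<bullet> emb \<Omega> yr"

lemma Jp_eq_Jsq:
  assumes "L2 \<Omega> yd" "L2 \<Omega> yr" "L2 \<Omega> w" "H01 \<Omega> p" "AstarL2 \<Omega> aa c0 p f"
  shows "Jp \<Omega> aa c0 yd yr \<alpha> w p = ereal (Jsq yd yr \<alpha> w (emb \<Omega> p) (emb \<Omega> f))"
proof -
  note A = AstarL2_Astar[OF assms(5)]
  have LA: "L2 \<Omega> (Astar \<Omega> aa c0 p)" using A by (simp add: AstarL2_def)
  have "\<exists>f. AstarL2 \<Omega> aa c0 p f" using A by (rule exI[of "AstarL2 \<Omega> aa c0 p"])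
  then show ?thesis
    unfolding Jp_def Jsq_def AstarL2_unique[OF assms(5) A]
    by (simp add: nrmL2_emb_diff[OF dom(1)] LA assms(1-3) H01_L2[OF assms(4)] dist_norm inner_emb[OF dom(1)])
qed

text \<open>The objective is finite at the zero function, so a minimiser has a finite value and lies
  in the domain of \<open>A\<close>.\<close>

lemma argmin_in_graph:
  assumes "is_argmin_p \<Omega> aa c0 yd yr \<alpha> w q"
  shows "H01 \<Omega> q" "AstarL2 \<Omega> aa c0 q (Astar \<Omega> aa c0 q)" "(emb \<Omega> q, emb \<Omega> (Astar \<Omega> aa c0 q)) \<in> graph"
proof -
  show q: "H01 \<Omega> q" using assms by (simp add: is_argmin_p_def)
  have "Jp \<Omega> aa c0 yd yr \<alpha> w q \<le> Jp \<Omega> aa c0 yd yr \<alpha> w (\<lambda>x. 0)"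
    using assms zero_graph(1) by (simp add: is_argmin_p_def)
  moreover have ex: "\<exists>f. AstarL2 \<Omega> aa c0 (\<lambda>x. 0) f" using zero_graph(2) by (rule exI[of "AstarL2 \<Omega> aa c0 (\<lambda>x. 0)"])
  have "Jp \<Omega> aa c0 yd yr \<alpha> w (\<lambda>x. 0) \<noteq> \<infinity>" unfolding Jp_def if_P[OF ex] by simp
  ultimately have "Jp \<Omega> aa c0 yd yr \<alpha> w q \<noteq> \<infinity>" by auto
  moreover have "Jp \<Omega> aa c0 yd yr \<alpha> w q = \<infinity>" if "\<not> (\<exists>f. AstarL2 \<Omega> aa c0 q f)"
    unfolding Jp_def if_not_P[OF that] ..
  ultimately have "\<exists>f. AstarL2 \<Omega> aa c0 q f" by (rule contrapos_np)
  then obtain f where "AstarL2 \<Omega> aa c0 q f" by (elim exE)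
  then show A: "AstarL2 \<Omega> aa c0 q (Astar \<Omega> aa c0 q)" by (rule AstarL2_Astar)
  show "(emb \<Omega> q, emb \<Omega> (Astar \<Omega> aa c0 q)) \<in> graph" by (rule graph_I[OF q A])
qed

text \<open>Along the direction (\<open>v\<close>, \<open>av\<close>) the objective is a quadratic
  polynomial with minimum at zero, and the expression in question is its linear coefficient.\<close>

lemma argmin_euler:
  assumes \<alpha>: "\<alpha> > 0" and L: "L2 \<Omega> yd" "L2 \<Omega> yr" "L2 \<Omega> w"
    and q: "is_argmin_p \<Omega> aa c0 yd yr \<alpha> w q" and v: "(v, av) \<in> graph"
  shows "(emb \<Omega> (Astar \<Omega> aa c0 q) - emb \<Omega> yd) \<bullet> av + (emb \<Omega> q - emb \<Omega> w) \<bullet> v / \<alpha> + v \<bullet> emb \<Omega> yr = 0"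
proof -
  obtain u f where u: "H01 \<Omega> u" "AstarL2 \<Omega> aa c0 u f" "v = emb \<Omega> u" "av = emb \<Omega> f"
    using v unfolding graph_def by (elim CollectE exE conjE Pair_inject)
  note qg = argmin_in_graph[OF q]
  let ?f = "Astar \<Omega> aa c0 q"
  have Lf: "L2 \<Omega> ?f" "L2 \<Omega> f" using qg(2) u(2) by (simp_all add: AstarL2_def)
  let ?h = "emb \<Omega> q" and ?a = "emb \<Omega> ?f"
  have min: "Jsq yd yr \<alpha> w ?h ?a \<le> Jsq yd yr \<alpha> w (?h + t *\<^sub>R v) (?a + t *\<^sub>R av)" for t
  proof -
    note H = H01_lincomb(1)[OF dom qg(1) u(1), of 1 t]
    note A = AstarL2_lincomb[OF qg(1,2) u(1,2), of 1 t]
    have "Jp \<Omega> aa c0 yd yr \<alpha> w q \<le> Jp \<Omega> aa c0 yd yr \<alpha> w (\<lambda>x. 1 * q x + t * u x)"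
      using q H unfolding is_argmin_p_def by (elim conjE allE impE)
    then have "Jsq yd yr \<alpha> w ?h ?a \<le> Jsq yd yr \<alpha> w (emb \<Omega> (\<lambda>x. 1 * q x + t * u x)) (emb \<Omega> (\<lambda>x. 1 * ?f x + t * f x))"
      unfolding Jp_eq_Jsq[OF L qg(1,2)] Jp_eq_Jsq[OF L H A] by simp
    then show ?thesis
      unfolding L2_lincomb(2)[OF dom(1) Lf] L2_lincomb(2)[OF dom(1) H01_L2[OF qg(1)] H01_L2[OF u(1)]]
      by (simp add: u(3,4))
  qed
  let ?E = "(?a - emb \<Omega> yd) \<bullet> av + (?h - emb \<Omega> w) \<bullet> v / \<alpha> + v \<bullet> emb \<Omega> yr"
  let ?C = "1/2 * (av \<bullet> av) + 1/(2*\<alpha>) * (v \<bullet> v)"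
  have n: "(norm (x + t *\<^sub>R y - z))\<^sup>2 = (norm (x - z))\<^sup>2 + 2 * t * ((x - z) \<bullet> y) + t\<^sup>2 * (y \<bullet> y)"
    for x y z :: "(real^'n) l2" and t
    unfolding power2_norm_eq_inner by (simp add: algebra_simps inner_commute power2_eq_square)
  have "0 \<le> t * ?E + t\<^sup>2 * ?C" for t
  proof -
    have "Jsq yd yr \<alpha> w (?h + t *\<^sub>R v) (?a + t *\<^sub>R av) = Jsq yd yr \<alpha> w ?h ?a + (t * ?E + t\<^sup>2 * ?C)"
      unfolding Jsq_def n using \<alpha> by (simp add: inner_add_left field_simps)
    then show ?thesis using min[of t] by simp
  qed
  then show ?thesis by (rule quadratic_nonneg_linear_coeff_zero)
qed

lemma Phi_finite:
  assumes "L2 \<Omega> yd" "L2 \<Omega> yr" "L2 \<Omega> l" "H01 \<Omega> p" "L2 \<Omega> m"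
    and A: "AstarL2 \<Omega> aa c0 p f" and l: "AE x in lebesgue_on \<Omega>. \<bar>l x\<bar> \<le> \<beta>"
  shows "Phi \<Omega> aa c0 yd yr \<alpha> \<beta> ua ub l p m = ereal (1/2 * (norm (emb \<Omega> (Astar \<Omega> aa c0 p) - emb \<Omega> yd))\<^sup>2
     + 1/(2*\<alpha>) * (norm (emb \<Omega> p - emb \<Omega> l - emb \<Omega> m))\<^sup>2 + emb \<Omega> p \<bullet> emb \<Omega> yr + dstar_Uad \<Omega> ua ub m
     - 1/2 * (nrmL2 \<Omega> yd)\<^sup>2)"
proof -
  have LA: "L2 \<Omega> (Astar \<Omega> aa c0 p)" using AstarL2_Astar[OF A] by (simp add: AstarL2_def)
  note Lp = H01_L2[OF assms(4)]
  note d = L2_diff[OF dom(1) Lp assms(3)]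
  have "\<exists>f. AstarL2 \<Omega> aa c0 p f" using A by (rule exI[of "AstarL2 \<Omega> aa c0 p"])
  then show ?thesis
    unfolding Phi_def using l
    by (simp add: nrmL2_emb_diff[OF dom(1) LA assms(1)] nrmL2_emb_diff[OF dom(1) d(1) assms(5)] d(2)
        dist_norm inner_emb[OF dom(1) Lp assms(2)])
qed

end

theorem theorem2:
  fixes \<Omega> :: "(real^'n) set"
    and aa :: "real^'n \<Rightarrow> real^'n^'n" and c0 yd yr :: "'n fn"
    and \<alpha> \<beta> ua ub \<theta> :: real
    and lam_s p_s mu_s lam0 p0 mu0 :: "'n fn"
    and lam p mu lt pt mt ph :: "nat \<Rightarrow> 'n fn"
  assumes dim: "CARD('n) = 2 \<or> CARD('n) = 3"
    and dom: "open \<Omega>" "convex \<Omega>" "bounded \<Omega>" "C11_boundary \<Omega> \<or> polygonal_boundary \<Omega>"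
    and coef_meas: "\<forall>i j. (\<lambda>x. aa x $ i $ j) \<in> borel_measurable (lebesgue_on \<Omega>)"
    and coef_bdd: "\<exists>M. \<forall>i j. AE x in lebesgue_on \<Omega>. \<bar>aa x $ i $ j\<bar> \<le> M"
    and coef_sym: "\<forall>i j. AE x in lebesgue_on \<Omega>. aa x $ i $ j = aa x $ j $ i"
    and c0_meas: "c0 \<in> borel_measurable (lebesgue_on \<Omega>)"
    and c0_bdd: "\<exists>M. AE x in lebesgue_on \<Omega>. \<bar>c0 x\<bar> \<le> M"
    and c0_nonneg: "AE x in lebesgue_on \<Omega>. c0 x \<ge> 0"
    and elliptic: "\<theta> > 0"
      "AE x in lebesgue_on \<Omega>. \<forall>\<xi>::real^'n.
          (\<Sum>i\<in>UNIV. \<Sum>j\<in>UNIV. aa x $ i $ j * \<xi> $ i * \<xi> $ j) \<ge> \<theta> * (norm \<xi>)\<^sup>2"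
    and data: "L2 \<Omega> yd" "L2 \<Omega> yr" "ua \<le> 0" "0 \<le> ub" "\<alpha> > 0" "\<beta> > 0"
    and sol: "L2 \<Omega> lam_s" "H01 \<Omega> p_s" "L2 \<Omega> mu_s"
      "\<forall>l q m. L2 \<Omega> l \<and> H01 \<Omega> q \<and> L2 \<Omega> m \<longrightarrow>
         Phi \<Omega> aa c0 yd yr \<alpha> \<beta> ua ub lam_s p_s mu_s \<le> Phi \<Omega> aa c0 yd yr \<alpha> \<beta> ua ub l q m"
    and init: "L2 \<Omega> lam0" "H01 \<Omega> p0" "L2 \<Omega> mu0"
      "AE x in lebesgue_on \<Omega>. \<bar>lam0 x\<bar> \<le> \<beta>"
    and start: "lam 0 = lam0" "p 0 = p0" "mu 0 = mu0"
      "lt 1 = lam0" "pt 1 = p0" "mt 1 = mu0"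
    and step_i: "\<forall>k\<ge>1. is_argmin_p \<Omega> aa c0 yd yr \<alpha> (\<lambda>x. lt k x + mt k x) (ph k)"
    and step_ii: "\<forall>k\<ge>1. lam k = (\<lambda>x. proj (- \<beta>) \<beta> (ph k x - mt k x))"
    and step_iii: "\<forall>k\<ge>1. is_argmin_p \<Omega> aa c0 yd yr \<alpha> (\<lambda>x. lam k x + mt k x) (p k)"
    and step_iv: "\<forall>k\<ge>1. mu k = (\<lambda>x. p k x - lam k x - \<alpha> * proj ua ub ((p k x - lam k x) / \<alpha>))"
    and step_v: "\<forall>k\<ge>1. lt (Suc k) = (\<lambda>x. lam k x + bk k * (lam k x - lam (k - 1) x))"
      "\<forall>k\<ge>1. pt (Suc k) = (\<lambda>x. p k x + bk k * (p k x - p (k - 1) x))"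
      "\<forall>k\<ge>1. mt (Suc k) = (\<lambda>x. mu k x + bk k * (mu k x - mu (k - 1) x))"
  shows "\<forall>k\<ge>1.
     Phi \<Omega> aa c0 yd yr \<alpha> \<beta> ua ub (lam k) (p k) (mu k)
       - Phi \<Omega> aa c0 yd yr \<alpha> \<beta> ua ub lam_s p_s mu_s
     \<le> ereal (4 * (1/(2*\<alpha>) * ipL2 \<Omega> (\<lambda>x. lam_s x - lam0 x)
                                  (Rop \<Omega> aa c0 \<alpha> (\<lambda>x. lam_s x - lam0 x))
                   + 1/(2*\<alpha>) * (nrmL2 \<Omega> (\<lambda>x. mu_s x - mu0 x))\<^sup>2)
               / (real k + 1)\<^sup>2)"
proof (intro allI impI)
  fix k :: nat assume k: "k \<ge> 1"
  note \<Omega> = dom(1,3)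
  interpret elliptic_problem \<Omega> aa c0 \<theta>
    by unfold_locales (fact dom(1) dom(3) coef_meas coef_bdd coef_sym c0_meas c0_bdd c0_nonneg elliptic)+
  have uab: "ua \<le> ub" using data(3,4) by simp
  have \<alpha>: "\<alpha> > 0" and \<beta>: "- \<beta> \<le> \<beta>" using data(5,6) by simp_all
  have Lph: "L2 \<Omega> (ph k)" and Lp: "L2 \<Omega> (p k)" if "k \<ge> 1" for k
    using step_i step_iii that by (auto simp: is_argmin_p_def intro: H01_L2)
  have Llam: "L2 \<Omega> (lam k)" if "k \<ge> 1" "L2 \<Omega> (mt k)" for k
  proof -
    have "(\<lambda>x. proj (- \<beta>) \<beta> (ph k x - mt k x)) \<in> borel_measurable (lebesgue_on \<Omega>)"
      using L2_diff(1)[OF \<Omega>(1) Lph[OF that(1)] that(2)] by (intro proj_measurable L2_measurable)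
    then show ?thesis
      using step_ii that(1) proj_abs_le[OF \<beta>] by (simp, intro L2_bounded_fun[OF \<Omega>]) auto
  qed
  \<comment> \<open>Step (iv) reads \<open>mu k = p k - lam k - \<alpha> * uk k\<close>;
    \<open>uk k\<close> will be the subgradient of the support function at
    \<open>mu k\<close>.\<close>
  define uk where "uk = (\<lambda>k x. proj ua ub ((p k x - lam k x) / \<alpha>))"
  have Lu: "L2 \<Omega> (uk k)" if "k \<ge> 1" "L2 \<Omega> (mt k)" for k
  proof -
    have "(\<lambda>x. (1 / \<alpha>) * (p k x - lam k x)) \<in> borel_measurable (lebesgue_on \<Omega>)"
      by (intro L2_measurable L2_cmult(1)[OF \<Omega>(1)] L2_diff(1)[OF \<Omega>(1)] Lp Llam that)
    then have "uk k \<in> borel_measurable (lebesgue_on \<Omega>)"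
      unfolding uk_def by (intro proj_measurable) simp
    then show ?thesis
      by (rule L2_bounded_fun[OF \<Omega>]) (unfold uk_def, rule proj_abs_le[OF uab])
  qed
  have muk: "mu k = (\<lambda>x. (p k x - lam k x) - \<alpha> * uk k x)" if "k \<ge> 1" for k
    using step_iv that by (simp add: uk_def)
  have Lmu: "L2 \<Omega> (mu k)" if "k \<ge> 1" "L2 \<Omega> (mt k)" for k
    unfolding muk[OF that(1)]
    by (intro L2_diff(1)[OF \<Omega>(1)] L2_cmult(1)[OF \<Omega>(1)] Lp Llam Lu that)
  \<comment> \<open>Square integrability travels with the iteration: \<open>lam k\<close> and
    \<open>mu k\<close> inherit it from \<open>mt k\<close>, and the extrapolated points from two
    consecutive iterates, hence the index \<open>k - 1\<close> in the invariant.\<close>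
  have all: "L2 \<Omega> (lt k) \<and> L2 \<Omega> (mt k) \<and> L2 \<Omega> (lam (k - 1)) \<and> L2 \<Omega> (mu (k - 1))" if "k \<ge> 1" for k
    using that
  proof (induction k rule: nat_induct_at_least)
    case base
    show ?case using init(1,3) start by simp
  next
    case (Suc k)
    have "L2 \<Omega> (lam k)" "L2 \<Omega> (mu k)" using Suc Llam Lmu by blast+
    then show ?case
      using Suc step_v
      by (auto intro!: L2_add(1)[OF \<Omega>(1)] L2_diff(1)[OF \<Omega>(1)] L2_cmult(1)[OF \<Omega>(1)])
  qed
  have Lk: "L2 \<Omega> (lt k)" "L2 \<Omega> (mt k)" "L2 \<Omega> (lam k)" "L2 \<Omega> (mu k)" "L2 \<Omega> (uk k)" if "k \<ge> 1" for k
    using all[OF that] Llam[OF that] Lmu[OF that] Lu[OF that] by simp_all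
  have L0: "L2 \<Omega> (lam k)" "L2 \<Omega> (mu k)" for k using all[of "Suc k"] by simp_all
  have lam_range: "\<bar>lam k x\<bar> \<le> \<beta>" if "k \<ge> 1" for k x
    using step_ii that proj_range[OF \<beta>, of "ph k x - mt k x"] by (simp add: abs_le_iff)

  \<comment> \<open>Comparison with the zero triple, where the objective is finite, forces the
    solution to obey the bound by \<open>\<beta>\<close> and to lie in the domain of
    \<open>A\<close>.\<close>
  have z: "L2 \<Omega> (\<lambda>x. 0)" by (rule H01_L2[OF zero_graph(1)])
  have "Phi \<Omega> aa c0 yd yr \<alpha> \<beta> ua ub lam_s p_s mu_s \<le> Phi \<Omega> aa c0 yd yr \<alpha> \<beta> ua ub (\<lambda>x. 0) (\<lambda>x. 0) (\<lambda>x. 0)"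
    using sol(4) z zero_graph(1) by simp
  also have "\<dots> < \<infinity>"
    using data(6) by (subst Phi_finite[OF data(1,2) z zero_graph(1) z zero_graph(2)]) auto
  finally have "Phi \<Omega> aa c0 yd yr \<alpha> \<beta> ua ub lam_s p_s mu_s \<noteq> \<infinity>" by (rule less_imp_neq)
  moreover have "Phi \<Omega> aa c0 yd yr \<alpha> \<beta> ua ub lam_s p_s mu_s = \<infinity>"
    if "\<not> ((\<exists>f. AstarL2 \<Omega> aa c0 p_s f) \<and> (AE x in lebesgue_on \<Omega>. \<bar>lam_s x\<bar> \<le> \<beta>))"
    unfolding Phi_def if_not_P[OF that] ..
  ultimately have "(\<exists>f. AstarL2 \<Omega> aa c0 p_s f) \<and> (AE x in lebesgue_on \<Omega>. \<bar>lam_s x\<bar> \<le> \<beta>)"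
    by (rule contrapos_np)
  then have fin: "\<exists>f. AstarL2 \<Omega> aa c0 p_s f" "AE x in lebesgue_on \<Omega>. \<bar>lam_s x\<bar> \<le> \<beta>"
    by (rule conjunct1, rule conjunct2)
  then obtain fs where fs: "AstarL2 \<Omega> aa c0 p_s fs" by (elim exE)

  obtain R AR where R: "linear R" "\<forall>h. is_resolvent \<alpha> h (R h) (AR h)"
    using resolvent_exists[OF \<alpha>] by (elim exE conjE)
  let ?e = "emb \<Omega>" and ?A = "\<lambda>q. emb \<Omega> (Astar \<Omega> aa c0 q)"

  \<comment> \<open>The variational inequality of the pointwise projection, integrated over the
    domain.\<close>
  have ii: "(?e (lam k) + ?e (mt k) - ?e (ph k)) \<bullet> (?e l - ?e (lam k)) \<ge> 0"
    if "k \<ge> 1" "L2 \<Omega> l" "AE x in lebesgue_on \<Omega>. \<bar>l x\<bar> \<le> \<beta>" for k l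
  proof -
    note a = L2_add[OF \<Omega>(1) Lk(3)[OF that(1)] Lk(2)[OF that(1)]]
    note d = L2_diff[OF \<Omega>(1) a(1) Lph[OF that(1)]]
    note e = L2_diff[OF \<Omega>(1) that(2) Lk(3)[OF that(1)]]
    have "0 \<le> ipL2 \<Omega> (\<lambda>x. lam k x + mt k x - ph k x) (\<lambda>x. l x - lam k x)"
      unfolding ipL2_def
    proof (rule integral_nonneg_AE, use that(3) in eventually_elim)
      case (elim x)
      have "0 \<le> (proj (- \<beta>) \<beta> (ph k x - mt k x) - (ph k x - mt k x)) * (l x - proj (- \<beta>) \<beta> (ph k x - mt k x))"
        using elim by (intro proj_variational) (simp_all add: abs_le_iff)
      then show ?case using step_ii that(1) by (simp add: algebra_simps)
    qed
    then show ?thesis by (simp add: inner_emb[OF \<Omega>(1) d(1) e(1), symmetric] a(2) d(2) e(2))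
  qed
  \<comment> \<open>The residual of step (iv) divided by \<open>\<alpha>\<close> is exactly
    \<open>uk k\<close>.\<close>
  have iv: "dstar_Uad \<Omega> ua ub m \<ge> dstar_Uad \<Omega> ua ub (mu k)
      + (?e (p k) - ?e (lam k) - ?e (mu k)) \<bullet> (?e m - ?e (mu k)) / \<alpha>"
    if "k \<ge> 1" "L2 \<Omega> m" for k m
  proof -
    note d = L2_diff[OF \<Omega>(1) Lp[OF that(1)] Lk(3)[OF that(1)]]
    note c = L2_cmult[OF \<Omega>(1) Lk(5)[OF that(1)], of \<alpha>]
    note e = L2_diff[OF \<Omega>(1) that(2) Lk(4)[OF that(1)]]
    have "?e (mu k) = ?e (p k) - ?e (lam k) - \<alpha> *\<^sub>R ?e (uk k)"
      unfolding muk[OF that(1)] by (simp add: L2_diff(2)[OF \<Omega>(1) d(1) c(1)] d(2) c(2))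
    then have "(?e (p k) - ?e (lam k) - ?e (mu k)) \<bullet> (?e m - ?e (mu k)) / \<alpha> = ipL2 \<Omega> (uk k) (\<lambda>x. m x - mu k x)"
      using \<alpha> by (simp add: inner_emb[OF \<Omega>(1) Lk(5)[OF that(1)] e(1), symmetric] e(2))
    moreover have "dstar_Uad \<Omega> ua ub (mu k) + ipL2 \<Omega> (uk k) (\<lambda>x. m x - mu k x) \<le> dstar_Uad \<Omega> ua ub m"
    proof (rule dstar_Uad_subgradient[OF \<Omega> Lk(5)[OF that(1)] Lk(4)[OF that(1)] that(2)])
      fix x
      show "ua \<le> uk k x" "uk k x \<le> ub" unfolding uk_def by (rule proj_range[OF uab])+
      show "uk k x * mu k x = max (ua * mu k x) (ub * mu k x)"
        unfolding uk_def by (rule proj_support_function[OF uab \<alpha>]) (simp add: muk[OF that(1)] uk_def)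
    qed
    ultimately show ?thesis by simp
  qed

  have rate: "(1/2 * (norm (?A (p k) - ?e yd))\<^sup>2 + 1/(2*\<alpha>) * (norm (?e (p k) - ?e (lam k) - ?e (mu k)))\<^sup>2
        + ?e (p k) \<bullet> ?e yr + dstar_Uad \<Omega> ua ub (mu k))
      - (1/2 * (norm (?A p_s - ?e yd))\<^sup>2 + 1/(2*\<alpha>) * (norm (?e p_s - ?e lam_s - ?e mu_s))\<^sup>2
        + ?e p_s \<bullet> ?e yr + dstar_Uad \<Omega> ua ub mu_s)
      \<le> 4 * (1/(2*\<alpha>) * ((?e lam_s - ?e (lam 0)) \<bullet> R (?e lam_s - ?e (lam 0)))
            + 1/(2*\<alpha>) * (norm (?e mu_s - ?e (mu 0)))\<^sup>2) / (real k + 1)\<^sup>2"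
  proof (rule mabcd_rate[where G = graph and AR = AR and R = R and ph = "\<lambda>k. ?e (ph k)" and aph = "\<lambda>k. ?A (ph k)"
        and p = "\<lambda>k. ?e (p k)" and ap = "\<lambda>k. ?A (p k)" and lam = "\<lambda>k. ?e (lam k)" and mu = "\<lambda>k. ?e (mu k)"
        and lt = "\<lambda>k. ?e (lt k)" and mt = "\<lambda>k. ?e (mt k)" and s = "\<lambda>k. dstar_Uad \<Omega> ua ub (mu k)"])
    show "(R f, AR f) \<in> graph" for f using R(2) by (simp add: is_resolvent_def)
    show "\<alpha> * (AR f \<bullet> av) + (R f - f) \<bullet> v = 0" if "(v, av) \<in> graph" for f v av
      using R(2) that unfolding is_resolvent_def by blast
    show "(?e p_s, ?A p_s) \<in> graph" by (rule graph_I[OF sol(2) AstarL2_Astar[OF fs]])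
    fix k :: nat assume k: "k \<ge> 1"
    show "(?e (ph k), ?A (ph k)) \<in> graph" "(?e (p k), ?A (p k)) \<in> graph"
      using step_i step_iii k argmin_in_graph(3) by blast+
    show "(?A (ph k) - ?e yd) \<bullet> av + (?e (ph k) - ?e (lt k) - ?e (mt k)) \<bullet> v / \<alpha> + v \<bullet> ?e yr = 0"
      if "(v, av) \<in> graph" for v av
    proof -
      note a = L2_add[OF \<Omega>(1) Lk(1)[OF k] Lk(2)[OF k]]
      from argmin_euler[OF \<alpha> data(1,2) a(1) step_i[rule_format, OF k] that]
      show ?thesis by (simp add: a(2) diff_diff_eq)
    qed
    show "(?A (p k) - ?e yd) \<bullet> av + (?e (p k) - ?e (lam k) - ?e (mt k)) \<bullet> v / \<alpha> + v \<bullet> ?e yr = 0"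
      if "(v, av) \<in> graph" for v av
    proof -
      note a = L2_add[OF \<Omega>(1) Lk(3)[OF k] Lk(2)[OF k]]
      from argmin_euler[OF \<alpha> data(1,2) a(1) step_iii[rule_format, OF k] that]
      show ?thesis by (simp add: a(2) diff_diff_eq)
    qed
    show "(?e (lam k) + ?e (mt k) - ?e (ph k)) \<bullet> (?e (lam j) - ?e (lam k)) \<ge> 0" if "j \<ge> 1" for j
      by (rule ii[OF k Lk(3)[OF that]]) (simp add: lam_range[OF that])
    show "(?e (lam k) + ?e (mt k) - ?e (ph k)) \<bullet> (?e lam_s - ?e (lam k)) \<ge> 0"
      by (rule ii[OF k sol(1) fin(2)])
    show "dstar_Uad \<Omega> ua ub (mu k) + (?e (p k) - ?e (lam k) - ?e (mu k)) \<bullet> (?e (mu j) - ?e (mu k)) / \<alpha>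
        \<le> dstar_Uad \<Omega> ua ub (mu j)" if "j \<ge> 1" for j
      by (rule iv[OF k Lk(4)[OF that]])
    show "dstar_Uad \<Omega> ua ub (mu k) + (?e (p k) - ?e (lam k) - ?e (mu k)) \<bullet> (?e mu_s - ?e (mu k)) / \<alpha>
        \<le> dstar_Uad \<Omega> ua ub mu_s"
      by (rule iv[OF k sol(3)])
    have extrapolation: "?e (\<lambda>x. f x + c * (f x - g x)) = ?e f + c *\<^sub>R (?e f - ?e g)" if "L2 \<Omega> f" "L2 \<Omega> g" for f g c
      using L2_add(2)[OF \<Omega>(1) that(1) L2_cmult(1)[OF \<Omega>(1) L2_diff(1)[OF \<Omega>(1) that]]]
        L2_cmult(2)[OF \<Omega>(1) L2_diff(1)[OF \<Omega>(1) that]] L2_diff(2)[OF \<Omega>(1) that] by simp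
    show "?e (lt (Suc k)) = ?e (lam k) + bk k *\<^sub>R (?e (lam k) - ?e (lam (k - 1)))"
      unfolding step_v(1)[rule_format, OF k] by (rule extrapolation[OF L0(1) L0(1)])
    show "?e (mt (Suc k)) = ?e (mu k) + bk k *\<^sub>R (?e (mu k) - ?e (mu (k - 1)))"
      unfolding step_v(3)[rule_format, OF k] by (rule extrapolation[OF L0(2) L0(2)])
  qed (use \<alpha> R(1) subspace_graph start k in auto)

  \<comment> \<open>Both values are finite, so the extended real difference is an ordinary one and
    the common constant in \<open>yd\<close> cancels.\<close>
  have PhiK: "Phi \<Omega> aa c0 yd yr \<alpha> \<beta> ua ub (lam k) (p k) (mu k) = ereal
      (1/2 * (norm (?A (p k) - ?e yd))\<^sup>2 + 1/(2*\<alpha>) * (norm (?e (p k) - ?e (lam k) - ?e (mu k)))\<^sup>2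
        + ?e (p k) \<bullet> ?e yr + dstar_Uad \<Omega> ua ub (mu k) - 1/2 * (nrmL2 \<Omega> yd)\<^sup>2)"
    using argmin_in_graph[OF step_iii[rule_format, OF k]] lam_range[OF k]
    by (intro Phi_finite[OF data(1,2) Lk(3)[OF k] _ Lk(4)[OF k]]) auto
  have PhiS: "Phi \<Omega> aa c0 yd yr \<alpha> \<beta> ua ub lam_s p_s mu_s = ereal
      (1/2 * (norm (?A p_s - ?e yd))\<^sup>2 + 1/(2*\<alpha>) * (norm (?e p_s - ?e lam_s - ?e mu_s))\<^sup>2
        + ?e p_s \<bullet> ?e yr + dstar_Uad \<Omega> ua ub mu_s - 1/2 * (nrmL2 \<Omega> yd)\<^sup>2)"
    by (rule Phi_finite[OF data(1,2) sol(1-3) fs fin(2)])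
  note dl = L2_diff[OF \<Omega>(1) sol(1) init(1)] and dm = L2_diff[OF \<Omega>(1) sol(3) init(3)]
  note Rf = Rop_resolvent[OF \<alpha> dl(1) R(2)[rule_format]]
  have "ipL2 \<Omega> (\<lambda>x. lam_s x - lam0 x) (Rop \<Omega> aa c0 \<alpha> (\<lambda>x. lam_s x - lam0 x))
      = (?e lam_s - ?e (lam 0)) \<bullet> R (?e lam_s - ?e (lam 0))"
    unfolding inner_emb[OF \<Omega>(1) dl(1) Rf(1), symmetric] Rf(2) dl(2) start(1) ..
  moreover have "nrmL2 \<Omega> (\<lambda>x. mu_s x - mu0 x) = norm (?e mu_s - ?e (mu 0))"
    unfolding norm_emb[OF \<Omega>(1) dm(1), symmetric] dm(2) start(3) ..
  ultimately show "Phi \<Omega> aa c0 yd yr \<alpha> \<beta> ua ub (lam k) (p k) (mu k)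
       - Phi \<Omega> aa c0 yd yr \<alpha> \<beta> ua ub lam_s p_s mu_s
     \<le> ereal (4 * (1/(2*\<alpha>) * ipL2 \<Omega> (\<lambda>x. lam_s x - lam0 x)
                                  (Rop \<Omega> aa c0 \<alpha> (\<lambda>x. lam_s x - lam0 x))
                   + 1/(2*\<alpha>) * (nrmL2 \<Omega> (\<lambda>x. mu_s x - mu0 x))\<^sup>2)
               / (real k + 1)\<^sup>2)"
    unfolding PhiK PhiS using rate by simp
qed

end
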